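(* Let $np=d\log n$ with $d=d(n)$, let $\gamma=np-\log n$, and let $m=n(n-1)p$. If $\gamma=\omega(\log\log n)$ (that is, $\gamma/\log\log n\to\infty$), then with high probability $\varsigma^*(v)=o(\deg^-(v))$ for all vertices $v$ of $D_{n,p}$, where $$\varsigma^*(v)=\max_{w\in N^-(v)}\left\{\frac{\deg^-(w)}{\deg^+(w)}\right\}.$$ In particular, when $d=1+\delta$ with $\delta>0$ constant, with high probability the minimum out-degree of $D_{n,p}$ is $\Omega(\log n)$, and the stationary distribution $\pi$ of the simple random walk on $D_{n,p}$ satisfies $\pi_v\sim\deg^-(v)/m$ for all $v\in V$.
   Context: $D_{n,p}$ is the random digraph with vertex set $V=[n]$ in which each directed edge $(i,j)$, $i\neq j$, is included independently with probability $p=p(n)$. $\deg^-(v)$ and $\deg^+(v)$ are the in-degree and out-degree of $v$, and $N^-(v)$ is the set of in-neighbours of $v$. The simple random walk moves at each step to a uniformly random out-neighbour of the current vertex; $\pi$ is its stationary distribution. $\log$ is the natural logarithm. "With high probability" means with probability tending to $1$ as $n\to\infty$, in the space of $D_{n,p}$. The $o(\cdot)$ and $\sim$ are uniform over vertices: there is $\epsilon_n\to0$ such that with high probability $\varsigma^*(v)\le\epsilon_n\deg^-(v)$ (respectively $|\pi_v m/\deg^-(v)-1|\le\epsilon_n$) for all $v\in V$ simultaneously. *)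

theory Defs
  imports "HOL-Probability.Probability" "Graph_Theory.Pair_Digraph"
begin

definition random_digraph :: "nat \<Rightarrow> real \<Rightarrow> nat pair_pre_digraph pmf" where
  "random_digraph n p =
     (let S = {(i, j). i \<in> {1..n} \<and> j \<in> {1..n} \<and> i \<noteq> j} in
      map_pmf (\<lambda>f. \<lparr>pverts = {1..n}, parcs = {e \<in> S. f e}\<rparr>)
        (Pi_pmf S False (\<lambda>_. bernoulli_pmf p)))"

definition with_high_probability ::
  "(nat \<Rightarrow> real) \<Rightarrow> (nat \<Rightarrow> nat pair_pre_digraph \<Rightarrow> bool) \<Rightarrow> bool" where
  "with_high_probability p P \<longleftrightarrow>
     (\<lambda>n. measure_pmf.prob (random_digraph n (p n)) {D. P n D}) \<longlonglongrightarrow> 1"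

definition indeg :: "'a pair_pre_digraph \<Rightarrow> 'a \<Rightarrow> nat" where
  "indeg D v = in_degree (with_proj D) v"

definition outdeg :: "'a pair_pre_digraph \<Rightarrow> 'a \<Rightarrow> nat" where
  "outdeg D v = out_degree (with_proj D) v"

definition min_outdeg :: "'a pair_pre_digraph \<Rightarrow> nat" where
  "min_outdeg D = Min (outdeg D ` pverts D)"

definition in_nbrs :: "'a pair_pre_digraph \<Rightarrow> 'a \<Rightarrow> 'a set" where
  "in_nbrs D v = {w. (w, v) \<in> parcs D}"

definition out_nbrs :: "'a pair_pre_digraph \<Rightarrow> 'a \<Rightarrow> 'a set" where
  "out_nbrs D v = {w. (v, w) \<in> parcs D}"

text \<open>Meaningful only if \<open>v\<close> has an in-neighbour: \<open>Max {}\<close> is unspecified.\<close>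

definition varsigma_star :: "'a pair_pre_digraph \<Rightarrow> 'a \<Rightarrow> real" where
  "varsigma_star D v = Max ((\<lambda>w. real (indeg D w) / real (outdeg D w)) ` in_nbrs D v)"

text \<open>A vertex without out-neighbours has no move; by convention the walk stays there.\<close>

definition walk_step :: "'a pair_pre_digraph \<Rightarrow> 'a \<Rightarrow> 'a pmf" where
  "walk_step D v = (if out_nbrs D v = {} then return_pmf v else pmf_of_set (out_nbrs D v))"

definition is_stationary :: "'a pair_pre_digraph \<Rightarrow> 'a pmf \<Rightarrow> bool" where
  "is_stationary D \<pi> \<longleftrightarrow> set_pmf \<pi> \<subseteq> pverts D \<and> bind_pmf \<pi> (walk_step D) = \<pi>"

end

theory Submission
  imports Defs "HOL-Real_Asymp.Real_Asymp"
begin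

text \<open>
  The bound on \<open>\<varsigma>\<^sup>*\<close> is a first-moment argument: since all in-degrees are \<open>O(np)\<close>, it fails
  only if some arc \<open>(w, v)\<close> has \<open>deg\<^sup>+(w) deg\<^sup>-(v) = O(np)\<close>, that is, if one of the two degrees is
  bounded or both are at most a small multiple of \<open>np\<close>.

  For the stationary distribution, a second-moment computation over simple paths shows that from
  most starting vertices the walk is close to uniform in total variation after
  \<open>t = O(log n / log log n)\<close> steps. As all out-degrees are \<open>\<Omega>(log n)\<close>, the walk visits a given vertex
  within \<open>t\<close> steps with probability \<open>O(t / log n) = o(1)\<close>, so this property hardly depends on the
  arcs leaving a fixed vertex \<open>x\<close>. Hence the random out-neighbourhood of \<open>x\<close> is independent of the
  (few) bad vertices and meets them rarely, and the walk mixes from every vertex.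
  In the same way, after deleting the arcs into \<open>v\<close>, the stationary distribution changes little at the
  other vertices and is independent of the in-neighbourhood of \<open>v\<close>. As it is almost
  uniform at most vertices, averaging it over the in-neighbours of \<open>v\<close> gives \<open>\<pi>\<^sub>v \<sim> deg\<^sup>-(v) / m\<close>.
\<close>

section \<open>Random subsets\<close>

text \<open>For a single start vertex the second moment bounds the probability of poor mixing by
  something that tends to 0 far more slowly than \<open>1 / n\<close>, so a union bound over start
  vertices is out of reach. Leaving one vertex out amplifies it: few vertices are bad, and a fresh
  out-neighbourhood contains more than a small proportion of them only with probability
  \<open>exp (- 2 * np)\<close>, which survives the union bound. The price is one more step of the
  walk. Simple paths are used because they leave each vertex at most once: their weights are then
  products over independent rows of the transition matrix. A small out-degree would spoil the
  moments, so the kernel is cut off at out-degree \<open>k\<close>; the moment bounds then hold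
  unconditionally, and the cut-off kernel is exchanged for the walk only outside a negligible event.
  Mixing in total variation does not control the mass of one vertex. The pointwise estimate for
  \<pi> has an error term containing the maximum of \<pi>; evaluating the estimate at a vertex where
  the maximum is attained bounds that maximum.\<close>

definition random_subset :: "'a set \<Rightarrow> real \<Rightarrow> 'a set pmf" where
  "random_subset S p = map_pmf (\<lambda>f. {e \<in> S. f e}) (Pi_pmf S False (\<lambda>_. bernoulli_pmf p))"

lemma set_pmf_random_subset: "set_pmf (random_subset S p) \<subseteq> Pow S"
  by (auto simp: random_subset_def)

lemma finite_set_pmf_random_subset:
  "finite S \<Longrightarrow> finite (set_pmf (random_subset S p))"
  by (meson finite_Pow_iff finite_subset set_pmf_random_subset)

lemma random_subset_Un:
  assumes "finite A" "finite B" "A \<inter> B = {}"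
  shows "random_subset (A \<union> B) p =
    map_pmf (\<lambda>(X, Y). X \<union> Y) (pair_pmf (random_subset A p) (random_subset B p))"
proof -
  have "random_subset (A \<union> B) p = map_pmf (\<lambda>(f, g). {e \<in> A \<union> B. if e \<in> A then f e else g e})
     (pair_pmf (Pi_pmf A False (\<lambda>_. bernoulli_pmf p)) (Pi_pmf B False (\<lambda>_. bernoulli_pmf p)))"
    by (simp add: random_subset_def Pi_pmf_union[OF assms] pmf.map_comp o_def case_prod_unfold)
  also have "\<dots> = map_pmf (\<lambda>(f, g). {e \<in> A. f e} \<union> {e \<in> B. g e})
     (pair_pmf (Pi_pmf A False (\<lambda>_. bernoulli_pmf p)) (Pi_pmf B False (\<lambda>_. bernoulli_pmf p)))"
    using assms(3) by (intro map_pmf_cong) auto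
  also have "\<dots> = map_pmf (\<lambda>(X, Y). X \<union> Y) (pair_pmf (random_subset A p) (random_subset B p))"
    by (simp add: random_subset_def map_pair[symmetric] pmf.map_comp o_def case_prod_unfold)
  finally show ?thesis .
qed

lemma expectation_random_subset_Un:
  fixes F G :: "'a set \<Rightarrow> real"
  assumes "finite S" "T \<subseteq> S"
  shows "measure_pmf.expectation (random_subset S p) (\<lambda>X. F (X \<inter> T) * G (X - T)) =
    measure_pmf.expectation (random_subset T p) F * measure_pmf.expectation (random_subset (S - T) p) G"
proof -
  have fin: "finite T" "finite (S - T)"
    using assms finite_subset by auto
  let ?M = "random_subset T p" and ?N = "random_subset (S - T) p"
  have "random_subset S p = map_pmf (\<lambda>(X, Y). X \<union> Y) (pair_pmf ?M ?N)"
    using random_subset_Un[OF fin, of p] assms(2) by (auto simp: Un_absorb1)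
  hence "measure_pmf.expectation (random_subset S p) (\<lambda>X. F (X \<inter> T) * G (X - T)) =
    measure_pmf.expectation (pair_pmf ?M ?N) (\<lambda>(X, Y). F ((X \<union> Y) \<inter> T) * G ((X \<union> Y) - T))"
    by (simp add: case_prod_unfold)
  also have "\<dots> = (\<Sum>XY \<in> set_pmf ?M \<times> set_pmf ?N. 
     (F ((fst XY \<union> snd XY) \<inter> T) * G ((fst XY \<union> snd XY) - T)) * pmf (pair_pmf ?M ?N) XY)"
    using finite_set_pmf_random_subset[OF fin(1)] finite_set_pmf_random_subset[OF fin(2)]
    by (subst integral_measure_pmf_real[where A = "set_pmf ?M \<times> set_pmf ?N"])
       (auto simp: case_prod_unfold)
  also have "\<dots> = (\<Sum>XY \<in> set_pmf ?M \<times> set_pmf ?N. (F (fst XY) * pmf ?M (fst XY)) * (G (snd XY) * pmf ?N (snd XY)))"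
  proof (rule sum.cong)
    fix XY assume "XY \<in> set_pmf ?M \<times> set_pmf ?N"
    then obtain X Y where XY: "XY = (X, Y)" "X \<in> set_pmf ?M" "Y \<in> set_pmf ?N" by auto
    have "X \<subseteq> T" "Y \<subseteq> S - T"
      using XY set_pmf_random_subset[of T p] set_pmf_random_subset[of "S - T" p] by auto
    hence "(X \<union> Y) \<inter> T = X" "(X \<union> Y) - T = Y" by auto
    thus "F ((fst XY \<union> snd XY) \<inter> T) * G ((fst XY \<union> snd XY) - T) * pmf (pair_pmf ?M ?N) XY =
      (F (fst XY) * pmf ?M (fst XY)) * (G (snd XY) * pmf ?N (snd XY))"
      by (simp add: XY(1) pmf_pair)
  qed auto
  also have "\<dots> = (\<Sum>X\<in>set_pmf ?M. F X * pmf ?M X) * (\<Sum>Y\<in>set_pmf ?N. G Y * pmf ?N Y)"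
    by (simp add: sum_product sum.cartesian_product case_prod_unfold)
  also have "\<dots> = measure_pmf.expectation ?M F * measure_pmf.expectation ?N G"
    using finite_set_pmf_random_subset[OF fin(1)] finite_set_pmf_random_subset[OF fin(2)]
    by (subst (1 2) integral_measure_pmf_real[where A = "set_pmf _"]) auto
  finally show ?thesis .
qed

lemma expectation_random_subset_Int:
  fixes F :: "'a set \<Rightarrow> real"
  assumes "finite S" "T \<subseteq> S"
  shows "measure_pmf.expectation (random_subset S p) (\<lambda>X. F (X \<inter> T)) =
    measure_pmf.expectation (random_subset T p) F"
  using expectation_random_subset_Un[OF assms, of p F "\<lambda>_. 1"] by simp

lemma expectation_random_subset_prod:
  fixes F :: "'i \<Rightarrow> 'a set \<Rightarrow> real"
  assumes "finite I" "finite S" "\<And>i. i \<in> I \<Longrightarrow> T i \<subseteq> S" "disjoint_family_on T I"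
  shows "measure_pmf.expectation (random_subset S p) (\<lambda>X. \<Prod>i\<in>I. F i (X \<inter> T i)) =
    (\<Prod>i\<in>I. measure_pmf.expectation (random_subset S p) (\<lambda>X. F i (X \<inter> T i)))"
  using assms
proof (induction I arbitrary: S rule: finite_induct)
  case empty
  then show ?case by simp
next
  case (insert i I)
  let ?S = "S - T i"
  have Ti: "T i \<subseteq> S" and fS: "finite ?S" using insert.prems by auto
  have disj: "T j \<inter> T i = {}" if "j \<in> I" for j
    using insert.prems(3) insert.hyps that by (auto simp: disjoint_family_on_def)
  have sub: "T j \<subseteq> ?S" if "j \<in> I" for j
    using disj[OF that] insert.prems(2)[of j] that by auto
  have eq: "(X - T i) \<inter> T j = X \<inter> T j" if "j \<in> I" for j X
    using disj[OF that] by auto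
  have "measure_pmf.expectation (random_subset S p) (\<lambda>X. \<Prod>i\<in>insert i I. F i (X \<inter> T i)) =
    measure_pmf.expectation (random_subset S p) (\<lambda>X. F i (X \<inter> T i) * (\<Prod>j\<in>I. F j ((X - T i) \<inter> T j)))"
    using insert.hyps by (simp add: eq cong: prod.cong)
  also have "\<dots> = measure_pmf.expectation (random_subset (T i) p) (F i) *
      measure_pmf.expectation (random_subset ?S p) (\<lambda>X. \<Prod>j\<in>I. F j (X \<inter> T j))"
    by (rule expectation_random_subset_Un[OF insert.prems(1) Ti])
  also have "measure_pmf.expectation (random_subset ?S p) (\<lambda>X. \<Prod>j\<in>I. F j (X \<inter> T j)) =
     (\<Prod>j\<in>I. measure_pmf.expectation (random_subset ?S p) (\<lambda>X. F j (X \<inter> T j)))"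
    using insert.IH[OF fS sub] insert.prems(3)
    by (auto simp: disjoint_family_on_def)
  also have "\<dots> = (\<Prod>j\<in>I. measure_pmf.expectation (random_subset S p) (\<lambda>X. F j (X \<inter> T j)))"
    using insert.prems sub fS
    by (intro prod.cong) (auto simp: expectation_random_subset_Int)
  also have "measure_pmf.expectation (random_subset (T i) p) (F i) = 
      measure_pmf.expectation (random_subset S p) (\<lambda>X. F i (X \<inter> T i))"
    using expectation_random_subset_Int[OF insert.prems(1) Ti] by simp
  finally show ?case using insert.hyps by simp
qed

lemma prob_random_subset_conditional_le:
  assumes "finite S" "T \<subseteq> S"
    and "\<And>Y. Y \<subseteq> S - T \<Longrightarrow> measure_pmf.prob (random_subset T p) {X. Q (X \<union> Y)} \<le> c"
  shows "measure_pmf.prob (random_subset S p) {X. Q X} \<le> c"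
proof -
  have fin: "finite T" "finite (S - T)"
    using assms finite_subset by auto
  let ?M = "random_subset T p" and ?N = "random_subset (S - T) p"
  have "random_subset S p = random_subset ((S - T) \<union> T) p"
    using assms(2) by (simp add: Un_absorb2)
  also have "\<dots> = map_pmf (\<lambda>(Y, X). Y \<union> X) (pair_pmf ?N ?M)"
    by (rule random_subset_Un[OF fin(2,1)]) auto
  also have "\<dots> = bind_pmf ?N (\<lambda>Y. map_pmf (\<lambda>X. X \<union> Y) ?M)"
    by (simp add: pair_pmf_def map_bind_pmf map_pmf_def bind_assoc_pmf bind_return_pmf Un_commute)
  finally have eq: "random_subset S p = bind_pmf ?N (\<lambda>Y. map_pmf (\<lambda>X. X \<union> Y) ?M)" .
  have "measure_pmf.prob (random_subset S p) {X. Q X} = 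
      measure_pmf.expectation ?N (\<lambda>Y. measure_pmf.prob ?M {X. Q (X \<union> Y)})"
    unfolding eq measure_pmf_bind
    by (subst measure_pmf.measure_bind[where N = "count_space UNIV"])
       (auto simp: measure_pmf_in_subprob_algebra vimage_def)
  also have "\<dots> \<le> measure_pmf.expectation ?N (\<lambda>_. c)"
    using set_pmf_random_subset[of "S - T" p] assms(3)
    by (intro integral_mono_AE integrable_measure_pmf_finite finite_set_pmf_random_subset fin)
       (auto simp: AE_measure_pmf_iff)
  finally show ?thesis by simp
qed

section \<open>Exponential moments and tail bounds\<close>

lemma expectation_random_subset_power_card:
  fixes p s :: real
  assumes "finite S" "W \<subseteq> S" "W0 \<subseteq> S" "W0 \<inter> W = {}" "0 \<le> p" "p \<le> 1" "0 \<le> s"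
  shows "measure_pmf.expectation (random_subset S p) (\<lambda>X. of_bool (W0 \<subseteq> X) * s ^ card (W \<inter> X)) =
    p ^ card W0 * (1 - p + p * s) ^ card W"
proof -
  define g where "g e b = (if e \<in> W0 then of_bool b else if e \<in> W then (if b then s else 1) else (1::real))"
    for e b
  have fin: "finite W" "finite W0"
    using finite_subset[OF assms(2,1)] finite_subset[OF assms(3,1)] by auto
  have *: "of_bool (W0 \<subseteq> {e\<in>S. f e}) * s ^ card (W \<inter> {e\<in>S. f e}) = (\<Prod>e\<in>S. g e (f e))" for f
  proof -
    have "(\<Prod>e\<in>S. g e (f e)) = (\<Prod>e\<in>W0 \<union> W. g e (f e))"
      by (rule prod.mono_neutral_right) (use assms in \<open>auto simp: g_def\<close>)
    also have "\<dots> = (\<Prod>e\<in>W0. g e (f e)) * (\<Prod>e\<in>W. g e (f e))"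
      by (rule prod.union_disjoint) (use fin assms in auto)
    also have "(\<Prod>e\<in>W0. g e (f e)) = (\<Prod>e\<in>W0. of_bool (f e))"
      by (simp add: g_def)
    also have "\<dots> = of_bool (W0 \<subseteq> {e\<in>S. f e})"
      using fin(2) assms(3)
    proof (induction W0 rule: finite_induct)
      case (insert e W0)
      then show ?case by (auto simp del: Collect_conj_eq)
    qed simp
    also have "(\<Prod>e\<in>W. g e (f e)) = (\<Prod>e\<in>W. if f e then s else 1)"
      using assms(4) by (intro prod.cong) (auto simp: g_def)
    also have "\<dots> = (\<Prod>e\<in>W \<inter> {e. f e}. s)"
      using fin by (subst prod.inter_restrict) auto
    also have "\<dots> = s ^ card (W \<inter> {e\<in>S. f e})"
      using assms(2) by (simp, intro arg_cong[where f = "\<lambda>x. s ^ card x"]) auto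
    finally show ?thesis by simp
  qed
  have "measure_pmf.expectation (random_subset S p) (\<lambda>X. of_bool (W0 \<subseteq> X) * s ^ card (W \<inter> X)) =
    measure_pmf.expectation (Pi_pmf S False (\<lambda>_. bernoulli_pmf p)) (\<lambda>f. \<Prod>e\<in>S. g e (f e))"
    by (simp add: random_subset_def *)
  also have "\<dots> = (\<Prod>e\<in>S. measure_pmf.expectation (bernoulli_pmf p) (g e))"
    using assms by (intro expectation_prod_Pi_pmf integrable_measure_pmf_finite) (auto simp: g_def)
  also have "\<dots> = (\<Prod>e\<in>W0 \<union> W. measure_pmf.expectation (bernoulli_pmf p) (g e))"
    by (rule prod.mono_neutral_right) (use assms in \<open>auto simp: g_def\<close>)
  also have "\<dots> = (\<Prod>e\<in>W0. measure_pmf.expectation (bernoulli_pmf p) (g e)) *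
       (\<Prod>e\<in>W. measure_pmf.expectation (bernoulli_pmf p) (g e))"
    by (rule prod.union_disjoint) (use fin assms in auto)
  also have "(\<Prod>e\<in>W0. measure_pmf.expectation (bernoulli_pmf p) (g e)) = (\<Prod>e\<in>W0. p)"
    using assms(5,6) by (intro prod.cong) (auto simp: g_def)
  also have "(\<Prod>e\<in>W. measure_pmf.expectation (bernoulli_pmf p) (g e)) = (\<Prod>e\<in>W. 1 - p + p * s)"
    using assms(4-6) by (intro prod.cong) (auto simp: g_def)
  finally show ?thesis by simp
qed

lemma prob_le_expectation_div:
  fixes F :: "'a \<Rightarrow> real"
  assumes "finite (set_pmf M)" "\<And>x. x \<in> set_pmf M \<Longrightarrow> F x \<ge> 0"
    and "\<And>x. x \<in> set_pmf M \<Longrightarrow> Q x \<Longrightarrow> c \<le> F x" "c > 0"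
  shows "measure_pmf.prob M {x. Q x} \<le> measure_pmf.expectation M F / c"
proof -
  have "measure_pmf.prob M {x. Q x} = measure_pmf.expectation M (indicator {x. Q x})"
    by simp
  also have "\<dots> \<le> measure_pmf.expectation M (\<lambda>x. F x / c)"
    using assms by (intro integral_mono_AE integrable_measure_pmf_finite)
      (auto simp: AE_measure_pmf_iff indicator_def field_simps)
  finally show ?thesis by simp
qed

text \<open>Markov's inequality for \<open>s ^ card (W \<inter> X)\<close> on the event
  \<open>W0 \<subseteq> X\<close>, with \<open>1 - u \<le> exp (- u)\<close>. Comparing powers of
  \<open>s\<close> instead of \<open>k\<close> with the cardinality treats both tails at once:
  \<open>s > 1\<close> gives the upper and \<open>s < 1\<close> the lower one. The forced set
  \<open>W0\<close> serves events that also ask for a given arc to be present.\<close>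

lemma prob_random_subset_chernoff:
  fixes p s k :: real
  assumes "finite S" "W \<subseteq> S" "W0 \<subseteq> S" "W0 \<inter> W = {}" "0 \<le> p" "p \<le> 1" "0 < s"
    and "\<And>X. X \<subseteq> S \<Longrightarrow> Q X \<Longrightarrow> W0 \<subseteq> X \<and> s powr k \<le> s ^ card (W \<inter> X)"
  shows "measure_pmf.prob (random_subset S p) {X. Q X} \<le>
    p ^ card W0 * exp (- k * ln s - card W * p * (1 - s))"
proof -
  have "measure_pmf.prob (random_subset S p) {X. Q X} \<le>
     measure_pmf.expectation (random_subset S p) (\<lambda>X. of_bool (W0 \<subseteq> X) * s ^ card (W \<inter> X)) / (s powr k)"
  proof (intro prob_le_expectation_div finite_set_pmf_random_subset)
    fix X assume "X \<in> set_pmf (random_subset S p)" "Q X"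
    moreover from this have "X \<subseteq> S"
      using set_pmf_random_subset[of S p] by auto
    ultimately show "s powr k \<le> of_bool (W0 \<subseteq> X) * s ^ card (W \<inter> X)"
      using assms(8) by auto
  qed (use assms in auto)
  also have "\<dots> = p ^ card W0 * (1 - p + p * s) ^ card W / (s powr k)"
    using assms by (subst expectation_random_subset_power_card) auto
  also have "\<dots> \<le> p ^ card W0 * exp (- p * (1 - s)) ^ card W / (s powr k)"
  proof (intro divide_right_mono mult_left_mono power_mono)
    show "1 - p + p * s \<le> exp (- p * (1 - s))"
      using exp_ge_add_one_self[of "- p * (1 - s)"] by (simp add: algebra_simps)
    have "p * s \<ge> 0" using assms by simp
    thus "0 \<le> 1 - p + p * s" using assms by linarith
  qed (use assms in auto)
  also have "\<dots> = p ^ card W0 * exp (- k * ln s - card W * p * (1 - s))"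
  proof -
    have "exp (- p * (1 - s)) ^ card W / (s powr k) = exp (card W * (- p * (1 - s))) / exp (k * ln s)"
      using assms(7) by (simp only: powr_def exp_of_nat_mult) simp
    also have "\<dots> = exp (- k * ln s - card W * p * (1 - s))"
      by (subst exp_diff[symmetric]) (simp add: algebra_simps)
    finally show ?thesis by (simp only: times_divide_eq_right[symmetric])
  qed
  finally show ?thesis .
qed

lemma prob_random_subset_card_ge:
  fixes p s k :: real and S :: "'a set"
  assumes "finite S" "W \<subseteq> S" "0 \<le> p" "p \<le> 1" "1 \<le> s"
    and "\<And>X. X \<subseteq> S \<Longrightarrow> Q X \<Longrightarrow> k \<le> card (W \<inter> X)"
  shows "measure_pmf.prob (random_subset S p) {X. Q X} \<le> exp (- k * ln s - card W * p * (1 - s))"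
proof -
  have "measure_pmf.prob (random_subset S p) {X. Q X} \<le>
      p ^ card ({} :: 'a set) * exp (- k * ln s - card W * p * (1 - s))"
  proof (rule prob_random_subset_chernoff)
    fix X assume "X \<subseteq> S" "Q X"
    hence "s powr k \<le> s powr card (W \<inter> X)"
      using assms by (intro powr_mono) auto
    thus "{} \<subseteq> X \<and> s powr k \<le> s ^ card (W \<inter> X)"
      using assms(5) by (simp add: powr_realpow)
  qed (use assms in auto)
  thus ?thesis by simp
qed

lemma prob_random_subset_card_le:
  fixes p s k :: real and S :: "'a set"
  assumes "finite S" "W \<subseteq> S" "0 \<le> p" "p \<le> 1" "0 < s" "s \<le> 1"
    and "\<And>X. X \<subseteq> S \<Longrightarrow> Q X \<Longrightarrow> card (W \<inter> X) \<le> k"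
  shows "measure_pmf.prob (random_subset S p) {X. Q X} \<le> exp (- k * ln s - card W * p * (1 - s))"
proof -
  have "measure_pmf.prob (random_subset S p) {X. Q X} \<le>
      p ^ card ({} :: 'a set) * exp (- k * ln s - card W * p * (1 - s))"
  proof (rule prob_random_subset_chernoff)
    fix X assume "X \<subseteq> S" "Q X"
    hence "s powr k \<le> s powr card (W \<inter> X)"
      using assms by (intro powr_mono') auto
    thus "{} \<subseteq> X \<and> s powr k \<le> s ^ card (W \<inter> X)"
      using assms(5) by (simp add: powr_realpow)
  qed (use assms in auto)
  thus ?thesis by simp
qed

lemma prob_random_subset_leave_one_out:
  fixes W :: "'a set \<Rightarrow> 'a set" and k :: real
  assumes "finite S" "T \<subseteq> S" "0 \<le> p" "p \<le> 1" "1 \<le> s"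
    and "\<And>X. W X = W (X - T)" "\<And>X. W X \<subseteq> T"
  shows "measure_pmf.prob (random_subset S p) {X. real (card (W X)) \<le> w \<and> k \<le> card (W X \<inter> X)} \<le>
    exp (- k * ln s + w * p * (s - 1))"
proof (rule prob_random_subset_conditional_le[OF assms(1,2)])
  fix Y assume Y: "Y \<subseteq> S - T"
  have WX: "W (X \<union> Y) = W Y \<and> W Y \<inter> (X \<union> Y) = W Y \<inter> X" if "X \<subseteq> T" for X
  proof -
    have "(X \<union> Y) - T = Y - T" using that by auto
    hence "W (X \<union> Y) = W Y" using assms(6) by metis
    thus ?thesis using assms(7)[of Y] Y by auto
  qed
  show "measure_pmf.prob (random_subset T p) {X. real (card (W (X \<union> Y))) \<le> w \<and> k \<le> card (W (X \<union> Y) \<inter> (X \<union> Y))}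
     \<le> exp (- k * ln s + w * p * (s - 1))"
  proof (cases "real (card (W Y)) \<le> w")
    case True
    have "measure_pmf.prob (random_subset T p) {X. real (card (W (X \<union> Y))) \<le> w \<and> k \<le> card (W (X \<union> Y) \<inter> (X \<union> Y))}
      \<le> exp (- k * ln s - card (W Y) * p * (1 - s))"
      using assms(3-5,7) WX
      by (intro prob_random_subset_card_ge finite_subset[OF assms(2,1)]) auto
    also have "\<dots> = exp (- k * ln s + card (W Y) * (p * (s - 1)))"
      by (simp add: algebra_simps)
    also have "\<dots> \<le> exp (- k * ln s + w * (p * (s - 1)))"
      using True assms(3,5) by (intro iffD2[OF exp_le_cancel_iff] add_left_mono mult_right_mono) auto
    finally show ?thesis by (simp add: mult.assoc)
  next
    case False
    have "measure_pmf.prob (random_subset T p) {X. real (card (W (X \<union> Y))) \<le> w \<and> k \<le> card (W (X \<union> Y) \<inter> (X \<union> Y))} = 0"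
      unfolding measure_pmf_zero_iff using False WX set_pmf_random_subset[of T p] by auto
    thus ?thesis by simp
  qed
qed

text \<open>The source of all symmetry arguments below. Injectivity of \<open>h\<close> on the whole
  type keeps elements outside \<open>S\<close> outside, as the reindexing of \<open>Pi_pmf\<close>
  demands.\<close>

lemma random_subset_bij:
  assumes "finite S" "bij_betw h S S" "inj h"
  shows "map_pmf (\<lambda>X. h ` X) (random_subset S p) = random_subset S p"
proof -
  have out: "x \<notin> S \<Longrightarrow> h x \<notin> S" for x
    using assms(2,3) by (metis bij_betw_def imageE injD)
  have "random_subset S p = map_pmf (\<lambda>f. {e \<in> S. f (h e)}) (Pi_pmf S False (\<lambda>_. bernoulli_pmf p))"
    unfolding random_subset_def
    by (subst Pi_pmf_bij_betw[OF assms(1,2) out]) (simp_all add: pmf.map_comp o_def)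
  hence "map_pmf (\<lambda>X. h ` X) (random_subset S p) =
     map_pmf (\<lambda>f. h ` {e \<in> S. f (h e)}) (Pi_pmf S False (\<lambda>_. bernoulli_pmf p))"
    by (simp add: pmf.map_comp o_def)
  also have "\<dots> = random_subset S p"
    unfolding random_subset_def
  proof (rule map_pmf_cong)
    fix f :: "'a \<Rightarrow> bool"
    have "h ` S = S" using assms by (simp add: bij_betw_def)
    thus "h ` {e \<in> S. f (h e)} = {e \<in> S. f e}" by (auto simp: image_iff)
  qed simp
  finally show ?thesis .
qed

section \<open>Row vectors, stochastic matrices and contraction\<close>

definition act :: "'a set \<Rightarrow> ('a \<Rightarrow> 'a \<Rightarrow> real) \<Rightarrow> ('a \<Rightarrow> real) \<Rightarrow> 'a \<Rightarrow> real" where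
  "act V K \<mu> v = (\<Sum>w\<in>V. \<mu> w * K w v)"

definition dirac :: "'a \<Rightarrow> 'a \<Rightarrow> real" where
  "dirac x v = of_bool (v = x)"

text \<open>For a probability vector this is the total variation distance to the uniform distribution;
  being antitone, it can be bounded through sub-probability vectors below \<open>\<mu>\<close>.\<close>

definition deficit :: "'a set \<Rightarrow> ('a \<Rightarrow> real) \<Rightarrow> real" where
  "deficit V \<mu> = (\<Sum>v\<in>V. max 0 (1 / card V - \<mu> v))"

definition stochastic :: "'a set \<Rightarrow> ('a \<Rightarrow> 'a \<Rightarrow> real) \<Rightarrow> bool" where
  "stochastic V K \<longleftrightarrow> (\<forall>a\<in>V. \<forall>b\<in>V. 0 \<le> K a b) \<and> (\<forall>a\<in>V. (\<Sum>b\<in>V. K a b) = 1)"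

lemma funpow_Suc_act:
  "(act V K ^^ Suc t) \<mu> v = (\<Sum>w\<in>V. (act V K ^^ t) \<mu> w * K w v)"
  by (simp add: act_def)

lemma funpow_act_nonneg:
  assumes "\<And>a b. a \<in> V \<Longrightarrow> b \<in> V \<Longrightarrow> 0 \<le> K a b" "\<And>a. a \<in> V \<Longrightarrow> 0 \<le> \<mu> a" "v \<in> V"
  shows "0 \<le> (act V K ^^ t) \<mu> v"
  using assms(3)
proof (induction t arbitrary: v)
  case (Suc t)
  then show ?case using assms by (auto simp only: funpow_Suc_act intro!: sum_nonneg mult_nonneg_nonneg)
qed (use assms in auto)

lemma funpow_act_mono:
  assumes "\<And>a b. a \<in> V \<Longrightarrow> b \<in> V \<Longrightarrow> 0 \<le> Q a b" "\<And>a b. a \<in> V \<Longrightarrow> b \<in> V \<Longrightarrow> Q a b \<le> K a b"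
    and "\<And>a. a \<in> V \<Longrightarrow> 0 \<le> \<mu> a" "\<And>a. a \<in> V \<Longrightarrow> \<mu> a \<le> \<nu> a" "v \<in> V"
  shows "(act V Q ^^ t) \<mu> v \<le> (act V K ^^ t) \<nu> v"
  using assms(5)
proof (induction t arbitrary: v)
  case (Suc t)
  have "(act V Q ^^ t) \<mu> w * Q w v \<le> (act V K ^^ t) \<nu> w * K w v" if "w \<in> V" for w
  proof (intro mult_mono)
    have "0 \<le> (act V Q ^^ t) \<mu> w"
      using assms that by (intro funpow_act_nonneg) auto
    thus "0 \<le> (act V K ^^ t) \<nu> w" using Suc.IH[OF that] by linarith
  qed (use assms that Suc in auto)
  thus ?case by (simp only: funpow_Suc_act sum_mono)
qed (use assms in auto)

lemma funpow_act_cong: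
  assumes "\<And>a b. a \<in> V \<Longrightarrow> b \<in> V \<Longrightarrow> Q a b = K a b" "\<And>a. a \<in> V \<Longrightarrow> \<mu> a = \<nu> a" "v \<in> V"
  shows "(act V Q ^^ t) \<mu> v = (act V K ^^ t) \<nu> v"
  using assms(3)
proof (induction t arbitrary: v)
  case (Suc t)
  then show ?case using assms by (simp only: funpow_Suc_act cong: sum.cong)
qed (use assms in auto)

lemma funpow_act_eq_sum_dirac:
  assumes "finite V" "v \<in> V"
  shows "(act V K ^^ t) \<mu> v = (\<Sum>x\<in>V. \<mu> x * (act V K ^^ t) (dirac x) v)"
  using assms(2)
proof (induction t arbitrary: v)
  case 0
  then show ?case using assms(1) by (simp add: dirac_def if_distrib of_bool_def cong: if_cong)
next
  case (Suc t)
  have "(act V K ^^ Suc t) \<mu> v = (\<Sum>w\<in>V. (\<Sum>x\<in>V. \<mu> x * (act V K ^^ t) (dirac x) w) * K w v)"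
    using Suc.IH by (simp only: funpow_Suc_act cong: sum.cong)
  also have "\<dots> = (\<Sum>w\<in>V. \<Sum>x\<in>V. \<mu> x * ((act V K ^^ t) (dirac x) w * K w v))"
    by (simp add: sum_distrib_right mult.assoc)
  also have "\<dots> = (\<Sum>x\<in>V. \<mu> x * (act V K ^^ Suc t) (dirac x) v)"
    by (subst sum.swap) (simp only: funpow_Suc_act sum_distrib_left)
  finally show ?case .
qed

lemma act_dirac:
  assumes "finite V" "x \<in> V"
  shows "act V K (dirac x) = K x"
proof
  fix v
  have "act V K (dirac x) v = (\<Sum>w\<in>V. if w = x then K x v else 0)"
    unfolding act_def dirac_def by (intro sum.cong) auto
  thus "act V K (dirac x) v = K x v" using assms by simp
qed

lemma sum_act: "sum (act V K \<mu>) V = (\<Sum>w\<in>V. \<mu> w * (\<Sum>v\<in>V. K w v))"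
  unfolding act_def by (subst sum.swap) (simp add: sum_distrib_left)

lemma sum_funpow_act:
  assumes "stochastic V K"
  shows "sum ((act V K ^^ t) \<mu>) V = sum \<mu> V"
  using assms by (induction t) (auto simp: sum_act stochastic_def)

lemma sum_dirac: "finite V \<Longrightarrow> x \<in> V \<Longrightarrow> sum (dirac x) V = 1"
  by (simp add: dirac_def of_bool_def)

lemma dirac_nonneg: "dirac x v \<ge> 0"
  by (simp add: dirac_def)

text \<open>No mass ever enters \<open>V - A\<close>, so the vector stays supported in
  \<open>A\<close>, where each step preserves at least the fraction \<open>1 - \<theta>\<close> of
  every row.\<close>

lemma sum_funpow_act_ge:
  assumes "A \<subseteq> V" "finite V" "\<And>a b. a \<in> V \<Longrightarrow> b \<in> V \<Longrightarrow> 0 \<le> Q a b"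
    and "\<And>a b. a \<in> V \<Longrightarrow> b \<in> V - A \<Longrightarrow> Q a b = 0"
    and "\<And>a. a \<in> A \<Longrightarrow> 1 - \<theta> \<le> (\<Sum>b\<in>V. Q a b)"
    and "\<And>a. a \<in> V \<Longrightarrow> 0 \<le> \<mu> a" "\<And>a. a \<in> V - A \<Longrightarrow> \<mu> a = 0"
    and "0 \<le> \<theta>" "\<theta> \<le> 1"
  shows "(1 - \<theta>) ^ t * sum \<mu> V \<le> sum ((act V Q ^^ t) \<mu>) V"
proof (induction t)
  case (Suc t)
  let ?f = "(act V Q ^^ t) \<mu>"
  have supp: "?f a = 0" if "a \<in> V - A" for a
    using that assms(4,7) by (cases t) (auto simp: act_def)
  have nn: "0 \<le> ?f a" if "a \<in> V" for a
    using assms that by (intro funpow_act_nonneg) auto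
  have "(1 - \<theta>) ^ Suc t * sum \<mu> V \<le> (1 - \<theta>) * sum ?f V"
    using mult_left_mono[OF Suc.IH, of "1 - \<theta>"] assms by (simp add: mult.assoc)
  also have "\<dots> = (\<Sum>w\<in>V. ?f w * (1 - \<theta>))" by (simp add: sum_distrib_left mult.commute)
  also have "\<dots> \<le> (\<Sum>w\<in>V. ?f w * (\<Sum>v\<in>V. Q w v))"
  proof (rule sum_mono)
    fix w assume "w \<in> V"
    thus "?f w * (1 - \<theta>) \<le> ?f w * (\<Sum>v\<in>V. Q w v)"
      using supp[of w] nn[of w] assms(5)[of w] by (cases "w \<in> A") (auto intro: mult_left_mono)
  qed
  also have "\<dots> = sum ((act V Q ^^ Suc t) \<mu>) V" by (simp add: sum_act)
  finally show ?case .
qed simp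

section \<open>Distance from uniformity under perturbation, mixing and killing\<close>

lemma deficit_nonneg: "0 \<le> deficit V \<mu>"
  by (auto simp: deficit_def intro!: sum_nonneg)

lemma deficit_mono:
  assumes "\<And>v. v \<in> V \<Longrightarrow> \<mu> v \<le> \<nu> v"
  shows "deficit V \<nu> \<le> deficit V \<mu>"
  using assms unfolding deficit_def by (intro sum_mono) fastforce

lemma deficit_perturb:
  assumes "\<And>v. v \<in> V \<Longrightarrow> \<mu> v \<le> \<nu> v"
  shows "deficit V \<mu> \<le> deficit V \<nu> + (sum \<nu> V - sum \<mu> V)"
proof -
  have "deficit V \<mu> \<le> (\<Sum>v\<in>V. max 0 (1 / card V - \<nu> v) + (\<nu> v - \<mu> v))"
    using assms unfolding deficit_def by (intro sum_mono) fastforce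
  thus ?thesis by (simp add: deficit_def sum.distrib sum_subtractf)
qed

lemma deficit_convex:
  assumes "finite A" "\<And>x. x \<in> A \<Longrightarrow> 0 \<le> c x" "sum c A = 1"
  shows "deficit V (\<lambda>v. \<Sum>x\<in>A. c x * \<nu> x v) \<le> (\<Sum>x\<in>A. c x * deficit V (\<nu> x))"
proof -
  have "deficit V (\<lambda>v. \<Sum>x\<in>A. c x * \<nu> x v) \<le> (\<Sum>v\<in>V. \<Sum>x\<in>A. c x * max 0 (1 / card V - \<nu> x v))"
    unfolding deficit_def
  proof (rule sum_mono)
    fix v
    have "1 / card V - (\<Sum>x\<in>A. c x * \<nu> x v) = (\<Sum>x\<in>A. c x * (1 / card V - \<nu> x v))"
      using assms(3) by (simp add: right_diff_distrib sum_subtractf flip: sum_divide_distrib)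
    also have "\<dots> \<le> (\<Sum>x\<in>A. c x * max 0 (1 / card V - \<nu> x v))"
      using assms(2) by (intro sum_mono mult_left_mono) auto
    finally show "max 0 (1 / card V - (\<Sum>x\<in>A. c x * \<nu> x v)) \<le> (\<Sum>x\<in>A. c x * max 0 (1 / card V - \<nu> x v))"
      using assms(2) by (auto intro!: sum_nonneg)
  qed
  also have "\<dots> = (\<Sum>x\<in>A. c x * deficit V (\<nu> x))"
    by (subst sum.swap) (simp add: deficit_def sum_distrib_left)
  finally show ?thesis .
qed

text \<open>Both vectors have total mass 1, so the positive and negative parts of their difference
  have equal mass.\<close>

lemma sum_abs_eq_deficit:
  assumes "finite V" "V \<noteq> {}" "sum \<mu> V = 1"
  shows "(\<Sum>v\<in>V. \<bar>\<mu> v - 1 / card V\<bar>) = 2 * deficit V \<mu>"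
proof -
  have "(\<Sum>v\<in>V. \<bar>\<mu> v - 1 / card V\<bar>) = (\<Sum>v\<in>V. 2 * max 0 (1 / card V - \<mu> v) + (\<mu> v - 1 / card V))"
    by (intro sum.cong) (auto simp: max_def)
  also have "\<dots> = 2 * deficit V \<mu>"
    using assms by (simp add: deficit_def sum.distrib sum_subtractf sum_distrib_left)
  finally show ?thesis .
qed

text \<open>\<open>Q\<close> is the walk killed on leaving \<open>A\<close>. By Bernoulli's
  inequality at most \<open>t * \<theta>\<close> of the mass is lost in \<open>t\<close> steps, and
  the deficit grows by no more than the lost mass.\<close>

lemma deficit_killed:
  assumes "finite V" "A \<subseteq> V" "stochastic V K"
    and "\<And>a b. a \<in> V \<Longrightarrow> b \<in> V \<Longrightarrow> 0 \<le> Q a b" "\<And>a b. a \<in> V \<Longrightarrow> b \<in> V \<Longrightarrow> Q a b \<le> K a b"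
    and "\<And>a b. a \<in> V \<Longrightarrow> b \<in> V - A \<Longrightarrow> Q a b = 0"
    and "\<And>a. a \<in> A \<Longrightarrow> 1 - \<theta> \<le> (\<Sum>b\<in>V. Q a b)" "0 \<le> \<theta>" "\<theta> \<le> 1" "y \<in> A"
  shows "deficit V ((act V Q ^^ t) (dirac y)) \<le> deficit V ((act V K ^^ t) (dirac y)) + t * \<theta>"
proof -
  have yV: "y \<in> V" using assms by auto
  have "deficit V ((act V Q ^^ t) (dirac y)) \<le> deficit V ((act V K ^^ t) (dirac y)) +
      (sum ((act V K ^^ t) (dirac y)) V - sum ((act V Q ^^ t) (dirac y)) V)"
    using assms by (intro deficit_perturb funpow_act_mono) (auto simp: dirac_nonneg)
  also have "sum ((act V K ^^ t) (dirac y)) V = 1"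
    using sum_funpow_act[OF assms(3)] sum_dirac[OF assms(1) yV] by simp
  also have "(1 - \<theta>) ^ t * sum (dirac y) V \<le> sum ((act V Q ^^ t) (dirac y)) V"
    using assms by (intro sum_funpow_act_ge[of A]) (auto simp: dirac_def)
  hence "1 - sum ((act V Q ^^ t) (dirac y)) V \<le> t * \<theta>"
    using Bernoulli_inequality[of "-\<theta>" t] assms(9) sum_dirac[OF assms(1) yV] by simp
  finally show ?thesis by simp
qed

section \<open>Contraction in the l1 norm and stationary vectors\<close>

lemma funpow_act_diff:
  "(act V K ^^ t) (\<lambda>v. \<mu> v - \<nu> v) = (\<lambda>v. (act V K ^^ t) \<mu> v - (act V K ^^ t) \<nu> v)"
  by (induction t) (auto simp: act_def left_diff_distrib sum_subtractf)

lemma sum_abs_act_le: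
  assumes "stochastic V K"
  shows "(\<Sum>v\<in>V. \<bar>act V K f v\<bar>) \<le> (\<Sum>v\<in>V. \<bar>f v\<bar>)"
proof -
  have "(\<Sum>v\<in>V. \<bar>act V K f v\<bar>) \<le> (\<Sum>v\<in>V. act V K (\<lambda>v. \<bar>f v\<bar>) v)"
    unfolding act_def using assms
    by (intro sum_mono order.trans[OF sum_abs]) (auto simp: abs_mult stochastic_def)
  also have "\<dots> = (\<Sum>v\<in>V. \<bar>f v\<bar>)"
    using assms by (simp add: sum_act stochastic_def)
  finally show ?thesis .
qed

lemma sum_abs_funpow_act_le:
  assumes "stochastic V K"
  shows "(\<Sum>v\<in>V. \<bar>(act V K ^^ t) f v\<bar>) \<le> (\<Sum>v\<in>V. \<bar>f v\<bar>)"
proof (induction t)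
  case (Suc t)
  show ?case unfolding funpow.simps o_apply
    by (rule order.trans[OF sum_abs_act_le[OF assms] Suc.IH])
qed simp

text \<open>As \<open>f\<close> has total mass 0, subtracting the uniform vector from every row of
  the \<open>T\<close>-step matrix leaves the image of \<open>f\<close> unchanged. Each row so
  modified has l1 norm twice a deficit.\<close>

lemma sum_abs_funpow_act_contraction:
  assumes "finite V" "V \<noteq> {}" "stochastic V K" "\<And>y. y \<in> V \<Longrightarrow> deficit V ((act V K ^^ T) (dirac y)) \<le> \<kappa>"
    and "sum f V = 0"
  shows "(\<Sum>v\<in>V. \<bar>(act V K ^^ T) f v\<bar>) \<le> 2 * \<kappa> * (\<Sum>v\<in>V. \<bar>f v\<bar>)"
proof -
  have "(\<Sum>v\<in>V. \<bar>(act V K ^^ T) f v\<bar>) \<le> (\<Sum>v\<in>V. \<Sum>x\<in>V. \<bar>f x\<bar> * \<bar>(act V K ^^ T) (dirac x) v - 1 / card V\<bar>)"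
  proof (rule sum_mono)
    fix v assume v: "v \<in> V"
    have "(act V K ^^ T) f v = (\<Sum>x\<in>V. f x * (act V K ^^ T) (dirac x) v) - (\<Sum>x\<in>V. f x) * (1 / card V)"
      unfolding assms(5) by (subst funpow_act_eq_sum_dirac[OF assms(1) v]) simp
    also have "\<dots> = (\<Sum>x\<in>V. f x * ((act V K ^^ T) (dirac x) v - 1 / card V))"
      by (simp only: sum_distrib_right right_diff_distrib sum_subtractf)
    finally show "\<bar>(act V K ^^ T) f v\<bar> \<le> (\<Sum>x\<in>V. \<bar>f x\<bar> * \<bar>(act V K ^^ T) (dirac x) v - 1 / card V\<bar>)"
      by (simp only: abs_mult[symmetric] sum_abs)
  qed
  also have "\<dots> = (\<Sum>x\<in>V. \<bar>f x\<bar> * (\<Sum>v\<in>V. \<bar>(act V K ^^ T) (dirac x) v - 1 / card V\<bar>))"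
    by (subst sum.swap) (simp add: sum_distrib_left)
  also have "\<dots> \<le> (\<Sum>x\<in>V. \<bar>f x\<bar> * (2 * \<kappa>))"
  proof (intro sum_mono mult_left_mono)
    fix x assume x: "x \<in> V"
    have "(\<Sum>v\<in>V. \<bar>(act V K ^^ T) (dirac x) v - 1 / card V\<bar>) = 2 * deficit V ((act V K ^^ T) (dirac x))"
      by (intro sum_abs_eq_deficit assms) (simp add: sum_funpow_act assms x sum_dirac)
    thus "(\<Sum>v\<in>V. \<bar>(act V K ^^ T) (dirac x) v - 1 / card V\<bar>) \<le> 2 * \<kappa>"
      using assms(4)[OF x] by simp
  qed auto
  finally show ?thesis by (simp add: sum_distrib_left mult_ac)
qed

lemma sum_abs_funpow_act_contraction_mult:
  assumes "finite V" "V \<noteq> {}" "stochastic V K" "\<And>y. y \<in> V \<Longrightarrow> deficit V ((act V K ^^ T) (dirac y)) \<le> \<kappa>"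
    and "sum f V = 0"
  shows "(\<Sum>v\<in>V. \<bar>(act V K ^^ (j * T + r)) f v\<bar>) \<le> (2 * \<kappa>) ^ j * (\<Sum>v\<in>V. \<bar>f v\<bar>)"
proof (induction j)
  case 0
  then show ?case using sum_abs_funpow_act_le[OF assms(3)] by simp
next
  case (Suc j)
  have "0 \<le> \<kappa>" using assms(2,4) deficit_nonneg order.trans by blast
  have "(act V K ^^ (Suc j * T + r)) f = (act V K ^^ T) ((act V K ^^ (j * T + r)) f)"
    by (simp add: funpow_add add.assoc)
  hence "(\<Sum>v\<in>V. \<bar>(act V K ^^ (Suc j * T + r)) f v\<bar>) \<le> 2 * \<kappa> * (\<Sum>v\<in>V. \<bar>(act V K ^^ (j * T + r)) f v\<bar>)"
    using sum_abs_funpow_act_contraction[OF assms(1-4), of "(act V K ^^ (j * T + r)) f"]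
    by (simp add: sum_funpow_act assms)
  also have "\<dots> \<le> 2 * \<kappa> * ((2 * \<kappa>) ^ j * (\<Sum>v\<in>V. \<bar>f v\<bar>))"
    using Suc.IH \<open>0 \<le> \<kappa>\<close> by (intro mult_left_mono) auto
  finally show ?case by (simp add: mult_ac)
qed

text \<open>The contraction factor is \<open>1 / 2\<close> here, so a fixed vector of total mass 0
  has at most half its own l1 norm.\<close>

lemma zero_if_act_fixed:
  assumes "finite V" "V \<noteq> {}" "stochastic V K" "\<And>y. y \<in> V \<Longrightarrow> deficit V ((act V K ^^ T) (dirac y)) \<le> 1 / 4"
    and "sum f V = 0" "\<And>v. v \<in> V \<Longrightarrow> (act V K ^^ T) f v = f v" "v \<in> V"
  shows "f v = 0"
proof -
  have "(\<Sum>v\<in>V. \<bar>(act V K ^^ T) f v\<bar>) \<le> 2 * (1/4) * (\<Sum>v\<in>V. \<bar>f v\<bar>)"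
    by (rule sum_abs_funpow_act_contraction[OF assms(1-5)])
  moreover have "(\<Sum>v\<in>V. \<bar>(act V K ^^ T) f v\<bar>) = (\<Sum>v\<in>V. \<bar>f v\<bar>)"
    using assms(6) by (intro sum.cong) auto
  ultimately have "(\<Sum>v\<in>V. \<bar>f v\<bar>) \<le> 0" by simp
  hence "(\<Sum>v\<in>V. \<bar>f v\<bar>) = 0" by (simp add: order.antisym sum_nonneg)
  thus ?thesis using assms(1,7) by (simp add: sum_nonneg_eq_0_iff)
qed

lemma funpow_act_fixed:
  assumes "\<And>v. v \<in> V \<Longrightarrow> act V K \<mu> v = \<mu> v" "v \<in> V"
  shows "(act V K ^^ t) \<mu> v = \<mu> v"
  using assms(2)
proof (induction t arbitrary: v)
  case (Suc t)
  have "(act V K ^^ Suc t) \<mu> v = act V K \<mu> v"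
    using Suc.IH unfolding funpow_Suc_act act_def[of V K \<mu>] by (simp cong: sum.cong)
  then show ?case using assms Suc by simp
qed simp

lemma stationary_unique:
  assumes "finite V" "V \<noteq> {}" "stochastic V K" "\<And>y. y \<in> V \<Longrightarrow> deficit V ((act V K ^^ T) (dirac y)) \<le> 1 / 4"
    and "sum \<mu> V = 1" "sum \<nu> V = 1" 
    and "\<And>v. v \<in> V \<Longrightarrow> act V K \<mu> v = \<mu> v" "\<And>v. v \<in> V \<Longrightarrow> act V K \<nu> v = \<nu> v" "v \<in> V"
  shows "\<mu> v = \<nu> v"
  using zero_if_act_fixed[OF assms(1-4), of "\<lambda>v. \<mu> v - \<nu> v" v] assms
  by (simp add: funpow_act_diff funpow_act_fixed sum_subtractf)

text \<open>The iterates of the \<open>T\<close>-step map on a point mass have geometrically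
  decreasing increments, hence converge; the limit is the stationary vector.\<close>

lemma stationary_exists:
  assumes "finite V" "V \<noteq> {}" "stochastic V K" "\<And>y. y \<in> V \<Longrightarrow> deficit V ((act V K ^^ T) (dirac y)) \<le> 1 / 4"
  obtains \<mu> where "\<And>v. v \<in> V \<Longrightarrow> 0 \<le> \<mu> v" "sum \<mu> V = 1" "\<And>v. v \<in> V \<Longrightarrow> act V K \<mu> v = \<mu> v"
proof -
  obtain x where x: "x \<in> V" using assms(2) by auto
  define f where "f j = (act V K ^^ (j * T)) (dirac x)" for j
  have f_Suc: "f (Suc j) = (act V K ^^ T) (f j)" for j
    by (simp add: f_def funpow_add)
  have f_nonneg: "0 \<le> f j v" if "v \<in> V" for j v
    unfolding f_def using assms(3) that by (intro funpow_act_nonneg) (auto simp: stochastic_def dirac_nonneg)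
  have f_sum: "sum (f j) V = 1" for j
    using assms x by (simp add: f_def sum_funpow_act sum_dirac)
  have diff: "(\<Sum>v\<in>V. \<bar>f (Suc j) v - f j v\<bar>) \<le> (1/2) ^ j * (\<Sum>v\<in>V. \<bar>f 1 v - f 0 v\<bar>)" for j
  proof -
    have "f (Suc j) = (act V K ^^ (j * T)) (f 1)"
      by (simp add: f_def add.commute[of T] funpow_add)
    hence eq: "f (Suc j) v - f j v = (act V K ^^ (j * T + 0)) (\<lambda>v. f 1 v - f 0 v) v" for v
      by (simp add: funpow_act_diff f_def)
    have "(\<Sum>v\<in>V. \<bar>(act V K ^^ (j * T + 0)) (\<lambda>v. f 1 v - f 0 v) v\<bar>) \<le>
      (2 * (1/4)) ^ j * (\<Sum>v\<in>V. \<bar>f 1 v - f 0 v\<bar>)"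
    proof (rule sum_abs_funpow_act_contraction_mult[OF assms])
      show "(\<Sum>v\<in>V. f 1 v - f 0 v) = 0"
        using f_sum[of 1] f_sum[of 0] by (simp only: sum_subtractf)
    qed
    thus ?thesis unfolding eq by simp
  qed
  have "convergent (\<lambda>j. f j v)" if v: "v \<in> V" for v
  proof -
    have "summable (\<lambda>j. f (Suc j) v - f j v)"
    proof (rule summable_comparison_test')
      show "summable (\<lambda>j. (1/2) ^ j * (\<Sum>v\<in>V. \<bar>f 1 v - f 0 v\<bar>))"
        by (intro summable_mult2 summable_geometric) auto
      show "norm (f (Suc j) v - f j v) \<le> (1/2) ^ j * (\<Sum>v\<in>V. \<bar>f 1 v - f 0 v\<bar>)" if "j \<ge> 0" for j
        unfolding real_norm_def
        by (rule order.trans[OF _ diff]) (rule member_le_sum[OF v _ assms(1)], simp)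
    qed
    hence "(\<lambda>n. \<Sum>j<n. f (Suc j) v - f j v) \<longlonglongrightarrow> (\<Sum>j. f (Suc j) v - f j v)"
      by (rule summable_LIMSEQ)
    hence "(\<lambda>n. (f n v - f 0 v) + f 0 v) \<longlonglongrightarrow> (\<Sum>j. f (Suc j) v - f j v) + f 0 v"
      unfolding sum_lessThan_telescope[of "\<lambda>j. f j v"] by (intro tendsto_add tendsto_const)
    thus ?thesis by (auto simp: convergent_def)
  qed
  then obtain \<mu> where lim: "\<And>v. v \<in> V \<Longrightarrow> (\<lambda>j. f j v) \<longlonglongrightarrow> \<mu> v"
    unfolding convergent_def by metis
  have nonneg: "0 \<le> \<mu> v" if "v \<in> V" for v
    using lim[OF that] f_nonneg[OF that] by (intro LIMSEQ_le_const) auto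
  have lim_act: "(\<lambda>j. (act V K ^^ t) (f j) v) \<longlonglongrightarrow> (act V K ^^ t) \<mu> v" if "v \<in> V" for t v
    using that
  proof (induction t arbitrary: v)
    case (Suc t)
    then show ?case by (simp only: funpow_Suc_act) (auto intro!: tendsto_intros)
  qed (auto intro: lim)
  have "(\<lambda>j. sum (f j) V) \<longlonglongrightarrow> sum \<mu> V"
    by (intro tendsto_sum lim)
  hence sum: "sum \<mu> V = 1" 
    unfolding f_sum by (simp add: LIMSEQ_const_iff)
  have fixT: "(act V K ^^ T) \<mu> v = \<mu> v" if "v \<in> V" for v
  proof -
    have "(\<lambda>j. f (Suc j) v) \<longlonglongrightarrow> \<mu> v"
      using lim[OF that] by (rule LIMSEQ_Suc)
    thus ?thesis using lim_act[OF that, of T] LIMSEQ_unique unfolding f_Suc by blast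
  qed
  \<comment> \<open>So far the limit is fixed by \<open>T\<close> steps only. Its one-step increment
    has total mass 0 and is again fixed by \<open>T\<close> steps, so it vanishes.\<close>
  have "act V K \<mu> v - \<mu> v = 0" if v: "v \<in> V" for v
  proof (rule zero_if_act_fixed[OF assms, of _ v])
    show "(\<Sum>v\<in>V. act V K \<mu> v - \<mu> v) = 0"
      using sum_funpow_act[OF assms(3), of 1 \<mu>] by (simp add: sum_subtractf)
    fix v assume v: "v \<in> V"
    have "(act V K ^^ T) (act V K \<mu>) v = act V K ((act V K ^^ T) \<mu>) v"
      by (metis funpow_swap1)
    also have "\<dots> = act V K \<mu> v"
      using fixT by (simp add: act_def)
    finally show "(act V K ^^ T) (\<lambda>v. act V K \<mu> v - \<mu> v) v = act V K \<mu> v - \<mu> v"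
      using fixT[OF v] by (simp add: funpow_act_diff)
  qed (use v in auto)
  with nonneg sum that show ?thesis by fastforce
qed

section \<open>Moments of the walk kernel\<close>

definition arc_pairs :: "'a set \<Rightarrow> ('a \<times> 'a) set" where
  "arc_pairs V = {(i, j). i \<in> V \<and> j \<in> V \<and> i \<noteq> j}"

text \<open>\<open>k = 0\<close> gives the transition matrix of the walk; for \<open>k > 0\<close> all entries are at most \<open>1 / k\<close>,
  whatever the arc set.\<close>

definition walk_kernel :: "real \<Rightarrow> ('a \<times> 'a) set \<Rightarrow> 'a \<Rightarrow> 'a \<Rightarrow> real" where
  "walk_kernel k X a b = (if (a, b) \<in> X \<and> k \<le> real (card (X `` {a})) then 1 / card (X `` {a}) else 0)"

lemma finite_arc_pairs: "finite V \<Longrightarrow> finite (arc_pairs V)"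
  by (rule finite_subset[of _ "V \<times> V"]) (auto simp: arc_pairs_def)

lemma walk_kernel_nonneg: "0 \<le> walk_kernel k X a b"
  by (simp add: walk_kernel_def)

text \<open>Row \<open>a\<close> of the kernel depends on the arcs leaving \<open>a\<close> alone.
  Hence different rows are independent.\<close>

lemma walk_kernel_Int: "walk_kernel k (X \<inter> {a} \<times> UNIV) a b = walk_kernel k X a b"
proof -
  have "(X \<inter> {a} \<times> UNIV) `` {a} = X `` {a}" by auto
  thus ?thesis by (simp add: walk_kernel_def)
qed

lemma sum_walk_kernel:
  assumes "finite V" "X \<subseteq> arc_pairs V" "a \<in> V" "0 < k"
  shows "(\<Sum>b\<in>V - {a}. walk_kernel k X a b) = of_bool (k \<le> real (card (X `` {a})))"
proof -
  have fin: "finite (X `` {a})"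
    by (rule finite_subset[OF _ assms(1)]) (use assms(2) in \<open>auto simp: arc_pairs_def\<close>)
  have "(\<Sum>b\<in>V - {a}. walk_kernel k X a b) = (\<Sum>b\<in>X `` {a}. walk_kernel k X a b)"
    by (rule sum.mono_neutral_right) (use assms in \<open>auto simp: arc_pairs_def walk_kernel_def\<close>)
  also have "\<dots> = (\<Sum>b\<in>X `` {a}. if k \<le> real (card (X `` {a})) then 1 / card (X `` {a}) else 0)"
    by (intro sum.cong) (auto simp: walk_kernel_def)
  also have "\<dots> = of_bool (k \<le> real (card (X `` {a})))"
    using assms(4) by (cases "k \<le> real (card (X `` {a}))") simp_all
  finally show ?thesis .
qed

lemma integrable_random_subset:
  fixes f :: "'a set \<Rightarrow> real"
  assumes "finite S"
  shows "integrable (random_subset S p) f"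
  by (intro integrable_measure_pmf_finite finite_set_pmf_random_subset assms)

lemma expectation_random_subset_mono:
  fixes f g :: "'a set \<Rightarrow> real"
  assumes "finite S" "\<And>X. X \<subseteq> S \<Longrightarrow> f X \<le> g X"
  shows "measure_pmf.expectation (random_subset S p) f \<le> measure_pmf.expectation (random_subset S p) g"
  using assms set_pmf_random_subset[of S p]
  by (intro integral_mono_AE integrable_random_subset) (auto simp: AE_measure_pmf_iff)

lemma expectation_random_subset_cong:
  fixes f g :: "'a set \<Rightarrow> real"
  assumes "\<And>X. X \<subseteq> S \<Longrightarrow> f X = g X"
  shows "measure_pmf.expectation (random_subset S p) f = measure_pmf.expectation (random_subset S p) g"
  using assms set_pmf_random_subset[of S p]
  by (intro integral_cong_AE) (auto simp: AE_measure_pmf_iff)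

text \<open>Exchanging the arcs \<open>(a, b)\<close> and \<open>(a, c)\<close> while fixing all
  other arcs preserves the distribution of the arc set and transposes two entries of row
  \<open>a\<close>.\<close>

lemma expectation_walk_kernel_swap:
  fixes F :: "('a \<Rightarrow> real) \<Rightarrow> real"
  assumes "finite V" "a \<in> V" "b \<in> V - {a}" "c \<in> V - {a}"
  shows "measure_pmf.expectation (random_subset (arc_pairs V) p) (\<lambda>X. F (walk_kernel k X a)) =
    measure_pmf.expectation (random_subset (arc_pairs V) p) (\<lambda>X. F (walk_kernel k X a \<circ> Transposition.transpose b c))"
proof -
  define \<tau> where "\<tau> = Transposition.transpose b c"
  have \<tau>\<tau>[simp]: "\<tau> (\<tau> x) = x" for x by (simp add: \<tau>_def)
  have \<tau>a[simp]: "\<tau> a = a" using assms by (auto simp: \<tau>_def Transposition.transpose_def)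
  have \<tau>V[simp]: "\<tau> x \<in> V \<longleftrightarrow> x \<in> V" for x
    using assms by (auto simp: \<tau>_def Transposition.transpose_def split: if_splits)
  have \<tau>_eq: "\<tau> x = y \<longleftrightarrow> x = \<tau> y" for x y by auto
  define h where "h = (\<lambda>(x, y). if x = a then (a, \<tau> y) else (x, y))"
  have hh: "h (h e) = e" for e by (auto simp: h_def split: prod.splits)
  have hS: "h e \<in> arc_pairs V" if "e \<in> arc_pairs V" for e
    using that by (auto simp: h_def arc_pairs_def \<tau>_eq split: if_splits)
  have bij: "bij_betw h (arc_pairs V) (arc_pairs V)"
    by (rule bij_betw_byWitness[where f' = h]) (auto simp: hh intro: hS)
  have inj: "inj h" by (metis hh injI)
  have K: "walk_kernel k (h ` X) a = walk_kernel k X a \<circ> \<tau>" for X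
  proof
    fix y
    have mem: "(a, y) \<in> h ` X \<longleftrightarrow> (a, \<tau> y) \<in> X" for y
    proof
      assume "(a, y) \<in> h ` X"
      then obtain e where "e \<in> X" "h e = (a, y)" by auto
      hence "e = h (a, y)" using hh[of e] by simp
      thus "(a, \<tau> y) \<in> X" using \<open>e \<in> X\<close> by (simp add: h_def)
    next
      assume "(a, \<tau> y) \<in> X"
      moreover have "h (a, \<tau> y) = (a, y)" by (simp add: h_def)
      ultimately show "(a, y) \<in> h ` X" by (metis imageI)
    qed
    have "(h ` X) `` {a} = \<tau> ` (X `` {a})"
    proof (intro set_eqI iffI)
      fix z assume "z \<in> (h ` X) `` {a}"
      hence "\<tau> z \<in> X `` {a}" using mem by simp
      thus "z \<in> \<tau> ` (X `` {a})" by (metis \<tau>\<tau> imageI)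
    qed (use mem in auto)
    moreover have "inj \<tau>" by (metis \<tau>\<tau> injI)
    ultimately have "card ((h ` X) `` {a}) = card (X `` {a})"
      by (simp add: card_image inj_on_def)
    thus "walk_kernel k (h ` X) a y = (walk_kernel k X a \<circ> \<tau>) y"
      by (simp add: walk_kernel_def mem)
  qed
  have "measure_pmf.expectation (random_subset (arc_pairs V) p) (\<lambda>X. F (walk_kernel k X a)) =
    measure_pmf.expectation (map_pmf (\<lambda>X. h ` X) (random_subset (arc_pairs V) p)) (\<lambda>X. F (walk_kernel k X a))"
    using random_subset_bij[OF finite_arc_pairs[OF assms(1)] bij inj] by simp
  also have "\<dots> = measure_pmf.expectation (random_subset (arc_pairs V) p) (\<lambda>X. F (walk_kernel k X a \<circ> \<tau>))"
    by (simp add: K)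
  finally show ?thesis by (simp add: \<tau>_def)
qed

text \<open>By symmetry all off-diagonal entries of row \<open>a\<close> have the same expectation,
  and they add up to the indicator of the event that the out-degree reaches
  \<open>k\<close>.\<close>

lemma expectation_walk_kernel:
  assumes "finite V" "a \<in> V" "b \<in> V - {a}" "0 < k"
  shows "measure_pmf.expectation (random_subset (arc_pairs V) p) (\<lambda>X. walk_kernel k X a b) =
    measure_pmf.prob (random_subset (arc_pairs V) p) {X. k \<le> real (card (X `` {a}))} / (card V - 1)"
proof -
  let ?M = "random_subset (arc_pairs V) p"
  note fin = finite_arc_pairs[OF assms(1)]
  have eq: "measure_pmf.expectation ?M (\<lambda>X. walk_kernel k X a c) = measure_pmf.expectation ?M (\<lambda>X. walk_kernel k X a b)"
    if "c \<in> V - {a}" for c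
    using expectation_walk_kernel_swap[OF assms(1,2,3) that, of p "\<lambda>f. f c" k] by simp
  have "measure_pmf.prob ?M {X. k \<le> real (card (X `` {a}))} =
      measure_pmf.expectation ?M (indicator {X. k \<le> real (card (X `` {a}))})" by simp
  also have "\<dots> = measure_pmf.expectation ?M (\<lambda>X. \<Sum>c\<in>V - {a}. walk_kernel k X a c)"
    using assms by (intro expectation_random_subset_cong) (simp add: sum_walk_kernel indicator_def)
  also have "\<dots> = (\<Sum>c\<in>V - {a}. measure_pmf.expectation ?M (\<lambda>X. walk_kernel k X a c))"
    by (intro Bochner_Integration.integral_sum integrable_random_subset fin)
  also have "\<dots> = (\<Sum>c\<in>V - {a}. measure_pmf.expectation ?M (\<lambda>X. walk_kernel k X a b))"
    by (intro sum.cong eq refl)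
  also have "\<dots> = (card V - 1) * measure_pmf.expectation ?M (\<lambda>X. walk_kernel k X a b)"
    using assms by simp
  finally have "measure_pmf.prob ?M {X. k \<le> real (card (X `` {a}))} = 
    real (card V - 1) * measure_pmf.expectation ?M (\<lambda>X. walk_kernel k X a b)" .
  moreover have "card V - 1 \<noteq> 0"
    using assms card_gt_0_iff[of "V - {a}"] by auto
  ultimately show ?thesis by simp
qed

lemma expectation_walk_kernel_le:
  assumes "finite V" "a \<in> V" "b \<in> V - {a}" "0 < k"
  shows "measure_pmf.expectation (random_subset (arc_pairs V) p) (\<lambda>X. walk_kernel k X a b) \<le> 1 / (card V - 1)"
  unfolding expectation_walk_kernel[OF assms] by (intro divide_right_mono) auto

text \<open>Here the cut-off pays: one of the two equal factors is at most \<open>1 / k\<close> for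
  every arc set.\<close>

lemma expectation_walk_kernel_same_le:
  assumes "finite V" "a \<in> V" "b \<in> V - {a}" "0 < k"
  shows "measure_pmf.expectation (random_subset (arc_pairs V) p)
    (\<lambda>X. walk_kernel k X a b * walk_kernel k X a b) \<le> 1 / (card V - 1) * (1 / k)"
proof -
  let ?M = "random_subset (arc_pairs V) p"
  have le: "walk_kernel k X a b \<le> 1 / k" for X :: "('a \<times> 'a) set"
    using assms(4) by (auto simp: walk_kernel_def field_simps)
  have "measure_pmf.expectation ?M (\<lambda>X. walk_kernel k X a b * walk_kernel k X a b) \<le>
    measure_pmf.expectation ?M (\<lambda>X. walk_kernel k X a b * (1 / k))"
    by (intro expectation_random_subset_mono finite_arc_pairs assms mult_left_mono le walk_kernel_nonneg)
  also have "\<dots> = measure_pmf.expectation ?M (\<lambda>X. walk_kernel k X a b) * (1 / k)" by simp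
  also have "\<dots> \<le> 1 / (card V - 1) * (1 / k)"
    using assms(4) by (intro mult_right_mono expectation_walk_kernel_le assms) auto
  finally show ?thesis .
qed

text \<open>By symmetry the products of the entry at \<open>b\<close> with the entries at the
  \<open>card V - 2\<close> other vertices have equal expectations. As row sums are at most 1, these
  products add up to at most the entry at \<open>b\<close>.\<close>

lemma expectation_walk_kernel_diff_le:
  assumes "finite V" "a \<in> V" "b \<in> V - {a}" "c \<in> V - {a}" "b \<noteq> c" "0 < k"
  shows "measure_pmf.expectation (random_subset (arc_pairs V) p)
    (\<lambda>X. walk_kernel k X a b * walk_kernel k X a c) \<le> 1 / (card V - 1) * (1 / (card V - 2))"
proof -
  let ?M = "random_subset (arc_pairs V) p"
  note fin = finite_arc_pairs[OF assms(1)]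
  have eq: "measure_pmf.expectation ?M (\<lambda>X. walk_kernel k X a b * walk_kernel k X a d) =
     measure_pmf.expectation ?M (\<lambda>X. walk_kernel k X a b * walk_kernel k X a c)"
    if "d \<in> V - {a, b}" for d
    using expectation_walk_kernel_swap[of V a c d p "\<lambda>f. f b * f d" k] assms that
    by (auto simp: Transposition.transpose_def)
  have cardD: "card (V - {a, b}) = card V - 2"
    using assms by (subst card_Diff_subset) (auto simp: card_insert_if)
  have "(card V - 2) * measure_pmf.expectation ?M (\<lambda>X. walk_kernel k X a b * walk_kernel k X a c) =
    (\<Sum>d\<in>V - {a, b}. measure_pmf.expectation ?M (\<lambda>X. walk_kernel k X a b * walk_kernel k X a c))"
    by (simp add: cardD)
  also have "\<dots> = (\<Sum>d\<in>V - {a, b}. measure_pmf.expectation ?M (\<lambda>X. walk_kernel k X a b * walk_kernel k X a d))"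
    by (intro sum.cong eq[symmetric] refl)
  also have "\<dots> = measure_pmf.expectation ?M (\<lambda>X. \<Sum>d\<in>V - {a, b}. walk_kernel k X a b * walk_kernel k X a d)"
    by (intro Bochner_Integration.integral_sum[symmetric] integrable_random_subset fin)
  also have "\<dots> \<le> measure_pmf.expectation ?M (\<lambda>X. walk_kernel k X a b)"
  proof (rule expectation_random_subset_mono[OF fin])
    fix X assume X: "X \<subseteq> arc_pairs V"
    have "(\<Sum>d\<in>V - {a, b}. walk_kernel k X a d) \<le> (\<Sum>d\<in>V - {a}. walk_kernel k X a d)"
      using assms by (intro sum_mono2) (auto simp: walk_kernel_nonneg)
    also have "\<dots> \<le> 1" using assms X by (simp add: sum_walk_kernel)
    finally have "walk_kernel k X a b * (\<Sum>d\<in>V - {a, b}. walk_kernel k X a d) \<le> walk_kernel k X a b * 1"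
      by (intro mult_left_mono walk_kernel_nonneg)
    thus "(\<Sum>d\<in>V - {a, b}. walk_kernel k X a b * walk_kernel k X a d) \<le> walk_kernel k X a b"
      by (simp add: sum_distrib_left)
  qed
  also have "\<dots> \<le> 1 / (card V - 1)"
    by (rule expectation_walk_kernel_le) (use assms in auto)
  finally have *: "real (card V - 2) * measure_pmf.expectation ?M (\<lambda>X. walk_kernel k X a b * walk_kernel k X a c) \<le> 1 / (card V - 1)" .
  have "c \<in> V - {a, b}" using assms by auto
  hence "card (V - {a, b}) > 0" using assms(1) by (auto simp: card_gt_0_iff)
  hence "card V - 2 > 0" using cardD by simp
  hence "measure_pmf.expectation ?M (\<lambda>X. walk_kernel k X a b * walk_kernel k X a c) \<le>
      (1 / (card V - 1)) / real (card V - 2)"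
    using * by (subst pos_le_divide_eq) (simp_all only: of_nat_0_less_iff mult.commute)
  thus ?thesis by simp
qed

section \<open>Simple paths\<close>

fun path_weight :: "('a \<Rightarrow> 'a \<Rightarrow> real) \<Rightarrow> 'a \<Rightarrow> 'a list \<Rightarrow> real" where
  "path_weight K x [] = 1"
| "path_weight K x (y # ys) = K x y * path_weight K y ys"

definition path_arcs :: "'a \<Rightarrow> 'a list \<Rightarrow> ('a \<times> 'a) set" where
  "path_arcs x ys = set (zip (x # ys) ys)"

lemma path_arcs_Nil [simp]: "path_arcs x [] = {}"
  by (simp add: path_arcs_def)

lemma path_arcs_Cons [simp]: "path_arcs x (y # ys) = insert (x, y) (path_arcs y ys)"
  by (simp add: path_arcs_def)

lemma finite_path_arcs [simp]: "finite (path_arcs x ys)"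
  by (simp add: path_arcs_def)

lemma path_arcsD: "(a, b) \<in> path_arcs x ys \<Longrightarrow> a \<in> set (x # ys) \<and> b \<in> set ys"
  by (induction ys arbitrary: x) auto

lemma path_arcs_functional:
  "distinct (x # ys) \<Longrightarrow> (a, b) \<in> path_arcs x ys \<Longrightarrow> (a, c) \<in> path_arcs x ys \<Longrightarrow> b = c"
  by (induction ys arbitrary: x) (auto dest: path_arcsD)

lemma path_arcs_injective:
  "distinct (x # ys) \<Longrightarrow> (a, c) \<in> path_arcs x ys \<Longrightarrow> (b, c) \<in> path_arcs x ys \<Longrightarrow> a = b"
  by (induction ys arbitrary: x) (auto dest: path_arcsD)

lemma path_arcs_subset:
  "distinct (x # ys) \<Longrightarrow> x \<in> V \<Longrightarrow> set ys \<subseteq> V \<Longrightarrow> path_arcs x ys \<subseteq> arc_pairs V"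
  by (induction ys arbitrary: x) (auto simp: arc_pairs_def)

lemma card_path_arcs: "distinct (x # ys) \<Longrightarrow> card (path_arcs x ys) = length ys"
proof (induction ys arbitrary: x)
  case (Cons y ys)
  hence "(x, y) \<notin> path_arcs y ys" by (auto dest: path_arcsD)
  with Cons show ?case by simp
qed simp

lemma path_weight_eq_prod:
  "distinct (x # ys) \<Longrightarrow> path_weight K x ys = (\<Prod>(a, b)\<in>path_arcs x ys. K a b)"
proof (induction ys arbitrary: x)
  case (Cons y ys)
  hence "(x, y) \<notin> path_arcs y ys" by (auto dest: path_arcsD)
  with Cons show ?case by simp
qed simp

lemma sum_path_weight_eq_act:
  assumes "finite V" "x \<in> V" "v \<in> V"
  shows "(\<Sum>ys | set ys \<subseteq> V \<and> length ys = t \<and> last (x # ys) = v. path_weight K x ys) =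
    (act V K ^^ t) (dirac x) v"
  using assms(2)
proof (induction t arbitrary: x)
  case 0
  have "{ys. set ys \<subseteq> V \<and> length ys = 0 \<and> last (x # ys) = v} = (if x = v then {[]} else {})"
    by auto
  thus ?case by (simp add: dirac_def)
next
  case (Suc t)
  let ?L = "\<lambda>y. {ys. set ys \<subseteq> V \<and> length ys = t \<and> last (y # ys) = v}"
  have fin: "finite (?L y)" for y
    by (rule finite_subset[OF _ finite_lists_length_eq[OF assms(1), of t]]) auto
  have "{ys. set ys \<subseteq> V \<and> length ys = Suc t \<and> last (x # ys) = v} = (\<lambda>(y, ys). y # ys) ` (SIGMA y:V. ?L y)"
    by (auto simp: length_Suc_conv image_iff)
  hence "(\<Sum>ys | set ys \<subseteq> V \<and> length ys = Suc t \<and> last (x # ys) = v. path_weight K x ys) =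
     (\<Sum>(y, ys)\<in>(SIGMA y:V. ?L y). K x y * path_weight K y ys)"
    by (simp add: sum.reindex inj_on_def case_prod_unfold)
  also have "\<dots> = (\<Sum>y\<in>V. \<Sum>ys\<in>?L y. K x y * path_weight K y ys)"
    using assms(1) fin by (subst sum.Sigma) auto
  also have "\<dots> = (\<Sum>y\<in>V. K x y * (act V K ^^ t) (dirac y) v)"
    by (intro sum.cong refl) (simp only: Suc.IH sum_distrib_left[symmetric])
  also have "\<dots> = (act V K ^^ t) (K x) v"
    by (subst (2) funpow_act_eq_sum_dirac[OF assms(1,3)]) simp
  also have "\<dots> = (act V K ^^ Suc t) (dirac x) v"
    by (simp add: funpow_Suc_right act_dirac assms(1) Suc.prems del: funpow.simps)
  finally show ?case .
qed

definition simple_paths :: "'a set \<Rightarrow> 'a \<Rightarrow> nat \<Rightarrow> 'a list set" where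
  "simple_paths V x t = {ys. length ys = t \<and> distinct (x # ys) \<and> set ys \<subseteq> V}"

lemma finite_simple_paths: "finite V \<Longrightarrow> finite (simple_paths V x t)"
  by (rule finite_subset[OF _ finite_lists_length_eq[of V t]]) (auto simp: simple_paths_def)

lemma card_simple_paths:
  assumes "finite V" "x \<in> V" "t < card V"
  shows "(card V - t) ^ t \<le> card (simple_paths V x t)" "card (simple_paths V x t) \<le> (card V - 1) ^ t"
proof -
  have "simple_paths V x t = {ys. length ys = t \<and> distinct ys \<and> set ys \<subseteq> V - {x}}"
    by (auto simp: simple_paths_def)
  hence eq: "card (simple_paths V x t) = \<Prod>{card V - 1 - t + 1..card V - 1}"
    using assms by (simp add: card_lists_distinct_length_eq)
  have card: "card {card V - 1 - t + 1..card V - 1} = t" using assms by simp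
  have "(\<Prod>i\<in>{card V - 1 - t + 1..card V - 1}. card V - t) \<le> \<Prod>{card V - 1 - t + 1..card V - 1}"
    using assms by (intro prod_mono) auto
  thus "(card V - t) ^ t \<le> card (simple_paths V x t)" using eq card by simp
  have "\<Prod>{card V - 1 - t + 1..card V - 1} \<le> (\<Prod>i\<in>{card V - 1 - t + 1..card V - 1}. card V - 1)"
    using assms by (intro prod_mono) auto
  thus "card (simple_paths V x t) \<le> (card V - 1) ^ t" using eq card by simp
qed

lemma sum_simple_path_weight_le_act:
  assumes "finite V" "x \<in> V" "v \<in> V" "\<And>a b. 0 \<le> K a b"
  shows "(\<Sum>ys | ys \<in> simple_paths V x t \<and> last (x # ys) = v. path_weight K x ys) \<le>
    (act V K ^^ t) (dirac x) v"
proof -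
  have nn: "0 \<le> path_weight K x ys" for x ys
    using assms(4) by (induction ys arbitrary: x) auto
  show ?thesis
    unfolding sum_path_weight_eq_act[OF assms(1-3), symmetric]
  proof (rule sum_mono2)
    show "finite {ys. set ys \<subseteq> V \<and> length ys = t \<and> last (x # ys) = v}"
      by (rule finite_subset[OF _ finite_lists_length_eq[OF assms(1), of t]]) auto
  qed (auto simp: simple_paths_def nn)
qed

text \<open>The arcs of a simple path form such a partial matching \<open>A\<close>. Each vertex has
  at most one predecessor in \<open>A\<close>, so an entrywise bound \<open>m\<close> becomes
  \<open>q * mass + \<rho> * m\<close> after one step; the first summand of the bound is the fixed
  point of this recursion. The exponent \<open>T\<close> is separate from \<open>t\<close> so that
  the bound on the mass stays constant during the induction.\<close>

lemma act_uniform_plus_matching_le: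
  fixes A :: "('a \<times> 'a) set" and q \<rho> :: real
  assumes "finite V" "x \<in> V" "v \<in> V" "0 \<le> q" "0 \<le> \<rho>" "\<rho> < 1" "1 \<le> card V * q + \<rho>"
    and "\<And>a b c. (a, b) \<in> A \<Longrightarrow> (a, c) \<in> A \<Longrightarrow> b = c" "\<And>a b c. (a, c) \<in> A \<Longrightarrow> (b, c) \<in> A \<Longrightarrow> a = b"
    and K: "K = (\<lambda>a b. q + \<rho> * of_bool ((a, b) \<in> A))" and "t \<le> T"
  shows "(act V K ^^ t) (dirac x) v \<le> q * (card V * q + \<rho>) ^ T / (1 - \<rho>) + \<rho> ^ t"
proof -
  let ?f = "\<lambda>t. (act V K ^^ t) (dirac x)" and ?M = "(card V * q + \<rho>) ^ T"
  have card1: "(\<Sum>b\<in>B. of_bool (P b)) \<le> (1::real)" if "finite B" "\<And>b c. P b \<Longrightarrow> P c \<Longrightarrow> b = c" for B :: "'a set" and P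
  proof -
    have "card (B \<inter> {b. P b}) \<le> 1"
      using that by (auto simp: card_le_Suc0_iff_eq)
    thus ?thesis using that(1) by simp
  qed
  have nn: "0 \<le> ?f t w" if "w \<in> V" for t w
    using assms that by (intro funpow_act_nonneg) (auto simp: dirac_nonneg)
  have mass: "sum (?f t) V \<le> (card V * q + \<rho>) ^ t" for t
  proof (induction t)
    case 0
    then show ?case using assms by (simp add: sum_dirac)
  next
    case (Suc t)
    have "sum (?f (Suc t)) V = (\<Sum>w\<in>V. ?f t w * (\<Sum>v\<in>V. K w v))"
      by (simp add: sum_act)
    also have "\<dots> \<le> (\<Sum>w\<in>V. ?f t w * (card V * q + \<rho>))"
    proof (intro sum_mono mult_left_mono nn)
      fix w assume "w \<in> V"
      have "(\<Sum>v\<in>V. K w v) = card V * q + \<rho> * (\<Sum>v\<in>V. of_bool ((w, v) \<in> A))"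
        by (simp only: K sum.distrib sum_distrib_left) simp
      also have "\<dots> \<le> card V * q + \<rho> * 1"
        using assms by (intro add_left_mono mult_left_mono card1) auto
      finally show "(\<Sum>v\<in>V. K w v) \<le> card V * q + \<rho>" by simp
    qed
    also have "\<dots> = sum (?f t) V * (card V * q + \<rho>)" by (simp add: sum_distrib_right)
    also have "\<dots> \<le> (card V * q + \<rho>) ^ t * (card V * q + \<rho>)"
      using assms by (intro mult_right_mono Suc.IH) auto
    finally show ?case by (simp add: mult.commute)
  qed
  show ?thesis
    using assms(3,11)
  proof (induction t arbitrary: v)
    case 0
    have "0 \<le> q * ?M / (1 - \<rho>)" using assms by auto
    then show ?case by (simp add: dirac_def)
  next
    case (Suc t)
    define m where "m = q * ?M / (1 - \<rho>) + \<rho> ^ t"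
    have "0 \<le> m" using assms by (auto simp: m_def)
    have "?f (Suc t) v = q * sum (?f t) V + \<rho> * (\<Sum>w\<in>V. ?f t w * of_bool ((w, v) \<in> A))"
      unfolding funpow_Suc_act K by (simp add: algebra_simps sum.distrib sum_distrib_left)
    also have "q * sum (?f t) V \<le> q * ?M"
      using assms(4,7) Suc.prems by (intro mult_left_mono order.trans[OF mass] power_increasing) auto
    also have "(\<Sum>w\<in>V. ?f t w * of_bool ((w, v) \<in> A)) \<le> (\<Sum>w\<in>V. m * of_bool ((w, v) \<in> A))"
      using Suc by (intro sum_mono mult_right_mono) (auto simp: m_def)
    also have "\<dots> = m * (\<Sum>w\<in>V. of_bool ((w, v) \<in> A))" by (simp only: sum_distrib_left)
    also have "\<dots> \<le> m * 1"
      using assms \<open>0 \<le> m\<close> by (intro mult_left_mono card1) auto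
    also have "q * ?M + \<rho> * (m * 1) = q * ?M / (1 - \<rho>) + \<rho> ^ Suc t"
      using assms(6) by (simp add: m_def field_simps)
    finally show ?case using assms(5) by (simp add: mult_left_mono)
  qed
qed

section \<open>Second moment of the mass carried by simple paths\<close>

text \<open>Thanks to this, the weight of one simple path takes at most one factor from each row,
  and the product of two weights at most two. First and second moments of single rows are therefore
  enough.\<close>

lemma path_arcs_row_cases:
  assumes "distinct (x # ys)"
  obtains "{e \<in> path_arcs x ys. fst e = a} = {}" | b where "(a, b) \<in> path_arcs x ys" "{e \<in> path_arcs x ys. fst e = a} = {(a, b)}"
proof (cases "{e \<in> path_arcs x ys. fst e = a} = {}")
  case False
  then obtain b where b: "(a, b) \<in> path_arcs x ys" by auto
  have "{e \<in> path_arcs x ys. fst e = a} = {(a, b)}"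
    using b path_arcs_functional[OF assms] by fastforce
  with b that show ?thesis by blast
qed (use that in auto)

lemma prod_path_arcs_group:
  assumes "distinct (x # ys)" "x \<in> V" "set ys \<subseteq> V" "finite V"
  shows "(\<Prod>(a, b)\<in>path_arcs x ys. K a b) = (\<Prod>a\<in>V. \<Prod>e | e \<in> path_arcs x ys \<and> fst e = a. K (fst e) (snd e))"
proof -
  have "fst ` path_arcs x ys \<subseteq> V"
    using path_arcs_subset[OF assms(1-3)] by (auto simp: arc_pairs_def)
  thus ?thesis using assms(4) by (subst prod.group) (auto simp: case_prod_unfold)
qed

lemma expectation_path_weight_prod:
  fixes F :: "'a \<Rightarrow> ('a \<Rightarrow> real) \<Rightarrow> real"
  assumes "finite V"
  shows "measure_pmf.expectation (random_subset (arc_pairs V) p) (\<lambda>X. \<Prod>a\<in>V. F a (walk_kernel k X a)) =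
    (\<Prod>a\<in>V. measure_pmf.expectation (random_subset (arc_pairs V) p) (\<lambda>X. F a (walk_kernel k X a)))"
proof -
  define T where "T a = arc_pairs V \<inter> {a} \<times> UNIV" for a
  have eq: "F a (walk_kernel k (X \<inter> T a) a) = F a (walk_kernel k X a)" if "X \<subseteq> arc_pairs V" for a X
  proof -
    have "X \<inter> T a = X \<inter> {a} \<times> UNIV" using that by (auto simp: T_def)
    thus ?thesis using walk_kernel_Int[of k X a] by presburger
  qed
  have "measure_pmf.expectation (random_subset (arc_pairs V) p) (\<lambda>X. \<Prod>a\<in>V. F a (walk_kernel k (X \<inter> T a) a)) =
    (\<Prod>a\<in>V. measure_pmf.expectation (random_subset (arc_pairs V) p) (\<lambda>X. F a (walk_kernel k (X \<inter> T a) a)))"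
    by (rule expectation_random_subset_prod[where T = T and F = "\<lambda>a Y. F a (walk_kernel k Y a)"])
       (auto simp: assms finite_arc_pairs T_def disjoint_family_on_def)
  also have "measure_pmf.expectation (random_subset (arc_pairs V) p) (\<lambda>X. \<Prod>a\<in>V. F a (walk_kernel k (X \<inter> T a) a)) =
      measure_pmf.expectation (random_subset (arc_pairs V) p) (\<lambda>X. \<Prod>a\<in>V. F a (walk_kernel k X a))"
    by (intro expectation_random_subset_cong prod.cong refl eq)
  also have "(\<Prod>a\<in>V. measure_pmf.expectation (random_subset (arc_pairs V) p) (\<lambda>X. F a (walk_kernel k (X \<inter> T a) a))) =
      (\<Prod>a\<in>V. measure_pmf.expectation (random_subset (arc_pairs V) p) (\<lambda>X. F a (walk_kernel k X a)))"
    by (intro expectation_random_subset_cong prod.cong refl eq)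
  finally show ?thesis .
qed

lemma expectation_path_weight_ge:
  fixes k q0 :: real
  assumes "finite V" "x \<in> V" "0 < k" "ys \<in> simple_paths V x t" "0 \<le> q0"
    and "\<And>a. a \<in> V \<Longrightarrow> q0 \<le> measure_pmf.prob (random_subset (arc_pairs V) p) {X. k \<le> real (card (X `` {a}))}"
  shows "(q0 / (card V - 1)) ^ t \<le>
    measure_pmf.expectation (random_subset (arc_pairs V) p) (\<lambda>X. path_weight (walk_kernel k X) x ys)"
proof -
  let ?M = "random_subset (arc_pairs V) p"
  have ys: "distinct (x # ys)" "length ys = t" "set ys \<subseteq> V"
    using assms(4) by (auto simp: simple_paths_def)
  note sub = path_arcs_subset[OF ys(1) assms(2) ys(3)]
  let ?A = "\<lambda>a. {e \<in> path_arcs x ys. fst e = a}"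
  have "measure_pmf.expectation ?M (\<lambda>X. path_weight (walk_kernel k X) x ys) =
     measure_pmf.expectation ?M (\<lambda>X. \<Prod>a\<in>V. \<Prod>e\<in>?A a. walk_kernel k X a (snd e))"
    by (simp add: path_weight_eq_prod[OF ys(1)] prod_path_arcs_group[OF ys(1) assms(2) ys(3) assms(1)])
  also have "\<dots> = (\<Prod>a\<in>V. measure_pmf.expectation ?M (\<lambda>X. \<Prod>e\<in>?A a. walk_kernel k X a (snd e)))"
    by (rule expectation_path_weight_prod[OF assms(1), of p "\<lambda>a f. \<Prod>e\<in>?A a. f (snd e)"])
  also have "\<dots> \<ge> (\<Prod>a\<in>V. \<Prod>e\<in>?A a. q0 / (card V - 1))"
  proof (rule prod_mono)
    fix a assume a: "a \<in> V"
    show "0 \<le> (\<Prod>e\<in>?A a. q0 / (card V - 1)) \<and> (\<Prod>e\<in>?A a. q0 / (card V - 1)) \<le>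
      measure_pmf.expectation ?M (\<lambda>X. \<Prod>e\<in>?A a. walk_kernel k X a (snd e))"
    proof (cases rule: path_arcs_row_cases[OF ys(1), of a])
      case (2 b)
      hence b: "b \<in> V - {a}" using sub by (auto simp: arc_pairs_def)
      show ?thesis
        unfolding 2(2) using assms(5) assms(6)[OF a]
        by (simp add: expectation_walk_kernel[OF assms(1) a b assms(3)] divide_right_mono)
    next
      case 1
      show ?thesis unfolding 1 by simp
    qed
  qed
  also have "(\<Prod>a\<in>V. \<Prod>e\<in>?A a. q0 / (card V - 1)) = (q0 / (card V - 1)) ^ t"
    using prod_path_arcs_group[OF ys(1) assms(2) ys(3) assms(1), of "\<lambda>_ _. q0 / (card V - 1)"]
    by (simp add: card_path_arcs[OF ys(1)] ys(2))
  finally show ?thesis .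
qed

text \<open>The expectation factors over the rows. Each arc of \<open>ys\<close> is charged
  \<open>1 / (card V - 1)\<close>; an arc of \<open>zs\<close> is charged
  \<open>1 / (card V - 2)\<close>, and an additional \<open>1 / k\<close> when it also lies on
  \<open>ys\<close>. The bound is written as a path weight of \<open>zs\<close> so that the sum over
  \<open>zs\<close> becomes an entry of a matrix power.\<close>

lemma expectation_path_weight_mult_le:
  fixes k :: real
  assumes "finite V" "3 \<le> card V" "x \<in> V" "0 < k" "ys \<in> simple_paths V x t" "zs \<in> simple_paths V x t"
  shows "measure_pmf.expectation (random_subset (arc_pairs V) p)
      (\<lambda>X. path_weight (walk_kernel k X) x ys * path_weight (walk_kernel k X) x zs) \<le>
    (1 / real (card V - 1)) ^ t *
    path_weight (\<lambda>a b. 1 / real (card V - 2) + 1 / k * of_bool ((a, b) \<in> path_arcs x ys)) x zs"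
proof -
  let ?M = "random_subset (arc_pairs V) p"
  define \<kappa> where "\<kappa> = (\<lambda>a b. 1 / real (card V - 2) + 1 / k * of_bool ((a, b) \<in> path_arcs x ys))"
  have ys: "distinct (x # ys)" "length ys = t" "set ys \<subseteq> V"
    using assms(5) by (auto simp: simple_paths_def)
  have zs: "distinct (x # zs)" "length zs = t" "set zs \<subseteq> V"
    using assms(6) by (auto simp: simple_paths_def)
  note subys = path_arcs_subset[OF ys(1) assms(3) ys(3)] and subzs = path_arcs_subset[OF zs(1) assms(3) zs(3)]
  note groupys = prod_path_arcs_group[OF ys(1) assms(3) ys(3) assms(1)]
    and groupzs = prod_path_arcs_group[OF zs(1) assms(3) zs(3) assms(1)]
  let ?A = "\<lambda>a. {e \<in> path_arcs x ys. fst e = a}"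
  let ?B = "\<lambda>a. {e \<in> path_arcs x zs. fst e = a}"
  have le: "1 / real (card V - 1) \<le> 1 / real (card V - 2)"
    using assms(2) by (intro divide_left_mono) auto
  have \<kappa>1: "1 / real (card V - 2) \<le> \<kappa> a b" "1 / k \<le> \<kappa> a b \<or> (a, b) \<notin> path_arcs x ys" "0 \<le> \<kappa> a b" for a b
    using assms(4) by (auto simp: \<kappa>_def)
  have "measure_pmf.expectation ?M (\<lambda>X. path_weight (walk_kernel k X) x ys * path_weight (walk_kernel k X) x zs) =
     measure_pmf.expectation ?M (\<lambda>X. \<Prod>a\<in>V. (\<Prod>e\<in>?A a. walk_kernel k X a (snd e)) * (\<Prod>e\<in>?B a. walk_kernel k X a (snd e)))"
    by (simp add: path_weight_eq_prod[OF ys(1)] groupys path_weight_eq_prod[OF zs(1)] groupzs prod.distrib)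
  also have "\<dots> = (\<Prod>a\<in>V. measure_pmf.expectation ?M
       (\<lambda>X. (\<Prod>e\<in>?A a. walk_kernel k X a (snd e)) * (\<Prod>e\<in>?B a. walk_kernel k X a (snd e))))"
    by (rule expectation_path_weight_prod[OF assms(1), of p "\<lambda>a f. (\<Prod>e\<in>?A a. f (snd e)) * (\<Prod>e\<in>?B a. f (snd e))"])
  also have "\<dots> \<le> (\<Prod>a\<in>V. (\<Prod>e\<in>?A a. 1 / real (card V - 1)) * (\<Prod>e\<in>?B a. \<kappa> a (snd e)))"
  proof (rule prod_mono, intro conjI)
    fix a assume a: "a \<in> V"
    show "0 \<le> measure_pmf.expectation ?M
       (\<lambda>X. (\<Prod>e\<in>?A a. walk_kernel k X a (snd e)) * (\<Prod>e\<in>?B a. walk_kernel k X a (snd e)))"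
      by (intro integral_nonneg_AE AE_I2 mult_nonneg_nonneg prod_nonneg walk_kernel_nonneg)
    show "measure_pmf.expectation ?M
       (\<lambda>X. (\<Prod>e\<in>?A a. walk_kernel k X a (snd e)) * (\<Prod>e\<in>?B a. walk_kernel k X a (snd e))) \<le>
       (\<Prod>e\<in>?A a. 1 / real (card V - 1)) * (\<Prod>e\<in>?B a. \<kappa> a (snd e))"
    proof (cases rule: path_arcs_row_cases[OF ys(1), of a])
      case 1
      show ?thesis
      proof (cases rule: path_arcs_row_cases[OF zs(1), of a])
        case (2 c)
        hence c: "c \<in> V - {a}" using subzs by (auto simp: arc_pairs_def)
        show ?thesis
          unfolding 1 2(2)
          using order.trans[OF expectation_walk_kernel_le[OF assms(1) a c assms(4), of p] order.trans[OF le \<kappa>1(1)]]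
          by simp
      next
        case B: 1
        show ?thesis unfolding 1 B by simp
      qed
    next
      case ys_a: (2 b)
      hence b: "b \<in> V - {a}" using subys by (auto simp: arc_pairs_def)
      show ?thesis
      proof (cases rule: path_arcs_row_cases[OF zs(1), of a])
        case 1
        show ?thesis
          unfolding 1 ys_a(2) using expectation_walk_kernel_le[OF assms(1) a b assms(4), of p] by simp
      next
        case (2 c)
        hence c: "c \<in> V - {a}" using subzs by (auto simp: arc_pairs_def)
        have "measure_pmf.expectation ?M (\<lambda>X. walk_kernel k X a b * walk_kernel k X a c) \<le>
          1 / real (card V - 1) * \<kappa> a c"
        proof (cases "b = c")
          case True
          have "measure_pmf.expectation ?M (\<lambda>X. walk_kernel k X a b * walk_kernel k X a b) \<le> 
            1 / real (card V - 1) * (1 / k)"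
            by (rule expectation_walk_kernel_same_le[OF assms(1) a b assms(4)])
          also have "\<dots> \<le> 1 / real (card V - 1) * \<kappa> a c"
            using True ys_a(1) \<kappa>1(2)[of a c] by (intro mult_left_mono) auto
          finally show ?thesis using True by simp
        next
          case False
          have "measure_pmf.expectation ?M (\<lambda>X. walk_kernel k X a b * walk_kernel k X a c) \<le> 
            1 / real (card V - 1) * (1 / real (card V - 2))"
            by (rule expectation_walk_kernel_diff_le[OF assms(1) a b c False assms(4)])
          also have "\<dots> \<le> 1 / real (card V - 1) * \<kappa> a c"
            by (intro mult_left_mono \<kappa>1) auto
          finally show ?thesis .
        qed
        thus ?thesis unfolding ys_a(2) 2(2) by simp
      qed
    qed
  qed
  also have "\<dots> = (1 / real (card V - 1)) ^ t * path_weight \<kappa> x zs"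
    using groupys[of "\<lambda>_ _. 1 / real (card V - 1)"]
    by (simp add: path_weight_eq_prod[OF zs(1)] groupzs prod.distrib card_path_arcs[OF ys(1)] ys(2))
  finally show ?thesis by (simp add: \<kappa>_def)
qed

text \<open>The squares expand into pairs of simple paths with a common end point. For fixed
  \<open>ys\<close>, the sum over \<open>zs\<close> is bounded by the uniform kernel perturbed along
  the matching \<open>path_arcs x ys\<close>; the at most \<open>(card V - 1) ^ t\<close> choices of
  \<open>ys\<close> cancel the factors charged to the arcs of \<open>ys\<close>.\<close>

lemma expectation_square_simple_path_sum_le:
  fixes k :: real
  assumes "finite V" "3 \<le> card V" "x \<in> V" "1 < k" "t < card V"
  shows "measure_pmf.expectation (random_subset (arc_pairs V) p)
      (\<lambda>X. \<Sum>v\<in>V. (\<Sum>ys | ys \<in> simple_paths V x t \<and> last (x # ys) = v. path_weight (walk_kernel k X) x ys)\<^sup>2) \<le>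
    1 / real (card V - 2) * (card V * (1 / real (card V - 2)) + 1 / k) ^ t / (1 - 1 / k) + (1 / k) ^ t"
    (is "?lhs \<le> ?B")
proof -
  let ?M = "random_subset (arc_pairs V) p" and ?P = "simple_paths V x t"
  let ?w = "\<lambda>X. path_weight (walk_kernel k X) x"
  let ?Pv = "\<lambda>v. {ys. ys \<in> ?P \<and> last (x # ys) = v}"
  define u where "u = 1 / real (card V - 1)"
  define \<kappa> where "\<kappa> ys = (\<lambda>a b. 1 / real (card V - 2) + 1 / k * of_bool ((a, b) \<in> path_arcs x ys))" for ys
  note finP = finite_simple_paths[OF assms(1), of x t]
  have lastV: "last (x # ys) \<in> V" if "ys \<in> ?P" for ys
    using that assms(3) by (auto simp: simple_paths_def)
  have "(\<Sum>v\<in>V. (\<Sum>ys\<in>?Pv v. ?w X ys)\<^sup>2) = (\<Sum>ys\<in>?P. \<Sum>zs\<in>?Pv (last (x # ys)). ?w X ys * ?w X zs)" for X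
  proof -
    have "(\<Sum>v\<in>V. (\<Sum>ys\<in>?Pv v. ?w X ys)\<^sup>2) = (\<Sum>v\<in>V. \<Sum>ys\<in>?Pv v. \<Sum>zs\<in>?Pv v. ?w X ys * ?w X zs)"
      by (simp add: power2_eq_square sum_product)
    also have "\<dots> = (\<Sum>v\<in>V. \<Sum>ys\<in>?Pv v. \<Sum>zs\<in>?Pv (last (x # ys)). ?w X ys * ?w X zs)"
      by (intro sum.cong refl) auto
    also have "\<dots> = (\<Sum>ys\<in>?P. \<Sum>zs\<in>?Pv (last (x # ys)). ?w X ys * ?w X zs)"
      by (rule sum.group[OF finP assms(1)]) (use lastV in blast)
    finally show ?thesis .
  qed
  hence "?lhs = measure_pmf.expectation ?M (\<lambda>X. \<Sum>ys\<in>?P. \<Sum>zs\<in>?Pv (last (x # ys)). ?w X ys * ?w X zs)"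
    by simp
  also have "\<dots> = (\<Sum>ys\<in>?P. \<Sum>zs\<in>?Pv (last (x # ys)). measure_pmf.expectation ?M (\<lambda>X. ?w X ys * ?w X zs))"
    by (simp only: Bochner_Integration.integral_sum integrable_random_subset finite_arc_pairs assms(1))
  also have "\<dots> \<le> (\<Sum>ys\<in>?P. \<Sum>zs\<in>?Pv (last (x # ys)). u ^ t * path_weight (\<kappa> ys) x zs)"
    unfolding u_def \<kappa>_def using assms by (intro sum_mono expectation_path_weight_mult_le) auto
  also have "\<dots> = (\<Sum>ys\<in>?P. u ^ t * (\<Sum>zs\<in>?Pv (last (x # ys)). path_weight (\<kappa> ys) x zs))"
    by (simp only: sum_distrib_left)
  also have "\<dots> \<le> (\<Sum>ys\<in>?P. u ^ t * ?B)"
  proof (intro sum_mono mult_left_mono)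
    fix ys assume ys: "ys \<in> ?P"
    hence d: "distinct (x # ys)" by (simp add: simple_paths_def)
    have "(\<Sum>zs\<in>?Pv (last (x # ys)). path_weight (\<kappa> ys) x zs) \<le> (act V (\<kappa> ys) ^^ t) (dirac x) (last (x # ys))"
      using assms(4) by (intro sum_simple_path_weight_le_act assms lastV ys) (auto simp: \<kappa>_def)
    also have "\<dots> \<le> ?B"
    proof (rule act_uniform_plus_matching_le[where A = "path_arcs x ys"])
      have "1 \<le> card V * (1 / real (card V - 2))" using assms(2) by (simp add: field_simps)
      thus "1 \<le> card V * (1 / real (card V - 2)) + 1 / k"
        using assms(4) by (intro add_increasing2) auto
    qed (use assms lastV[OF ys] path_arcs_functional[OF d] path_arcs_injective[OF d] in \<open>auto simp: \<kappa>_def\<close>)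
    finally show "(\<Sum>zs\<in>?Pv (last (x # ys)). path_weight (\<kappa> ys) x zs) \<le> ?B" .
  qed (simp add: u_def)
  also have "\<dots> = card ?P * u ^ t * ?B" by simp
  also have "\<dots> \<le> 1 * ?B"
  proof (rule mult_right_mono)
    have "real (card ?P) \<le> real (card V - 1) ^ t"
      using card_simple_paths(2)[OF assms(1,3,5)] by (metis of_nat_le_iff of_nat_power)
    thus "card ?P * u ^ t \<le> 1"
      using assms(2) by (simp add: u_def field_simps)
    show "0 \<le> ?B" using assms(4) by (intro add_nonneg_nonneg divide_nonneg_nonneg mult_nonneg_nonneg zero_le_power) auto
  qed
  finally show ?thesis by simp
qed

text \<open>The mass that the walk carries along simple paths alone is already spread almost uniformly:
  two simple paths with the same end point rarely share an arc, so that the second moment of this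
  mass is close to \<open>1 / card V\<close>.\<close>

lemma prob_deficit_gt_le:
  fixes k \<epsilon> q0 :: real
  assumes "finite V" "3 \<le> card V" "x \<in> V" "1 < k" "t < card V" "0 < \<epsilon>" "0 \<le> q0"
    and "\<And>a. a \<in> V \<Longrightarrow> q0 \<le> measure_pmf.prob (random_subset (arc_pairs V) p) {X. k \<le> real (card (X `` {a}))}"
  shows "measure_pmf.prob (random_subset (arc_pairs V) p)
      {X. \<epsilon> < deficit V ((act V (walk_kernel k X) ^^ t) (dirac x))} \<le>
    (card V * (1 / real (card V - 2) * (card V * (1 / real (card V - 2)) + 1 / k) ^ t / (1 - 1 / k) + (1 / k) ^ t)
      - 2 * (q0 * (card V - t) / (card V - 1)) ^ t + 1) / \<epsilon>\<^sup>2"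
proof -
  let ?M = "random_subset (arc_pairs V) p" and ?P = "simple_paths V x t" and ?n = "real (card V)"
  let ?w = "\<lambda>X. path_weight (walk_kernel k X) x"
  let ?Pv = "\<lambda>v. {ys. ys \<in> ?P \<and> last (x # ys) = v}"
  let ?B = "1 / real (card V - 2) * (?n * (1 / real (card V - 2)) + 1 / k) ^ t / (1 - 1 / k) + (1 / k) ^ t"
  define R where "R X v = (\<Sum>ys\<in>?Pv v. ?w X ys)" for X v
  \<comment> \<open>This is the expanded form of
    \<open>?n * (\<Sum>v\<in>V. (R X v - 1 / ?n)\<^sup>2)\<close>: its expectation involves only the
    second moment of \<open>R\<close> and the expected total mass, and by Cauchy-Schwarz it
    dominates the square of the deficit.\<close>
  define Z where "Z X = ?n * (\<Sum>v\<in>V. (R X v)\<^sup>2) - 2 * (\<Sum>ys\<in>?P. ?w X ys) + 1" for X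
  note finP = finite_simple_paths[OF assms(1), of x t]
  note finA = finite_arc_pairs[OF assms(1)]
  have n: "?n > 0" using assms(2) by simp
  have Z: "Z X = ?n * (\<Sum>v\<in>V. (R X v - 1 / ?n)\<^sup>2)" for X
  proof -
    have sumR: "(\<Sum>v\<in>V. R X v) = (\<Sum>ys\<in>?P. ?w X ys)"
      unfolding R_def by (rule sum.group[OF finP assms(1)]) (use assms(3) in \<open>auto simp: simple_paths_def\<close>)
    define c where "c = 1 / ?n"
    have nc: "?n * c = 1" using n by (simp add: c_def)
    have "(\<Sum>v\<in>V. (R X v - c)\<^sup>2) = (\<Sum>v\<in>V. (R X v)\<^sup>2 - (2 * c) * R X v + c\<^sup>2)"
      by (intro sum.cong) (auto simp: power2_eq_square algebra_simps)
    also have "\<dots> = (\<Sum>v\<in>V. (R X v)\<^sup>2) - (2 * c) * (\<Sum>v\<in>V. R X v) + ?n * c\<^sup>2"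
      by (simp add: sum.distrib sum_subtractf sum_distrib_left)
    finally have eq: "(\<Sum>v\<in>V. (R X v - c)\<^sup>2) =
        (\<Sum>v\<in>V. (R X v)\<^sup>2) - (2 * c) * (\<Sum>v\<in>V. R X v) + ?n * c\<^sup>2" .
    have "?n * (\<Sum>v\<in>V. (R X v - c)\<^sup>2) =
        ?n * (\<Sum>v\<in>V. (R X v)\<^sup>2) - 2 * (?n * c) * (\<Sum>v\<in>V. R X v) + (?n * c)\<^sup>2"
      unfolding eq by (simp add: algebra_simps power2_eq_square)
    thus ?thesis unfolding nc sumR by (simp add: Z_def c_def)
  qed
  have "measure_pmf.prob ?M {X. \<epsilon> < deficit V ((act V (walk_kernel k X) ^^ t) (dirac x))} \<le>
      measure_pmf.expectation ?M Z / \<epsilon>\<^sup>2"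
  proof (rule prob_le_expectation_div)
    show "finite (set_pmf ?M)" by (rule finite_set_pmf_random_subset[OF finA])
    show "0 \<le> Z X" for X by (auto simp: Z intro!: sum_nonneg mult_nonneg_nonneg)
    fix X assume eps: "\<epsilon> < deficit V ((act V (walk_kernel k X) ^^ t) (dirac x))"
    also have "\<dots> \<le> deficit V (R X)"
      unfolding R_def using assms by (intro deficit_mono sum_simple_path_weight_le_act walk_kernel_nonneg) auto
    also have "\<dots> \<le> (\<Sum>v\<in>V. \<bar>R X v - 1 / ?n\<bar>)"
      unfolding deficit_def by (intro sum_mono) auto
    finally have "\<epsilon>\<^sup>2 \<le> (\<Sum>v\<in>V. \<bar>R X v - 1 / ?n\<bar>)\<^sup>2"
      using assms(6) by (intro power_mono) auto
    also have "\<dots> \<le> Z X"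
      using sum_squared_le_sum_of_squares[of "\<lambda>v. \<bar>R X v - 1 / ?n\<bar>" V] by (simp add: Z mult.commute)
    finally show "\<epsilon>\<^sup>2 \<le> Z X" .
  qed (use assms in auto)
  also have "measure_pmf.expectation ?M Z =
      ?n * measure_pmf.expectation ?M (\<lambda>X. \<Sum>v\<in>V. (R X v)\<^sup>2) - 2 * (\<Sum>ys\<in>?P. measure_pmf.expectation ?M (\<lambda>X. ?w X ys)) + 1"
  proof -
    have int: "integrable ?M f" for f :: "('a \<times> 'a) set \<Rightarrow> real"
      by (rule integrable_random_subset[OF finA])
    show ?thesis unfolding Z_def
      by (subst Bochner_Integration.integral_add, (rule int)+, subst Bochner_Integration.integral_diff, (rule int)+,
          subst (2) integral_mult_right_zero, subst Bochner_Integration.integral_sum, rule int) simp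
  qed
  also have "\<dots> \<le> ?n * ?B - 2 * (q0 * (card V - t) / (card V - 1)) ^ t + 1"
  proof -
    have "measure_pmf.expectation ?M (\<lambda>X. \<Sum>v\<in>V. (R X v)\<^sup>2) \<le> ?B"
      unfolding R_def by (rule expectation_square_simple_path_sum_le) (use assms in auto)
    hence 1: "?n * measure_pmf.expectation ?M (\<lambda>X. \<Sum>v\<in>V. (R X v)\<^sup>2) \<le> ?n * ?B"
      by (rule mult_left_mono) simp
    have "(q0 * real (card V - t) / real (card V - 1)) ^ t = real (card V - t) ^ t * (q0 / real (card V - 1)) ^ t"
      by (simp add: power_mult_distrib power_divide)
    also have "\<dots> \<le> card ?P * (q0 / real (card V - 1)) ^ t"
      using card_simple_paths(1)[OF assms(1,3,5)] assms(7)
      by (intro mult_right_mono) (auto simp flip: of_nat_power)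
    also have "\<dots> \<le> (\<Sum>ys\<in>?P. measure_pmf.expectation ?M (\<lambda>X. ?w X ys))"
      unfolding sum_constant[symmetric] using assms
      by (intro sum_mono expectation_path_weight_ge) auto
    finally show ?thesis using 1 by linarith
  qed
  finally show ?thesis using assms(6) by (simp add: divide_right_mono)
qed

section \<open>Deleting the arcs at one vertex\<close>

abbreviation rw :: "('a \<times> 'a) set \<Rightarrow> 'a \<Rightarrow> 'a \<Rightarrow> real" where
  "rw \<equiv> walk_kernel 0"

lemma rw_def': "rw X a b = (if (a, b) \<in> X then 1 / card (X `` {a}) else 0)"
  by (simp add: walk_kernel_def)

lemma rw_le:
  fixes D :: real
  assumes "0 < D" "D \<le> card (X `` {a})"
  shows "rw X a b \<le> 1 / D"
  using assms by (auto simp: rw_def' intro!: divide_left_mono)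

lemma finite_Image_arc_pairs: "finite V \<Longrightarrow> X \<subseteq> arc_pairs V \<Longrightarrow> finite (X `` A)"
  by (rule finite_subset[of _ V]) (auto simp: arc_pairs_def)

lemma stochastic_rw:
  assumes "finite V" "X \<subseteq> arc_pairs V" "\<And>a. a \<in> V \<Longrightarrow> card (X `` {a}) > 0"
  shows "stochastic V (rw X)"
  unfolding stochastic_def
proof (intro conjI ballI walk_kernel_nonneg)
  fix a assume a: "a \<in> V"
  have "(\<Sum>b\<in>V. rw X a b) = (\<Sum>b\<in>X `` {a}. 1 / card (X `` {a}))"
    by (rule sum.mono_neutral_cong_right) (use assms in \<open>auto simp: arc_pairs_def rw_def'\<close>)
  also have "\<dots> = 1" using assms(3)[OF a] by simp
  finally show "(\<Sum>b\<in>V. rw X a b) = 1" .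
qed

lemma deficit_le_1:
  assumes "finite V" "\<And>v. v \<in> V \<Longrightarrow> 0 \<le> \<mu> v"
  shows "deficit V \<mu> \<le> 1"
proof -
  have "deficit V \<mu> \<le> (\<Sum>v\<in>V. 1 / card V)"
    unfolding deficit_def using assms by (intro sum_mono) auto
  also have "\<dots> \<le> 1" by simp
  finally show ?thesis .
qed

text \<open>Killing the walk at \<open>x\<close> makes this set independent of the arcs leaving \<open>x\<close>.\<close>

definition row_bad :: "'a set \<Rightarrow> nat \<Rightarrow> real \<Rightarrow> 'a \<Rightarrow> ('a \<times> 'a) set \<Rightarrow> 'a set" where
  "row_bad V t \<epsilon> x X = {y \<in> V - {x}.
     2 * \<epsilon> < deficit V ((act V (\<lambda>a b. rw (X - {x} \<times> UNIV) a b * of_bool (b \<noteq> x)) ^^ t) (dirac y))}"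

lemma row_bad_Diff: "row_bad V t \<epsilon> x (X - {x} \<times> UNIV) = row_bad V t \<epsilon> x X"
  by (simp add: row_bad_def Diff_idemp)

lemma rw_delete_row: "rw (X - {x} \<times> UNIV) a b = (if a = x then 0 else rw X a b)"
proof -
  have "a \<noteq> x \<Longrightarrow> (X - {x} \<times> UNIV) `` {a} = X `` {a}" by auto
  thus ?thesis by (auto simp: rw_def')
qed

text \<open>The walk moves to \<open>x\<close> with probability at most \<open>1 / D\<close> per
  step, so killing it there costs at most \<open>t / D \<le> \<epsilon>\<close>. This is why the
  killed walk is tested against \<open>2 * \<epsilon>\<close>: bad vertices can then be counted
  using the unkilled walk.\<close>

lemma row_bad_subset:
  fixes D :: real
  assumes "finite V" "X \<subseteq> arc_pairs V" "\<And>a. a \<in> V \<Longrightarrow> D \<le> card (X `` {a})" "1 \<le> D" "t / D \<le> \<epsilon>"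
  shows "row_bad V t \<epsilon> x X \<subseteq> {y \<in> V. \<epsilon> < deficit V ((act V (rw X) ^^ t) (dirac y))}"
proof
  fix y assume "y \<in> row_bad V t \<epsilon> x X"
  hence y: "y \<in> V - {x}" and bad: "2 * \<epsilon> < deficit V ((act V (\<lambda>a b. rw (X - {x} \<times> UNIV) a b * of_bool (b \<noteq> x)) ^^ t) (dirac y))"
    by (auto simp: row_bad_def)
  have stoch: "stochastic V (rw X)"
  proof (intro stochastic_rw assms)
    fix a assume "a \<in> V"
    thus "0 < card (X `` {a})" using assms(3)[of a] assms(4) by linarith
  qed
  have "deficit V ((act V (\<lambda>a b. rw (X - {x} \<times> UNIV) a b * of_bool (b \<noteq> x)) ^^ t) (dirac y)) \<le>
      deficit V ((act V (rw X) ^^ t) (dirac y)) + t * (1 / D)"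
  proof (rule deficit_killed[of V "V - {x}"])
    fix a assume a: "a \<in> V - {x}"
    have "(\<Sum>b\<in>V. rw (X - {x} \<times> UNIV) a b * of_bool (b \<noteq> x)) = (\<Sum>b\<in>V. rw X a b - (if b = x then rw X a x else 0))"
      using a by (intro sum.cong) (auto simp: rw_delete_row)
    also have "\<dots> = (\<Sum>b\<in>V. rw X a b) - (if x \<in> V then rw X a x else 0)"
      using assms(1) by (simp add: sum_subtractf)
    also have "\<dots> \<ge> 1 - 1 / D"
      using stoch a assms rw_le[of D X a x] by (auto simp: stochastic_def)
    finally show "1 - 1 / D \<le> (\<Sum>b\<in>V. rw (X - {x} \<times> UNIV) a b * of_bool (b \<noteq> x))" .
  qed (use assms stoch y in \<open>auto simp: rw_delete_row walk_kernel_nonneg\<close>)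
  thus "y \<in> {y \<in> V. \<epsilon> < deficit V ((act V (rw X) ^^ t) (dirac y))}"
    using y bad assms(5) by auto
qed

text \<open>Decompose according to the first step from \<open>x\<close>. At an out-neighbour outside
  the bad set the walk dominates the killed walk, so its deficit is at most
  \<open>2 * \<epsilon>\<close>; each of the others is charged the trivial deficit 1 with weight at
  most \<open>1 / D\<close>.\<close>

lemma deficit_step_le:
  fixes D \<eta> :: real
  assumes "finite V" "X \<subseteq> arc_pairs V" "\<And>a. a \<in> V \<Longrightarrow> D \<le> card (X `` {a})" "1 \<le> D" "x \<in> V"
    and "card (row_bad V t \<epsilon> x X \<inter> X `` {x}) \<le> \<eta> * D" "0 \<le> \<epsilon>" "0 \<le> \<eta>"
  shows "deficit V ((act V (rw X) ^^ Suc t) (dirac x)) \<le> 2 * \<epsilon> + \<eta>"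
proof -
  let ?N = "X `` {x}" and ?W = "row_bad V t \<epsilon> x X"
  have pos: "card (X `` {a}) > 0" if "a \<in> V" for a using assms(3)[OF that] assms(4) by linarith
  have stoch: "stochastic V (rw X)" by (intro stochastic_rw assms pos)
  have N: "finite ?N" "?N \<subseteq> V - {x}" using assms(1,2) by (auto simp: arc_pairs_def finite_Image_arc_pairs)
  have nn: "0 \<le> (act V (rw X) ^^ t) (dirac y) v" if "v \<in> V" for y v
    using that by (intro funpow_act_nonneg) (auto simp: walk_kernel_nonneg dirac_nonneg)
  have "(act V (rw X) ^^ Suc t) (dirac x) v = (\<Sum>y\<in>V. rw X x y * (act V (rw X) ^^ t) (dirac y) v)" if "v \<in> V" for v
  proof -
    have "(act V (rw X) ^^ Suc t) (dirac x) v = (act V (rw X) ^^ t) (rw X x) v"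
      by (simp add: funpow_Suc_right act_dirac assms(1,5) del: funpow.simps)
    thus ?thesis by (simp only: funpow_act_eq_sum_dirac[OF assms(1) that, of _ _ "rw X x"])
  qed
  hence "deficit V ((act V (rw X) ^^ Suc t) (dirac x)) \<le> deficit V (\<lambda>v. \<Sum>y\<in>V. rw X x y * (act V (rw X) ^^ t) (dirac y) v)"
    by (intro deficit_mono) simp
  also have "\<dots> \<le> (\<Sum>y\<in>V. rw X x y * deficit V ((act V (rw X) ^^ t) (dirac y)))"
    using stoch assms(5) by (intro deficit_convex assms walk_kernel_nonneg) (auto simp: stochastic_def)
  also have "\<dots> \<le> (\<Sum>y\<in>V. rw X x y * (2 * \<epsilon> + of_bool (y \<in> ?W \<inter> ?N)))"
  proof (rule sum_mono)
    fix y assume y: "y \<in> V"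
    show "rw X x y * deficit V ((act V (rw X) ^^ t) (dirac y)) \<le> rw X x y * (2 * \<epsilon> + of_bool (y \<in> ?W \<inter> ?N))"
    proof (cases "y \<in> ?N")
      case True
      have "deficit V ((act V (rw X) ^^ t) (dirac y)) \<le> 2 * \<epsilon> + of_bool (y \<in> ?W \<inter> ?N)"
      proof (cases "y \<in> ?W")
        case W: True
        thus ?thesis
          using True assms(7) deficit_le_1[OF assms(1), of "(act V (rw X) ^^ t) (dirac y)"] nn by fastforce
      next
        case False
        have "deficit V ((act V (rw X) ^^ t) (dirac y)) \<le>
          deficit V ((act V (\<lambda>a b. rw (X - {x} \<times> UNIV) a b * of_bool (b \<noteq> x)) ^^ t) (dirac y))"
          by (intro deficit_mono funpow_act_mono) (auto simp: rw_delete_row walk_kernel_nonneg dirac_nonneg)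
        also have "\<dots> \<le> 2 * \<epsilon>" using False True N y by (auto simp: row_bad_def)
        finally show ?thesis by simp
      qed
      thus ?thesis by (intro mult_left_mono walk_kernel_nonneg)
    qed (simp add: rw_def')
  qed
  also have "\<dots> = 2 * \<epsilon> * (\<Sum>y\<in>V. rw X x y) + (\<Sum>y\<in>V. rw X x y * of_bool (y \<in> ?W \<inter> ?N))"
    by (simp add: algebra_simps sum.distrib sum_distrib_left)
  also have "(\<Sum>y\<in>V. rw X x y) = 1" using stoch assms(5) by (auto simp: stochastic_def)
  also have "(\<Sum>y\<in>V. rw X x y * of_bool (y \<in> ?W \<inter> ?N)) \<le> (\<Sum>y\<in>V. 1 / D * of_bool (y \<in> ?W \<inter> ?N))"
    using assms by (intro sum_mono mult_right_mono rw_le) auto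
  also have "\<dots> = 1 / D * card (?W \<inter> ?N)"
  proof -
    have "V \<inter> {y. y \<in> ?W \<inter> ?N} = ?W \<inter> ?N" using N by auto
    thus ?thesis using assms(1) by (simp only: sum_distrib_left[symmetric]) simp
  qed
  also have "\<dots> \<le> 1 / D * (\<eta> * D)" using assms by (intro mult_left_mono) auto
  also have "\<dots> = \<eta>" using assms by simp
  finally show ?thesis by simp
qed

text \<open>A stand-in for the stationary distribution after the arcs into \<open>v\<close> have
  been deleted. A fixed number of steps from the uniform distribution makes it well defined for
  every arc set and manifestly a function of the remaining arcs.\<close>

definition col_measure :: "'a set \<Rightarrow> nat \<Rightarrow> 'a \<Rightarrow> ('a \<times> 'a) set \<Rightarrow> 'a \<Rightarrow> real" where
  "col_measure V k v X = (act V (rw (X - UNIV \<times> {v})) ^^ k) (\<lambda>_. 1 / card V)"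

text \<open>In the stationarity equation at \<open>v\<close>, an in-neighbour \<open>w\<close>
  contributes its mass divided by its out-degree, ideally \<open>1 / (card V * s)\<close>. The set
  collects the vertices for which mass or out-degree is off; it reads no arc into \<open>v\<close>,
  so it is independent of the in-neighbourhood of \<open>v\<close>.\<close>

definition col_bad :: "'a set \<Rightarrow> nat \<Rightarrow> real \<Rightarrow> real \<Rightarrow> 'a \<Rightarrow> ('a \<times> 'a) set \<Rightarrow> 'a set" where
  "col_bad V k \<eta> s v X = {w \<in> V - {v}. \<eta> / card V < \<bar>col_measure V k v X w - 1 / card V\<bar> \<or>
     \<eta> * s < \<bar>real (card ((X - UNIV \<times> {v}) `` {w})) - s\<bar>}"

lemma col_bad_Diff: "col_bad V k \<eta> s v (X - UNIV \<times> {v}) = col_bad V k \<eta> s v X"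
  by (simp add: col_bad_def col_measure_def Diff_idemp)

text \<open>Deleting the arcs into \<open>v\<close> changes the walk only when it is about to move to \<open>v\<close>, which
  happens with probability at most \<open>1 / D\<close> in each step.\<close>

locale delete_in_arcs =
  fixes V :: "'a set" and X :: "('a \<times> 'a) set" and D :: real and v :: 'a and T :: nat and \<kappa> :: real
  assumes fin: "finite V" and X: "X \<subseteq> arc_pairs V" and D: "2 \<le> D" and v: "v \<in> V"
    and deg: "\<And>a. a \<in> V \<Longrightarrow> D \<le> card (X `` {a})"
    and mixing: "\<And>y. y \<in> V \<Longrightarrow> deficit V ((act V (rw X) ^^ T) (dirac y)) \<le> \<kappa>"
    and \<kappa>: "\<kappa> + T / D \<le> 1 / 4" and T: "0 < T"
begin

abbreviation "X' \<equiv> X - UNIV \<times> {v}"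

abbreviation "n \<equiv> real (card V)"

lemma n_pos: "n > 0" using fin v by (auto simp: card_gt_0_iff)

lemma card_X': "card (X' `` {a}) = card (X `` {a}) - of_bool ((a, v) \<in> X)"
proof -
  have "X' `` {a} = X `` {a} - {v}" by auto
  thus ?thesis using finite_Image_arc_pairs[OF fin X, of "{a}"] by auto
qed

lemma deg': "a \<in> V \<Longrightarrow> D - 1 \<le> card (X' `` {a})"
  using deg[of a] D by (auto simp: card_X' of_nat_diff)

lemma stoch: "stochastic V (rw X)"
proof (intro stochastic_rw fin X)
  fix a assume "a \<in> V"
  thus "0 < card (X `` {a})" using deg[of a] D by linarith
qed

lemma stoch': "stochastic V (rw X')"
proof (intro stochastic_rw fin)
  fix a assume "a \<in> V"
  thus "0 < card (X' `` {a})" using deg'[of a] D by linarith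
qed (use X in auto)

lemma rw_le_rw':
  assumes "a \<in> V" "b \<noteq> v"
  shows "rw X a b \<le> rw X' a b"
  using assms D deg[OF assms(1)] deg'[OF assms(1)] by (auto simp: rw_def' card_X' intro!: divide_left_mono)

text \<open>The difference \<open>1 / (d - 1) - 1 / d\<close> equals
  \<open>1 / d * (1 / (d - 1))\<close>, where \<open>1 / d\<close> is the probability of moving from
  \<open>a\<close> to \<open>v\<close>. Keeping that factor lets the sum against a stationary vector
  collapse to its value at \<open>v\<close>.\<close>

lemma rw'_minus_rw_le:
  assumes "a \<in> V" "b \<noteq> v"
  shows "rw X' a b - rw X a b \<le> rw X a v * (1 / (D - 1))"
proof (cases "(a, v) \<in> X \<and> (a, b) \<in> X")
  case True
  define d where "d = real (card (X `` {a}))"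
  have d: "D \<le> d" using deg[OF assms(1)] by (simp add: d_def)
  have "rw X' a b - rw X a b = 1 / (d - 1) - 1 / d"
    using True assms d D by (auto simp: rw_def' card_X' d_def of_nat_diff)
  also have "\<dots> = 1 / d * (1 / (d - 1))" using d D by (simp add: field_simps)
  also have "\<dots> \<le> 1 / d * (1 / (D - 1))"
    using d D by (intro mult_left_mono divide_left_mono) auto
  finally show ?thesis using True by (simp add: rw_def' d_def)
next
  case False
  hence "rw X' a b - rw X a b = 0" using assms by (auto simp: rw_def' card_X')
  thus ?thesis using D by (simp add: walk_kernel_nonneg)
qed

text \<open>Both walks are compared with the walk on \<open>X\<close> killed on entering
  \<open>v\<close>. It lies below the walk on \<open>X'\<close>, where the surviving arcs only gain
  weight, and it loses at most \<open>1 / D\<close> per step.\<close>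

lemma mixing':
  assumes y: "y \<in> V"
  shows "deficit V ((act V (rw X') ^^ T) (dirac y)) \<le> \<kappa> + T / D"
proof -
  let ?Q = "\<lambda>a b. rw X a b * of_bool (b \<noteq> v)"
  have "deficit V ((act V (rw X') ^^ T) (dirac y)) \<le> deficit V ((act V ?Q ^^ T) (dirac y))"
    using rw_le_rw' by (intro deficit_mono funpow_act_mono) (auto simp: walk_kernel_nonneg dirac_nonneg)
  also have "\<dots> \<le> deficit V ((act V (rw X) ^^ T) (dirac y)) + T * (1 / D)"
  proof (rule deficit_killed[of V V])
    fix a assume a: "a \<in> V"
    have "(\<Sum>b\<in>V. rw X a b * of_bool (b \<noteq> v)) = (\<Sum>b\<in>V. rw X a b - (if b = v then rw X a v else 0))"
      by (intro sum.cong) auto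
    also have "\<dots> = (\<Sum>b\<in>V. rw X a b) - rw X a v"
      using fin v by (simp add: sum_subtractf)
    also have "\<dots> \<ge> 1 - 1 / D"
      using stoch a D deg rw_le[of D X a v] by (auto simp: stochastic_def)
    finally show "1 - 1 / D \<le> (\<Sum>b\<in>V. rw X a b * of_bool (b \<noteq> v))" .
  qed (use D stoch y fin in \<open>auto simp: walk_kernel_nonneg\<close>)
  also have "\<dots> \<le> \<kappa> + T / D" using mixing[OF y] by simp
  finally show ?thesis .
qed

lemma contraction:
  assumes "sum f V = 0"
  shows "(\<Sum>w\<in>V. \<bar>(act V (rw X') ^^ (j * T + r)) f w\<bar>) \<le> (1 / 2) ^ j * (\<Sum>w\<in>V. \<bar>f w\<bar>)"
proof -
  have "(\<Sum>w\<in>V. \<bar>(act V (rw X') ^^ (j * T + r)) f w\<bar>) \<le> (2 * (1 / 4)) ^ j * (\<Sum>w\<in>V. \<bar>f w\<bar>)"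
    using fin v stoch' assms order.trans[OF mixing' \<kappa>] by (intro sum_abs_funpow_act_contraction_mult) auto
  thus ?thesis by simp
qed

text \<open>The last \<open>T\<close> steps alone do the mixing: whatever distribution they start
  from, the deficit of a mixture is at most the mixture of the deficits.\<close>

lemma sum_abs_col_measure_le:
  assumes "0 < J"
  shows "(\<Sum>w\<in>V. \<bar>col_measure V (J * T) v X w - 1 / n\<bar>) \<le> 2 * (\<kappa> + T / D)"
proof -
  define \<mu> where "\<mu> = (act V (rw X') ^^ ((J - 1) * T)) (\<lambda>_. 1 / n)"
  have sum\<mu>: "sum \<mu> V = 1" using n_pos by (simp add: \<mu>_def sum_funpow_act[OF stoch'])
  have nn: "0 \<le> \<mu> w" if "w \<in> V" for w
    unfolding \<mu>_def using that by (intro funpow_act_nonneg walk_kernel_nonneg) auto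
  have "J * T = T + (J - 1) * T" using assms by (cases J) auto
  hence eq: "col_measure V (J * T) v X = (act V (rw X') ^^ T) \<mu>"
    by (simp add: col_measure_def \<mu>_def funpow_add)
  have "deficit V (col_measure V (J * T) v X) \<le> deficit V (\<lambda>w. \<Sum>x\<in>V. \<mu> x * (act V (rw X') ^^ T) (dirac x) w)"
    unfolding eq by (intro deficit_mono) (simp only: funpow_act_eq_sum_dirac[OF fin, of _ _ _ \<mu>])
  also have "\<dots> \<le> (\<Sum>x\<in>V. \<mu> x * deficit V ((act V (rw X') ^^ T) (dirac x)))"
    by (intro deficit_convex fin nn sum\<mu>)
  also have "\<dots> \<le> (\<Sum>x\<in>V. \<mu> x * (\<kappa> + T / D))"
    by (intro sum_mono mult_left_mono mixing' nn)
  also have "\<dots> = \<kappa> + T / D" by (simp only: sum_distrib_right[symmetric] sum\<mu>) simp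
  finally have "deficit V (col_measure V (J * T) v X) \<le> \<kappa> + T / D" .
  moreover have "(\<Sum>w\<in>V. \<bar>col_measure V (J * T) v X w - 1 / n\<bar>) = 2 * deficit V (col_measure V (J * T) v X)"
    using fin v sum\<mu> by (intro sum_abs_eq_deficit) (auto simp: eq sum_funpow_act[OF stoch'])
  ultimately show ?thesis by simp
qed

text \<open>The first summand is Markov's inequality for the l1 distance of
  \<open>col_measure\<close> from uniform. In the second, the \<open>- 1\<close> accounts for the
  possibly deleted arc from \<open>w\<close> to \<open>v\<close>.\<close>

lemma card_col_bad_le:
  assumes "0 < J" "0 < \<eta>" 
  shows "card (col_bad V (J * T) \<eta> s v X) \<le> 2 * (\<kappa> + T / D) * n / \<eta> +
    card {w \<in> V. \<eta> * s - 1 < \<bar>real (card (X `` {w})) - s\<bar>}"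
proof -
  let ?A = "{w \<in> V. \<eta> / n < \<bar>col_measure V (J * T) v X w - 1 / n\<bar>}"
  let ?B = "{w \<in> V. \<eta> * s - 1 < \<bar>real (card (X `` {w})) - s\<bar>}"
  have "card ?A * (\<eta> / n) = (\<Sum>w\<in>?A. \<eta> / n)" by simp
  also have "\<dots> \<le> (\<Sum>w\<in>?A. \<bar>col_measure V (J * T) v X w - 1 / n\<bar>)"
    by (intro sum_mono) auto
  also have "\<dots> \<le> (\<Sum>w\<in>V. \<bar>col_measure V (J * T) v X w - 1 / n\<bar>)"
    using fin by (intro sum_mono2) auto
  also have "\<dots> \<le> 2 * (\<kappa> + T / D)" by (rule sum_abs_col_measure_le[OF assms(1)])
  finally have A: "card ?A \<le> 2 * (\<kappa> + T / D) * n / \<eta>"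
    using assms(2) n_pos by (simp add: field_simps)
  have "col_bad V (J * T) \<eta> s v X \<subseteq> ?A \<union> ?B"
  proof
    fix w assume w: "w \<in> col_bad V (J * T) \<eta> s v X"
    have "\<bar>real (card (X' `` {w})) - real (card (X `` {w}))\<bar> \<le> 1"
      unfolding card_X' by (cases "card (X `` {w})") auto
    thus "w \<in> ?A \<union> ?B" using w by (auto simp: col_bad_def)
  qed
  hence "card (col_bad V (J * T) \<eta> s v X) \<le> card ?A + card ?B"
    using fin by (intro order.trans[OF card_mono card_Un_le]) auto
  with A show ?thesis by linarith
qed

text \<open>The summand is constant on blocks of \<open>T\<close> indices, and the block values form
  a geometric series, so the bound does not depend on \<open>J\<close>.\<close>

lemma sum_power_half_div: "(\<Sum>i<J * T. (1 / 2 :: real) ^ (i div T)) \<le> 2 * T"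
proof -
  have "(\<Sum>i<J * T. (1 / 2 :: real) ^ (i div T)) = T * (\<Sum>j<J. (1 / 2) ^ j)"
  proof (induction J)
    case (Suc J)
    have "(\<Sum>i<Suc J * T. (1 / 2 :: real) ^ (i div T)) =
        (\<Sum>i<J * T. (1 / 2) ^ (i div T)) + (\<Sum>i=J * T..<J * T + T. (1 / 2) ^ (i div T))"
      by (simp add: add.commute[of T] lessThan_atLeast0 sum.atLeastLessThan_concat)
    also have "(\<Sum>i=J * T..<J * T + T. (1 / 2 :: real) ^ (i div T)) = (\<Sum>i=J * T..<J * T + T. (1 / 2) ^ J)"
    proof (intro sum.cong refl)
      fix i assume "i \<in> {J * T..<J * T + T}"
      hence "i div T = J" by (intro div_nat_eqI) (auto simp: algebra_simps)
      thus "(1 / 2 :: real) ^ (i div T) = (1 / 2) ^ J" by simp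
    qed
    finally show ?case using Suc.IH by (simp add: algebra_simps)
  qed simp
  also have "\<dots> \<le> real T * 2"
  proof (rule mult_left_mono)
    show "(\<Sum>j<J. (1 / 2 :: real) ^ j) \<le> 2"
    using sum_le_suminf[of "\<lambda>j. (1 / 2 :: real) ^ j" "{..<J}"] suminf_geometric[of "1 / 2 :: real"]
    by (simp add: summable_geometric)
  qed simp
  finally show ?thesis by simp
qed

text \<open>The defect \<open>h = \<pi> - ?A \<pi>\<close> has total mass 0 and is positive at most
  at \<open>v\<close>, so its l1 norm is twice \<pi> at \<open>v\<close>. Telescoping writes
  \<open>\<pi> - (?A ^^ k) \<pi>\<close> as a sum of images of \<open>h\<close>, whose norms decay
  by half every \<open>T\<close> steps. The factor \<open>1 / (D - 1)\<close>, the largest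
  probability of stepping to \<open>w\<close>, turns these norm bounds into a pointwise one. What
  remains is the difference of two start distributions after \<open>J * T\<close> steps.\<close>

lemma stationary_minus_col_measure_le:
  assumes \<pi>: "\<And>w. w \<in> V \<Longrightarrow> 0 \<le> \<pi> w" "sum \<pi> V = 1" "\<And>w. w \<in> V \<Longrightarrow> act V (rw X) \<pi> w = \<pi> w"
    and w: "w \<in> V" "w \<noteq> v"
  shows "\<bar>\<pi> w - col_measure V (J * T) v X w\<bar> \<le> 2 * (1 / 2) ^ J + 5 * T / (D - 1) * \<pi> v"
proof -
  let ?A = "act V (rw X')"
  define h where "h = (\<lambda>w. \<pi> w - ?A \<pi> w)"
  have sumh: "sum h V = 0"
    using sum_funpow_act[OF stoch', of 1 \<pi>] by (simp add: h_def sum_subtractf)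
  have "?A \<pi> v = 0" by (simp add: act_def rw_def')
  hence hv: "h v = \<pi> v" by (simp add: h_def)
  have h_le: "h b \<le> 0" if "b \<in> V" "b \<noteq> v" for b
  proof -
    have "\<pi> b = act V (rw X) \<pi> b" using \<pi>(3) that by simp
    also have "\<dots> \<le> ?A \<pi> b"
      unfolding act_def using \<pi>(1) that by (intro sum_mono mult_left_mono rw_le_rw')
    finally show ?thesis by (simp add: h_def)
  qed
  have abs_h: "(\<Sum>b\<in>V. \<bar>h b\<bar>) = 2 * \<pi> v"
  proof -
    have "(\<Sum>b\<in>V - {v}. \<bar>h b\<bar>) = (\<Sum>b\<in>V - {v}. - h b)"
      using h_le by (intro sum.cong) auto
    hence "(\<Sum>b\<in>V. \<bar>h b\<bar>) = \<bar>h v\<bar> - (\<Sum>b\<in>V - {v}. h b)"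
      using fin v by (simp add: sum.remove sum_negf)
    also have "(\<Sum>b\<in>V - {v}. h b) = - h v"
      using sumh fin v by (simp add: sum.remove)
    finally show ?thesis using hv \<pi>(1)[OF v] by simp
  qed
  \<comment> \<open>The term with no application of \<open>?A\<close> has no last step into
    \<open>w\<close> to gain from, so it needs its own estimate.\<close>
  have abs_hw: "\<bar>h w\<bar> \<le> \<pi> v / (D - 1)"
  proof -
    have "\<bar>h w\<bar> = ?A \<pi> w - act V (rw X) \<pi> w"
      using h_le[OF w] \<pi>(3)[OF w(1)] by (simp add: h_def)
    also have "\<dots> = (\<Sum>a\<in>V. \<pi> a * (rw X' a w - rw X a w))"
      by (simp add: act_def sum_subtractf right_diff_distrib)
    also have "\<dots> \<le> (\<Sum>a\<in>V. \<pi> a * (rw X a v * (1 / (D - 1))))"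
      using \<pi>(1) w by (intro sum_mono mult_left_mono rw'_minus_rw_le)
    also have "\<dots> = act V (rw X) \<pi> v * (1 / (D - 1))"
      by (simp only: act_def sum_distrib_right mult.assoc)
    finally show ?thesis using \<pi>(3)[OF v] by simp
  qed
  have abs_step: "\<bar>(?A ^^ Suc i) h w\<bar> \<le> 1 / (D - 1) * ((1 / 2) ^ (i div T) * (2 * \<pi> v))" for i
  proof -
    have "\<bar>(?A ^^ Suc i) h w\<bar> \<le> (\<Sum>a\<in>V. \<bar>(?A ^^ i) h a\<bar> * (1 / (D - 1)))"
      unfolding funpow_Suc_act
    proof (rule order.trans[OF sum_abs], rule sum_mono)
      fix a assume a: "a \<in> V"
      have "rw X' a w \<le> 1 / (D - 1)" using D deg'[OF a] by (intro rw_le) auto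
      thus "\<bar>(?A ^^ i) h a * rw X' a w\<bar> \<le> \<bar>(?A ^^ i) h a\<bar> * (1 / (D - 1))"
        unfolding abs_mult by (intro mult_left_mono) (simp_all only: abs_of_nonneg walk_kernel_nonneg abs_ge_zero)
    qed
    also have "\<dots> = 1 / (D - 1) * (\<Sum>a\<in>V. \<bar>(?A ^^ (i div T * T + i mod T)) h a\<bar>)"
      by (simp add: sum_distrib_left mult.commute)
    also have "\<dots> \<le> 1 / (D - 1) * ((1 / 2) ^ (i div T) * (\<Sum>a\<in>V. \<bar>h a\<bar>))"
      using D by (intro mult_left_mono contraction sumh) auto
    finally show ?thesis by (simp only: abs_h)
  qed
  have telescope: "\<pi> w - (?A ^^ k) \<pi> w = (\<Sum>i<k. (?A ^^ i) h w)" for k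
  proof (induction k)
    case (Suc k)
    have "(?A ^^ k) h w = (?A ^^ k) \<pi> w - (?A ^^ k) (?A \<pi>) w"
      by (simp add: h_def funpow_act_diff)
    also have "(?A ^^ k) (?A \<pi>) = (?A ^^ Suc k) \<pi>"
      by (simp add: funpow_swap1)
    finally show ?case using Suc.IH by (simp del: funpow.simps)
  qed simp
  have sum_le: "(\<Sum>i<J * T. \<bar>(?A ^^ i) h w\<bar>) \<le> 5 * T / (D - 1) * \<pi> v"
  proof -
    have "(\<Sum>i<J * T. \<bar>(?A ^^ i) h w\<bar>) \<le> (\<Sum>i<Suc (J * T). \<bar>(?A ^^ i) h w\<bar>)"
      by simp
    also have "\<dots> = \<bar>h w\<bar> + (\<Sum>i<J * T. \<bar>(?A ^^ Suc i) h w\<bar>)"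
      by (subst sum.lessThan_Suc_shift) simp
    also have "\<dots> \<le> \<pi> v / (D - 1) + (\<Sum>i<J * T. 1 / (D - 1) * ((1 / 2) ^ (i div T) * (2 * \<pi> v)))"
      by (intro add_mono abs_hw sum_mono abs_step)
    also have "(\<Sum>i<J * T. 1 / (D - 1) * ((1 / 2) ^ (i div T) * (2 * \<pi> v))) =
        (2 * \<pi> v / (D - 1)) * (\<Sum>i<J * T. (1 / 2) ^ (i div T))"
      by (simp add: sum_distrib_left mult_ac)
    also have "\<dots> \<le> (2 * \<pi> v / (D - 1)) * (2 * T)"
      using D \<pi>(1)[OF v] by (intro mult_left_mono sum_power_half_div) auto
    also have "\<pi> v / (D - 1) + \<dots> = (1 + 4 * T) * (\<pi> v / (D - 1))"
      by (simp add: algebra_simps add_divide_distrib)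
    \<comment> \<open>The 1 comes from the term without a step, and \<open>4 * T\<close> is twice
      the block sum; \<open>T \<ge> 1\<close> gives 5.\<close>
    also have "\<dots> \<le> (5 * T) * (\<pi> v / (D - 1))"
      using T D \<pi>(1)[OF v] by (intro mult_right_mono) auto
    finally show ?thesis by simp
  qed
  have init: "\<bar>(?A ^^ (J * T + 0)) (\<lambda>w. \<pi> w - 1 / n) w\<bar> \<le> 2 * (1 / 2) ^ J"
  proof -
    have "\<bar>(?A ^^ (J * T + 0)) (\<lambda>w. \<pi> w - 1 / n) w\<bar> \<le> (\<Sum>w\<in>V. \<bar>(?A ^^ (J * T + 0)) (\<lambda>w. \<pi> w - 1 / n) w\<bar>)"
      by (rule member_le_sum[OF w(1) _ fin]) simp
    also have "\<dots> \<le> (1 / 2) ^ J * (\<Sum>w\<in>V. \<bar>\<pi> w - 1 / n\<bar>)"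
      using n_pos \<pi>(2) by (intro contraction) (simp add: sum_subtractf)
    also have "(\<Sum>w\<in>V. \<bar>\<pi> w - 1 / n\<bar>) \<le> (\<Sum>w\<in>V. \<pi> w + 1 / n)"
    proof (rule sum_mono)
      fix w assume "w \<in> V"
      thus "\<bar>\<pi> w - 1 / n\<bar> \<le> \<pi> w + 1 / n"
        using \<pi>(1)[of w] n_pos by (intro order.trans[OF abs_triangle_ineq4]) auto
    qed
    also have "\<dots> = 2" using n_pos \<pi>(2) by (simp add: sum.distrib)
    finally show ?thesis by (simp add: mult.commute)
  qed
  define x where "x = (\<Sum>i<J * T. (?A ^^ i) h w)"
  define y where "y = (?A ^^ (J * T + 0)) (\<lambda>w. \<pi> w - 1 / n) w"
  have "\<pi> w - col_measure V (J * T) v X w = x + y"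
    unfolding x_def y_def telescope[symmetric] by (simp add: funpow_act_diff col_measure_def)
  moreover have "\<bar>x\<bar> \<le> 5 * T / (D - 1) * \<pi> v"
    unfolding x_def by (rule order.trans[OF _ sum_le]) (rule sum_abs)
  moreover have "\<bar>y\<bar> \<le> 2 * (1 / 2) ^ J" unfolding y_def by (rule init)
  ultimately show ?thesis using abs_triangle_ineq[of x y] by simp
qed

end

text \<open>Sum the stationarity equation over the in-neighbours of \<open>u\<close>. Good ones
  contribute almost \<open>1 / (n * s)\<close>; bad ones are few, but their mass is only known to be
  at most the maximum \<open>M\<close> of \<pi>. The same \<open>M\<close> enters through the
  perturbation estimate, so \<open>M\<close> must be bounded afterwards.\<close>

lemma stationary_asymptotic:
  fixes c C s \<eta> \<kappa> :: real and \<pi> :: "'a \<Rightarrow> real"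
  assumes fin: "finite V" and X: "X \<subseteq> arc_pairs V" and c: "0 < c" "2 \<le> c * s"
    and outdeg: "\<And>a. a \<in> V \<Longrightarrow> c * s \<le> card (X `` {a})"
    and indeg: "\<And>a. a \<in> V \<Longrightarrow> c * s \<le> card (X\<inverse> `` {a})" "\<And>a. a \<in> V \<Longrightarrow> card (X\<inverse> `` {a}) \<le> C * s"
    and mixing: "\<And>y. y \<in> V \<Longrightarrow> deficit V ((act V (rw X) ^^ T) (dirac y)) \<le> \<kappa>"
    and \<kappa>: "\<kappa> + T / (c * s) \<le> 1 / 4" and T: "0 < T"
    and \<eta>: "0 < \<eta>" "1 \<le> \<eta> * s" "5 * T / (c * s - 1) \<le> \<eta>" "2 * (1 / 2) ^ J \<le> \<eta> / card V"
    and K: "K = (4 * C + 1) / c + 1" "K * \<eta> \<le> 1 / 2"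
    and bad: "\<And>v. v \<in> V \<Longrightarrow> card (col_bad V (J * T) \<eta> s v X \<inter> X\<inverse> `` {v}) \<le> \<eta> * s"
    and \<pi>: "\<And>w. w \<in> V \<Longrightarrow> 0 \<le> \<pi> w" "sum \<pi> V = 1" "\<And>w. w \<in> V \<Longrightarrow> act V (rw X) \<pi> w = \<pi> w"
    and v: "v \<in> V"
  shows "\<bar>\<pi> v * (card V * s) / card (X\<inverse> `` {v}) - 1\<bar> \<le> K * \<eta> * (2 * C + 2) / c"
proof -
  define n where "n = real (card V)"
  define M where "M = Max (\<pi> ` V)"
  define dg where "dg u = real (card (X\<inverse> `` {u}))" for u
  have n: "n > 0" using fin v by (auto simp: n_def card_gt_0_iff)
  have s: "s > 0" using c by (metis less_le_trans zero_less_mult_pos zero_less_numeral)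
  have le_M: "\<pi> w \<le> M" if "w \<in> V" for w
    using fin that by (simp add: M_def)
  have M0: "0 \<le> M" using le_M[OF v] \<pi>(1)[OF v] by linarith
  have C: "0 < C"
  proof (rule ccontr)
    assume "\<not> 0 < C"
    hence "C * s \<le> 0" using s by (simp add: mult_nonpos_nonneg)
    thus False using indeg[OF v] c by linarith
  qed
  have main: "\<bar>\<pi> u - dg u / (n * s)\<bar> \<le> K * \<eta> * (1 / n + M)" if u: "u \<in> V" for u
  proof -
    interpret delete_in_arcs V X "c * s" u T \<kappa>
      by unfold_locales (use assms u in auto)
    let ?N = "X\<inverse> `` {u}" and ?B = "col_bad V (J * T) \<eta> s u X"
    define d where "d w = real (card (X `` {w}))" for w
    have N: "?N \<subseteq> V - {u}" "finite ?N"
      using X finite_subset[of ?N V] fin by (auto simp: arc_pairs_def)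
    have d: "c * s \<le> d w" if "w \<in> V" for w using outdeg[OF that] by (simp add: d_def)
    have "\<pi> u = (\<Sum>w\<in>V. \<pi> w * rw X w u)" using \<pi>(3)[OF u] by (simp add: act_def)
    also have "\<dots> = (\<Sum>w\<in>?N. \<pi> w / d w)"
      by (rule sum.mono_neutral_cong_right) (use fin N in \<open>auto simp: rw_def' d_def\<close>)
    finally have eq: "\<pi> u - dg u / (n * s) = (\<Sum>w\<in>?N. \<pi> w / d w - 1 / (n * s))"
      by (simp add: sum_subtractf dg_def)
    have "\<bar>\<pi> u - dg u / (n * s)\<bar> \<le> (\<Sum>w\<in>?N. (4 * \<eta> / n + \<eta> * M) / (c * s) + of_bool (w \<in> ?B) * (M / (c * s) + 1 / (n * s)))"
      unfolding eq
    proof (rule order.trans[OF sum_abs], rule sum_mono)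
      fix w assume w: "w \<in> ?N"
      hence wV: "w \<in> V" "w \<noteq> u" using N by auto
      have pos: "0 < d w" "0 < c * s" using d[OF wV(1)] c by linarith+
      show "\<bar>\<pi> w / d w - 1 / (n * s)\<bar> \<le> (4 * \<eta> / n + \<eta> * M) / (c * s) + of_bool (w \<in> ?B) * (M / (c * s) + 1 / (n * s))"
      proof (cases "w \<in> ?B")
        case True
        have "\<bar>\<pi> w / d w - 1 / (n * s)\<bar> \<le> \<pi> w / d w + 1 / (n * s)"
          using \<pi>(1)[OF wV(1)] pos n s by (intro order.trans[OF abs_triangle_ineq4]) auto
        also have "\<pi> w / d w \<le> M / (c * s)"
          using pos d[OF wV(1)] le_M[OF wV(1)] M0 by (intro frac_le)
        finally have "\<bar>\<pi> w / d w - 1 / (n * s)\<bar> \<le> M / (c * s) + 1 / (n * s)" by simp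
        moreover have "0 \<le> (4 * \<eta> / n + \<eta> * M) / (c * s)"
          using \<eta> n pos M0 by auto
        ultimately show ?thesis using True by simp
      next
        case False
        let ?\<sigma> = "col_measure V (J * T) u X w"
        have "\<bar>\<pi> w - ?\<sigma>\<bar> \<le> 2 * (1 / 2) ^ J + 5 * T / (c * s - 1) * \<pi> u"
          by (rule stationary_minus_col_measure_le[OF \<pi> wV])
        also have "\<dots> \<le> \<eta> / n + \<eta> * M"
          using \<eta> le_M[OF u] \<pi>(1)[OF u] by (intro add_mono mult_mono) (auto simp: n_def)
        finally have "\<bar>\<pi> w - ?\<sigma>\<bar> \<le> \<eta> / n + \<eta> * M" .
        moreover have "\<bar>?\<sigma> - 1 / n\<bar> \<le> \<eta> / n" "\<bar>real (card (X' `` {w})) - s\<bar> \<le> \<eta> * s"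
          using False wV by (auto simp: col_bad_def n_def)
        moreover have "\<bar>real (card (X' `` {w})) - d w\<bar> \<le> 1"
          unfolding card_X' d_def by (cases "card (X `` {w})") auto
        ultimately have 1: "\<bar>\<pi> w - 1 / n\<bar> \<le> 2 * (\<eta> / n) + \<eta> * M" and 2: "\<bar>s - d w\<bar> \<le> 2 * \<eta> * s"
          using \<eta>(2) by linarith+
        have split: "\<pi> w / d w - 1 / (n * s) = (\<pi> w - 1 / n) / d w + (s - d w) / (n * s * d w)"
          using pos n s by (simp add: field_simps)
        have "\<bar>\<pi> w / d w - 1 / (n * s)\<bar> \<le> \<bar>\<pi> w - 1 / n\<bar> / d w + \<bar>s - d w\<bar> / (n * s * d w)"
          unfolding split using pos n s abs_triangle_ineq[of "(\<pi> w - 1 / n) / d w" "(s - d w) / (n * s * d w)"]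
          by (simp add: abs_mult)
        also have "\<dots> \<le> (2 * (\<eta> / n) + \<eta> * M) / (c * s) + (2 * \<eta> * s) / (n * s * (c * s))"
          using 1 2 pos n s d[OF wV(1)] M0 \<eta>(1) by (intro add_mono frac_le mult_left_mono) auto
        also have "(2 * \<eta> * s) / (n * s * (c * s)) = 2 * (\<eta> / n) / (c * s)"
          using s by simp
        also have "(2 * (\<eta> / n) + \<eta> * M) / (c * s) + 2 * (\<eta> / n) / (c * s) = (4 * \<eta> / n + \<eta> * M) / (c * s)"
          by (subst add_divide_distrib[symmetric]) simp
        finally show ?thesis using False by simp
      qed
    qed
    also have "\<dots> = dg u * ((4 * \<eta> / n + \<eta> * M) / (c * s)) + card (?B \<inter> ?N) * (M / (c * s) + 1 / (n * s))"
    proof -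
      have "?N \<inter> {w. w \<in> ?B} = ?B \<inter> ?N" by auto
      hence "(\<Sum>w\<in>?N. of_bool (w \<in> ?B) * (M / (c * s) + 1 / (n * s))) = card (?B \<inter> ?N) * (M / (c * s) + 1 / (n * s))"
        using N(2) by (simp only: sum_distrib_right[symmetric]) simp
      thus ?thesis by (simp add: sum.distrib dg_def)
    qed
    also have "\<dots> \<le> (C * s) * ((4 * \<eta> / n + \<eta> * M) / (c * s)) + (\<eta> * s) * (M / (c * s) + 1 / (n * s))"
      using indeg(2)[OF u] bad[OF u] \<eta> n M0 c s
      by (intro add_mono mult_right_mono) (auto simp: dg_def)
    also have "\<dots> = (4 * C / c + 1) * (\<eta> / n) + (C / c + 1 / c) * (\<eta> * M)"
      using s c n by (simp add: field_simps)
    \<comment> \<open>The constant \<open>K\<close> is a common upper bound for both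
      coefficients.\<close>
    also have "\<dots> \<le> K * (\<eta> / n) + K * (\<eta> * M)"
    proof (intro add_mono mult_right_mono)
      show "4 * C / c + 1 \<le> K" "C / c + 1 / c \<le> K"
        using c C by (auto simp: K(1) field_simps)
    qed (use \<eta> n M0 in auto)
    finally show ?thesis by (simp add: algebra_simps)
  qed
  \<comment> \<open>Apply \<open>main\<close> where the maximum is attained: since
    \<open>K * \<eta> \<le> 1 / 2\<close>, at most half of \<open>M\<close> reappears on the right
    and can be absorbed.\<close>
  have M_le: "M \<le> (2 * C + 1) / n"
  proof -
    have "M \<in> \<pi> ` V" unfolding M_def using fin v by (intro Max_in) auto
    then obtain u where u: "u \<in> V" "\<pi> u = M" by auto
    have "dg u / (n * s) \<le> (C * s) / (n * s)"
      using indeg(2)[OF u(1)] n s by (intro divide_right_mono) (auto simp: dg_def)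
    hence "dg u / (n * s) \<le> C / n" using s by simp
    moreover have "K * \<eta> * (1 / n + M) \<le> 1 / 2 * (1 / n + M)"
      using K(2) n M0 by (intro mult_right_mono) auto
    ultimately have "M \<le> C / n + 1 / 2 * (1 / n + M)"
      using main[OF u(1)] u(2) by linarith
    thus ?thesis using n by (simp add: field_simps)
  qed
  have K0: "0 \<le> K" using c C by (simp add: K(1))
  have dgv: "c * s \<le> dg v" "0 < dg v" using indeg(1)[OF v] c by (auto simp: dg_def)
  have eq: "\<pi> v * (n * s) / dg v - 1 = (\<pi> v - dg v / (n * s)) * (n * s / dg v)"
    using dgv n s by (simp add: field_simps)
  have "\<bar>\<pi> v * (n * s) / dg v - 1\<bar> = \<bar>\<pi> v - dg v / (n * s)\<bar> * (n * s / dg v)"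
    unfolding eq using dgv n s by (simp add: abs_mult)
  also have "\<dots> \<le> (K * \<eta> * ((2 * C + 2) / n)) * (n * s / (c * s))"
  proof (intro mult_mono frac_le)
    have "K * \<eta> * (1 / n + M) \<le> K * \<eta> * ((2 * C + 2) / n)"
      using M_le n K0 \<eta> by (intro mult_left_mono) (auto simp: add_divide_distrib)
    thus "\<bar>\<pi> v - dg v / (n * s)\<bar> \<le> K * \<eta> * ((2 * C + 2) / n)"
      using main[OF v] by linarith
  qed (use dgv n s c C K0 \<eta> in auto)
  also have "\<dots> = K * \<eta> * (2 * C + 2) / c"
    using n s c by (simp add: field_simps)
  finally show ?thesis by (simp add: n_def dg_def)
qed

section \<open>Random digraphs\<close>

abbreviation vertices :: "nat \<Rightarrow> nat set" where
  "vertices n \<equiv> {1..n}"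

abbreviation random_arcs :: "nat \<Rightarrow> real \<Rightarrow> (nat \<times> nat) set pmf" where
  "random_arcs n p \<equiv> random_subset (arc_pairs (vertices n)) p"

definition negligible :: "(nat \<Rightarrow> real) \<Rightarrow> (nat \<Rightarrow> (nat \<times> nat) set \<Rightarrow> bool) \<Rightarrow> bool" where
  "negligible p B \<longleftrightarrow> (\<lambda>n. measure_pmf.prob (random_arcs n (p n)) {X. B n X}) \<longlonglongrightarrow> 0"

lemma random_digraph_eq:
  "random_digraph n p = map_pmf (\<lambda>X. \<lparr>pverts = vertices n, parcs = X\<rparr>) (random_arcs n p)"
  by (simp add: random_digraph_def random_subset_def arc_pairs_def pmf.map_comp o_def Let_def)

lemma finite_arc_pairs_vertices: "finite (arc_pairs (vertices n))"
  by (simp add: finite_arc_pairs)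

lemma prob_mono_random_arcs:
  assumes "\<And>X. X \<subseteq> arc_pairs (vertices n) \<Longrightarrow> A X \<Longrightarrow> B X"
  shows "measure_pmf.prob (random_arcs n p) {X. A X} \<le> measure_pmf.prob (random_arcs n p) {X. B X}"
proof -
  have "measure_pmf.prob (random_arcs n p) {X. A X} = measure_pmf.prob (random_arcs n p) ({X. A X} \<inter> set_pmf (random_arcs n p))"
    by (simp add: measure_Int_set_pmf)
  also have "\<dots> \<le> measure_pmf.prob (random_arcs n p) {X. B X}"
    using assms set_pmf_random_subset[of "arc_pairs (vertices n)" p]
    by (intro measure_pmf.finite_measure_mono) auto
  finally show ?thesis .
qed

lemma negligible_bound:
  assumes "\<forall>\<^sub>F n in sequentially. measure_pmf.prob (random_arcs n (p n)) {X. B n X} \<le> f n" "f \<longlonglongrightarrow> 0"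
  shows "negligible p B"
  unfolding negligible_def
  by (rule tendsto_sandwich[OF _ assms(1) tendsto_const assms(2)]) simp

text \<open>This is the passage from deterministic arguments to probability: they may assume that
  \<open>n\<close> is large and that \<open>X\<close> consists of arcs on the vertex set.\<close>

lemma negligible_mono:
  assumes "negligible p B" "\<forall>\<^sub>F n in sequentially. \<forall>X \<subseteq> arc_pairs (vertices n). A n X \<longrightarrow> B n X"
  shows "negligible p A"
proof (rule negligible_bound)
  show "\<forall>\<^sub>F n in sequentially. measure_pmf.prob (random_arcs n (p n)) {X. A n X} \<le>
      measure_pmf.prob (random_arcs n (p n)) {X. B n X}"
    using assms(2) by eventually_elim (intro prob_mono_random_arcs, blast)
qed (use assms(1) in \<open>simp add: negligible_def\<close>)

lemma negligible_disj:
  assumes "negligible p A" "negligible p B"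
  shows "negligible p (\<lambda>n X. A n X \<or> B n X)"
proof (rule negligible_bound)
  have "measure_pmf.prob (random_arcs n (p n)) {X. A n X \<or> B n X} \<le>
      measure_pmf.prob (random_arcs n (p n)) {X. A n X} + measure_pmf.prob (random_arcs n (p n)) {X. B n X}" for n
    unfolding Collect_disj_eq by (rule measure_Un_le) auto
  thus "\<forall>\<^sub>F n in sequentially. measure_pmf.prob (random_arcs n (p n)) {X. A n X \<or> B n X} \<le>
      measure_pmf.prob (random_arcs n (p n)) {X. A n X} + measure_pmf.prob (random_arcs n (p n)) {X. B n X}"
    by simp
  show "(\<lambda>n. measure_pmf.prob (random_arcs n (p n)) {X. A n X} + measure_pmf.prob (random_arcs n (p n)) {X. B n X}) \<longlonglongrightarrow> 0"
    using tendsto_add[of _ 0 _ _ 0] assms unfolding negligible_def by fastforce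
qed

lemma prob_ex_le:
  fixes b :: real
  assumes "finite I" "\<And>i. i \<in> I \<Longrightarrow> measure_pmf.prob M {X. B i X} \<le> b"
  shows "measure_pmf.prob M {X. \<exists>i\<in>I. B i X} \<le> card I * b"
proof -
  have "{X. \<exists>i\<in>I. B i X} = (\<Union>i\<in>I. {X. B i X})" by auto
  hence "measure_pmf.prob M {X. \<exists>i\<in>I. B i X} \<le> (\<Sum>i\<in>I. measure_pmf.prob M {X. B i X})"
    using assms(1) by (simp add: measure_pmf.finite_measure_subadditive_finite)
  also have "\<dots> \<le> (\<Sum>i\<in>I. b)" using assms(2) by (rule sum_mono)
  finally show ?thesis by simp
qed

lemma with_high_probability_if_negligible:
  assumes "negligible p (\<lambda>n X. \<not> P n \<lparr>pverts = vertices n, parcs = X\<rparr>)"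
  shows "with_high_probability p P"
proof -
  have "measure_pmf.prob (random_digraph n (p n)) {D. P n D} =
    1 - measure_pmf.prob (random_arcs n (p n)) {X. \<not> P n \<lparr>pverts = vertices n, parcs = X\<rparr>}" for n
  proof -
    have "{X. \<not> P n \<lparr>pverts = vertices n, parcs = X\<rparr>} = UNIV - {X. P n \<lparr>pverts = vertices n, parcs = X\<rparr>}" by auto
    thus ?thesis
      by (simp add: random_digraph_eq vimage_def measure_pmf.prob_compl[of "{X. P n \<lparr>pverts = vertices n, parcs = X\<rparr>}", simplified])
  qed
  moreover have "(\<lambda>n. 1 - measure_pmf.prob (random_arcs n (p n)) {X. \<not> P n \<lparr>pverts = vertices n, parcs = X\<rparr>}) \<longlonglongrightarrow> 1 - 0"
    using assms unfolding negligible_def by (intro tendsto_intros)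
  ultimately show ?thesis by (simp add: with_high_probability_def)
qed

text \<open>Take \<open>\<epsilon> = 1 / (k + 1)\<close> with \<open>k\<close> growing slowly enough.\<close>

lemma with_high_probability_diagonal:
  fixes P :: "nat \<Rightarrow> nat pair_pre_digraph \<Rightarrow> real \<Rightarrow> bool"
  assumes "\<And>\<epsilon>. 0 < \<epsilon> \<Longrightarrow> with_high_probability p (\<lambda>n D. P n D \<epsilon>)"
  shows "\<exists>\<epsilon>. \<epsilon> \<longlonglongrightarrow> 0 \<and> with_high_probability p (\<lambda>n D. P n D (\<epsilon> n))"
proof -
  define a where "a k n = measure_pmf.prob (random_digraph n (p n)) {D. P n D (1 / (real k + 1))}" for k n
  have "\<exists>N. \<forall>n\<ge>N. 1 - 1 / (real k + 1) \<le> a k n" for k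
  proof -
    have "a k \<longlonglongrightarrow> 1"
      using assms[of "1 / (real k + 1)"] by (simp add: with_high_probability_def a_def[abs_def])
    moreover have "1 - 1 / (real k + 1) < 1" by simp
    ultimately have "\<forall>\<^sub>F n in sequentially. 1 - 1 / (real k + 1) < a k n"
      by (rule order_tendstoD)
    thus ?thesis by (auto simp: eventually_sequentially intro: less_imp_le)
  qed
  then obtain N where N: "\<And>k n. N k \<le> n \<Longrightarrow> 1 - 1 / (real k + 1) \<le> a k n"
    by metis
  \<comment> \<open>Admitting \<open>k = 0\<close> unconditionally keeps the set nonempty; for that
    index the required lower bound on the probability is 0.\<close>
  define S where "S n = {k. k \<le> n \<and> (k = 0 \<or> N k \<le> n)}" for n
  define m where "m n = Max (S n)" for n
  have fin: "finite (S n)" for n by (rule finite_subset[of _ "{..n}"]) (auto simp: S_def)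
  have ne: "S n \<noteq> {}" for n by (auto simp: S_def)
  have m_in: "m n \<in> S n" for n unfolding m_def by (rule Max_in[OF fin ne])
  have m_ge: "k \<le> m n" if "n \<ge> max k (N k)" for k n
    unfolding m_def using that by (intro Max_ge[OF fin]) (auto simp: S_def)
  have m_top: "filterlim m at_top sequentially"
    unfolding filterlim_at_top eventually_sequentially using m_ge by meson
  have lim: "(\<lambda>n. 1 / (real (m n) + 1)) \<longlonglongrightarrow> 0"
    using filterlim_compose[OF _ m_top, of "\<lambda>k. 1 / (real k + 1)"] LIMSEQ_inverse_real_of_nat
    by (simp add: inverse_eq_divide add.commute)
  have "with_high_probability p (\<lambda>n D. P n D (1 / (real (m n) + 1)))"
    unfolding with_high_probability_def
  proof (rule tendsto_sandwich[where h = "\<lambda>_. 1"])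
    show "\<forall>\<^sub>F n in sequentially. 1 - 1 / (real (m n) + 1) \<le>
        measure_pmf.prob (random_digraph n (p n)) {D. P n D (1 / (real (m n) + 1))}"
    proof (intro always_eventually allI)
      fix n
      show "1 - 1 / (real (m n) + 1) \<le> measure_pmf.prob (random_digraph n (p n)) {D. P n D (1 / (real (m n) + 1))}"
        using m_in[of n] N[of "m n" n] by (cases "m n = 0") (auto simp: S_def a_def)
    qed
    show "(\<lambda>n. 1 - 1 / (real (m n) + 1)) \<longlonglongrightarrow> 1"
      using tendsto_diff[OF tendsto_const[of 1] lim] by simp
  qed (auto intro: always_eventually)
  with lim show ?thesis by blast
qed

section \<open>From digraphs and stationary distributions to arc sets and vectors\<close>

lemma outdeg_eq: "outdeg \<lparr>pverts = V, parcs = X\<rparr> a = card (X `` {a})"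
proof -
  have "out_arcs (with_proj \<lparr>pverts = V, parcs = X\<rparr>) a = Pair a ` (X `` {a})"
    by (auto simp: out_arcs_def)
  thus ?thesis by (simp add: outdeg_def out_degree_def card_image inj_on_def)
qed

lemma indeg_eq: "indeg \<lparr>pverts = V, parcs = X\<rparr> a = card (X\<inverse> `` {a})"
proof -
  have "in_arcs (with_proj \<lparr>pverts = V, parcs = X\<rparr>) a = (\<lambda>b. (b, a)) ` (X\<inverse> `` {a})"
    by (auto simp: in_arcs_def)
  thus ?thesis by (simp add: indeg_def in_degree_def card_image inj_on_def)
qed

lemma in_nbrs_eq: "in_nbrs \<lparr>pverts = V, parcs = X\<rparr> a = X\<inverse> `` {a}"
  by (auto simp: in_nbrs_def)

lemma out_nbrs_eq: "out_nbrs \<lparr>pverts = V, parcs = X\<rparr> a = X `` {a}"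
  by (auto simp: out_nbrs_def)

text \<open>With positive out-degrees the convention for vertices without a move never applies, so
  \<open>walk_step\<close> is the kernel \<open>rw\<close> on \<open>V\<close>.\<close>

lemma is_stationary_iff:
  assumes "finite V" "X \<subseteq> arc_pairs V" "\<And>a. a \<in> V \<Longrightarrow> 0 < card (X `` {a})"
  shows "is_stationary \<lparr>pverts = V, parcs = X\<rparr> \<pi> \<longleftrightarrow>
    set_pmf \<pi> \<subseteq> V \<and> (\<forall>v\<in>V. act V (rw X) (pmf \<pi>) v = pmf \<pi> v)"
proof -
  let ?D = "\<lparr>pverts = V, parcs = X\<rparr>"
  have step: "pmf (walk_step ?D w) v = rw X w v" if "w \<in> V" for w v
  proof -
    have "X `` {w} \<noteq> {}" "finite (X `` {w})"
      using assms(3)[OF that] by (auto simp: card_gt_0_iff)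
    thus ?thesis by (auto simp: walk_step_def out_nbrs_eq rw_def')
  qed
  have bind: "pmf (bind_pmf \<pi> (walk_step ?D)) v = act V (rw X) (pmf \<pi>) v" if "set_pmf \<pi> \<subseteq> V" for v
  proof -
    have "pmf (bind_pmf \<pi> (walk_step ?D)) v = (\<Sum>w\<in>V. pmf \<pi> w * pmf (walk_step ?D w) v)"
      unfolding pmf_bind using that assms(1) by (subst integral_measure_pmf[of V]) auto
    also have "\<dots> = act V (rw X) (pmf \<pi>) v"
      unfolding act_def by (intro sum.cong) (auto simp: step)
    finally show ?thesis .
  qed
  have zero: "act V (rw X) (pmf \<pi>) v = pmf \<pi> v" if "set_pmf \<pi> \<subseteq> V" "v \<notin> V" for v
  proof -
    have "act V (rw X) (pmf \<pi>) v = 0"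
      unfolding act_def using assms(2) that by (intro sum.neutral) (auto simp: rw_def' arc_pairs_def)
    moreover have "pmf \<pi> v = 0" using that by (auto simp: set_pmf_iff)
    ultimately show ?thesis by simp
  qed
  show ?thesis
    unfolding is_stationary_def pmf_eq_iff using bind zero by auto
qed

lemma is_stationary_exists_unique:
  assumes "finite V" "V \<noteq> {}" "X \<subseteq> arc_pairs V" "\<And>a. a \<in> V \<Longrightarrow> 0 < card (X `` {a})"
    and "\<And>y. y \<in> V \<Longrightarrow> deficit V ((act V (rw X) ^^ T) (dirac y)) \<le> 1 / 4"
  shows "\<exists>!\<pi>. is_stationary \<lparr>pverts = V, parcs = X\<rparr> \<pi>"
proof (rule ex_ex1I)
  note stoch = stochastic_rw[OF assms(1,3,4)]
  obtain \<mu> where \<mu>: "\<And>v. v \<in> V \<Longrightarrow> 0 \<le> \<mu> v" "sum \<mu> V = 1" "\<And>v. v \<in> V \<Longrightarrow> act V (rw X) \<mu> v = \<mu> v"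
    using stationary_exists[OF assms(1,2) stoch assms(5)] by blast
  define f where "f v = (if v \<in> V then \<mu> v else 0)" for v
  have nonneg: "0 \<le> f v" for v using \<mu>(1) by (simp add: f_def)
  have "(\<integral>\<^sup>+ v. ennreal (f v) \<partial>count_space UNIV) = (\<integral>\<^sup>+ v. ennreal (f v) \<partial>count_space V)"
    by (rule nn_integral_count_space_eq) (auto simp: f_def)
  also have "\<dots> = (\<Sum>v\<in>V. ennreal (f v))"
    using assms(1) by (rule nn_integral_count_space_finite)
  also have "\<dots> = ennreal (\<Sum>v\<in>V. f v)"
    using nonneg by simp
  also have "(\<Sum>v\<in>V. f v) = 1" using \<mu>(2) by (simp add: f_def)
  finally have int: "(\<integral>\<^sup>+ v. ennreal (f v) \<partial>count_space UNIV) = 1" by simp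
  have pmf: "pmf (embed_pmf f) v = f v" for v
    by (rule pmf_embed_pmf[OF nonneg int])
  have "is_stationary \<lparr>pverts = V, parcs = X\<rparr> (embed_pmf f)"
  proof (rule iffD2[OF is_stationary_iff[OF assms(1,3,4)]], assumption, intro conjI ballI)
    show "set_pmf (embed_pmf f) \<subseteq> V"
      using pmf by (auto simp: set_pmf_iff f_def split: if_splits)
    fix v assume v: "v \<in> V"
    have "act V (rw X) (pmf (embed_pmf f)) v = act V (rw X) \<mu> v"
      unfolding act_def by (intro sum.cong) (auto simp: pmf f_def)
    thus "act V (rw X) (pmf (embed_pmf f)) v = pmf (embed_pmf f) v"
      using \<mu>(3)[OF v] v by (simp add: pmf f_def)
  qed
  thus "\<exists>\<pi>. is_stationary \<lparr>pverts = V, parcs = X\<rparr> \<pi>" ..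
next
  fix \<pi> \<pi>' assume "is_stationary \<lparr>pverts = V, parcs = X\<rparr> \<pi>" "is_stationary \<lparr>pverts = V, parcs = X\<rparr> \<pi>'"
  hence *: "set_pmf \<pi> \<subseteq> V" "set_pmf \<pi>' \<subseteq> V" "\<And>v. v \<in> V \<Longrightarrow> act V (rw X) (pmf \<pi>) v = pmf \<pi> v"
    "\<And>v. v \<in> V \<Longrightarrow> act V (rw X) (pmf \<pi>') v = pmf \<pi>' v"
    by (auto simp: is_stationary_iff[OF assms(1,3,4)])
  show "\<pi> = \<pi>'"
  proof (rule pmf_eqI)
    fix v
    show "pmf \<pi> v = pmf \<pi>' v"
    proof (cases "v \<in> V")
      case True
      show ?thesis
      proof (rule stationary_unique[OF assms(1,2) stochastic_rw[OF assms(1,3,4)] assms(5)])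
        show "sum (pmf \<pi>) V = 1" "sum (pmf \<pi>') V = 1"
          using sum_pmf_eq_1[OF assms(1)] *(1,2) by blast+
      qed (use * True in blast)+
    next
      case False
      hence "pmf \<pi> v = 0" "pmf \<pi>' v = 0" using *(1,2) by (auto simp: set_pmf_iff)
      thus ?thesis by simp
    qed
  qed
qed

section \<open>Degree bounds\<close>

lemma card_row_Int_le: 
  assumes "finite V" "X \<subseteq> arc_pairs V"
  shows "card ({a} \<times> A \<inter> X) \<le> card (X `` {a})"
proof -
  have "card ({a} \<times> A \<inter> X) \<le> card (Pair a ` (X `` {a}))"
    using finite_Image_arc_pairs[OF assms] by (intro card_mono) auto
  thus ?thesis by (simp add: card_image inj_on_def)
qed

lemma card_row_Int:
  assumes "X \<subseteq> arc_pairs V"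
  shows "card ({a} \<times> (V - {a}) \<inter> X) = card (X `` {a})"
proof -
  have "{a} \<times> (V - {a}) \<inter> X = Pair a ` (X `` {a})" using assms by (auto simp: arc_pairs_def)
  thus ?thesis by (simp add: card_image inj_on_def)
qed

lemma finite_Image_converse_arc_pairs: "finite V \<Longrightarrow> X \<subseteq> arc_pairs V \<Longrightarrow> finite (X\<inverse> `` A)"
  by (rule finite_subset[of _ V]) (auto simp: arc_pairs_def)

lemma card_col_Int_le:
  assumes "finite V" "X \<subseteq> arc_pairs V"
  shows "card (A \<times> {a} \<inter> X) \<le> card (X\<inverse> `` {a})"
proof -
  have "card (A \<times> {a} \<inter> X) \<le> card ((\<lambda>b. (b, a)) ` (X\<inverse> `` {a}))"
    using finite_Image_converse_arc_pairs[OF assms] by (intro card_mono) auto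
  thus ?thesis by (simp add: card_image inj_on_def)
qed

lemma card_col_Int:
  assumes "X \<subseteq> arc_pairs V"
  shows "card ((V - {a}) \<times> {a} \<inter> X) = card (X\<inverse> `` {a})"
proof -
  have "(V - {a}) \<times> {a} \<inter> X = (\<lambda>b. (b, a)) ` (X\<inverse> `` {a})" using assms by (auto simp: arc_pairs_def)
  thus ?thesis by (simp add: card_image inj_on_def)
qed

text \<open>Degrees have \<open>n - 1\<close> trials, or \<open>n - 2\<close> when one arc is set
  aside. Since \<open>p * (1 - s) \<le> 1\<close>, counting \<open>n\<close> trials instead costs at
  most \<open>a\<close> in the exponent.\<close>

lemma card_minus_mult_ge:
  fixes p s :: real
  assumes "0 \<le> p" "p \<le> 1" "0 \<le> s" "s \<le> 1" "a \<le> n"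
  shows "real n * p * (1 - s) - a \<le> real (n - a) * p * (1 - s)"
proof -
  have "p * (1 - s) \<le> 1 * 1" using assms by (intro mult_mono) auto
  hence "real a * (p * (1 - s)) \<le> real a * 1" by (intro mult_left_mono) auto
  thus ?thesis using assms(5) by (simp add: of_nat_diff algebra_simps)
qed

lemma
  fixes p s k :: real
  assumes "0 \<le> p" "p \<le> 1" "0 < s" "s \<le> 1" "a \<in> vertices n"
  shows prob_outdeg_le: "measure_pmf.prob (random_arcs n p) {X. card (X `` {a}) \<le> k} \<le>
      exp (1 - k * ln s - n * p * (1 - s))" (is ?th1)
    and prob_indeg_le: "measure_pmf.prob (random_arcs n p) {X. card (X\<inverse> `` {a}) \<le> k} \<le>
      exp (1 - k * ln s - n * p * (1 - s))" (is ?th2)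
proof -
  have n: "1 \<le> n" using assms(5) by simp
  let ?V = "vertices n"
  have *: "exp (- k * ln s - real (n - 1) * p * (1 - s)) \<le> exp (1 - k * ln s - n * p * (1 - s))"
    using card_minus_mult_ge[of p s 1 n] assms n by simp
  have "measure_pmf.prob (random_arcs n p) {X. card (X `` {a}) \<le> k} \<le>
      exp (- k * ln s - card ({a} \<times> (?V - {a})) * p * (1 - s))"
    by (rule prob_random_subset_card_le)
       (use assms in \<open>auto simp: finite_arc_pairs card_row_Int, auto simp: arc_pairs_def\<close>)
  also have "card ({a} \<times> (?V - {a})) = n - 1" using assms(5) by (simp add: card_cartesian_product)
  finally show ?th1 using * by linarith
  have "measure_pmf.prob (random_arcs n p) {X. card (X\<inverse> `` {a}) \<le> k} \<le>
      exp (- k * ln s - card ((?V - {a}) \<times> {a}) * p * (1 - s))"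
    by (rule prob_random_subset_card_le)
       (use assms in \<open>auto simp: finite_arc_pairs card_col_Int, auto simp: arc_pairs_def\<close>)
  also have "card ((?V - {a}) \<times> {a}) = n - 1" using assms(5) by (simp add: card_cartesian_product)
  finally show ?th2 using * by linarith
qed

lemma
  fixes p s k :: real
  assumes "0 \<le> p" "p \<le> 1" "1 \<le> s" "a \<in> vertices n"
  shows prob_outdeg_ge: "measure_pmf.prob (random_arcs n p) {X. k \<le> card (X `` {a})} \<le>
      exp (- k * ln s + n * p * (s - 1))" (is ?th1)
    and prob_indeg_ge: "measure_pmf.prob (random_arcs n p) {X. k \<le> card (X\<inverse> `` {a})} \<le>
      exp (- k * ln s + n * p * (s - 1))" (is ?th2)
proof -
  let ?V = "vertices n"
  have "real (n - 1) * (p * (s - 1)) \<le> n * (p * (s - 1))"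
    using assms by (intro mult_right_mono) auto
  hence *: "exp (- k * ln s - real (n - 1) * p * (1 - s)) \<le> exp (- k * ln s + n * p * (s - 1))"
    by (simp add: algebra_simps)
  have "measure_pmf.prob (random_arcs n p) {X. k \<le> card (X `` {a})} \<le>
      exp (- k * ln s - card ({a} \<times> (?V - {a})) * p * (1 - s))"
    by (rule prob_random_subset_card_ge)
       (use assms in \<open>auto simp: finite_arc_pairs card_row_Int, auto simp: arc_pairs_def\<close>)
  also have "card ({a} \<times> (?V - {a})) = n - 1" using assms(4) by (simp add: card_cartesian_product)
  finally show ?th1 using * by linarith
  have "measure_pmf.prob (random_arcs n p) {X. k \<le> card (X\<inverse> `` {a})} \<le>
      exp (- k * ln s - card ((?V - {a}) \<times> {a}) * p * (1 - s))"
    by (rule prob_random_subset_card_ge)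
       (use assms in \<open>auto simp: finite_arc_pairs card_col_Int, auto simp: arc_pairs_def\<close>)
  also have "card ((?V - {a}) \<times> {a}) = n - 1" using assms(4) by (simp add: card_cartesian_product)
  finally show ?th2 using * by linarith
qed

section \<open>Union bounds over arcs and vertices\<close>

lemma card_arc_pairs_le: "real (card (arc_pairs (vertices n))) \<le> real n * real n"
proof -
  have "card (arc_pairs (vertices n)) \<le> card (vertices n \<times> vertices n)"
    by (intro card_mono) (auto simp: arc_pairs_def)
  hence "real (card (arc_pairs (vertices n))) \<le> real (n * n)" by (simp only: of_nat_le_iff) (simp add: card_cartesian_product)
  thus ?thesis by simp
qed

text \<open>There are at most \<open>n * n\<close> possible arcs, each present with probability
  \<open>p\<close>, hence the factor \<open>n * (n * p)\<close>. The set \<open>W w v\<close> avoids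
  \<open>(w, v)\<close>, so its count is independent of the presence of that arc.\<close>

lemma prob_arc_chernoff:
  fixes p s k b :: real
  assumes "0 \<le> p" "p \<le> 1" "0 < s" "s \<le> 1"
    and "\<And>w v. (w, v) \<in> arc_pairs (vertices n) \<Longrightarrow> W w v \<subseteq> arc_pairs (vertices n) - {(w, v)}"
    and "\<And>w v. (w, v) \<in> arc_pairs (vertices n) \<Longrightarrow> b \<le> card (W w v) * p * (1 - s)"
    and "\<And>w v X. (w, v) \<in> X \<Longrightarrow> X \<subseteq> arc_pairs (vertices n) \<Longrightarrow> Q w v X \<Longrightarrow> card (W w v \<inter> X) \<le> k"
  shows "measure_pmf.prob (random_arcs n p) {X. \<exists>w v. (w, v) \<in> X \<and> Q w v X} \<le> n * (n * p) * exp (- k * ln s - b)"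
proof -
  let ?A = "arc_pairs (vertices n)"
  have "measure_pmf.prob (random_arcs n p) {X. \<exists>w v. (w, v) \<in> X \<and> Q w v X} \<le>
      measure_pmf.prob (random_arcs n p) {X. \<exists>e\<in>?A. e \<in> X \<and> Q (fst e) (snd e) X}"
    by (intro prob_mono_random_arcs) fastforce
  also have "\<dots> \<le> card ?A * (p * exp (- k * ln s - b))"
  proof (rule prob_ex_le[OF finite_arc_pairs_vertices])
    fix e assume "e \<in> ?A"
    then obtain w v where e: "e = (w, v)" "(w, v) \<in> ?A" by (cases e) auto
    have "measure_pmf.prob (random_arcs n p) {X. e \<in> X \<and> Q (fst e) (snd e) X} \<le>
        p ^ card {e} * exp (- k * ln s - card (W w v) * p * (1 - s))"
    proof (rule prob_random_subset_chernoff)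
      fix X assume X: "X \<subseteq> ?A" "e \<in> X \<and> Q (fst e) (snd e) X"
      hence "card (W w v \<inter> X) \<le> k" using assms(7)[of w v X] e by simp
      hence "s powr k \<le> s powr card (W w v \<inter> X)" using assms by (intro powr_mono') auto
      thus "{e} \<subseteq> X \<and> s powr k \<le> s ^ card (W w v \<inter> X)"
        using X assms(3) by (simp add: powr_realpow)
    qed (use assms(1-4) assms(5)[OF e(2)] e finite_arc_pairs_vertices in auto)
    also have "\<dots> \<le> p * exp (- k * ln s - b)"
      using assms(1) assms(6)[OF e(2)] by (simp add: mult_left_mono)
    finally show "measure_pmf.prob (random_arcs n p) {X. e \<in> X \<and> Q (fst e) (snd e) X} \<le> p * exp (- k * ln s - b)" .
  qed
  also have "\<dots> \<le> (real n * real n) * (p * exp (- k * ln s - b))"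
    using assms(1) by (intro mult_right_mono card_arc_pairs_le) auto
  finally show ?thesis by (simp add: mult_ac)
qed

text \<open>A vertex without in-neighbours is the head of no arc, so bounds over arcs cannot see it,
  and there \<open>varsigma_star\<close> is an unspecified maximum. The power 0 brings the bound
  into the common form whose limit is assumed later.\<close>

lemma prob_indeg_zero:
  fixes p :: real
  assumes "0 \<le> p" "p \<le> 1" "1 \<le> real n * p"
  shows "measure_pmf.prob (random_arcs n p) {X. \<exists>v\<in>vertices n. card (X\<inverse> `` {v}) = 0} \<le>
    exp 3 * (n * (n * p) ^ 0 * exp (- (n * p)))"
proof -
  let ?x = "real n * p"
  have "measure_pmf.prob (random_arcs n p) {X. \<exists>v\<in>vertices n. card (X\<inverse> `` {v}) = 0} \<le>
      card (vertices n) * exp (3 - ?x)"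
  proof (rule prob_ex_le)
    fix v assume v: "v \<in> vertices n"
    have "measure_pmf.prob (random_arcs n p) {X. card (X\<inverse> `` {v}) \<le> (0 :: real)} \<le>
        exp (1 - 0 * ln (1 / ?x) - ?x * (1 - 1 / ?x))"
      using assms by (intro prob_indeg_le v) auto
    also have "\<dots> \<le> exp (3 - ?x)" using assms(3) by (auto simp: right_diff_distrib)
    finally show "measure_pmf.prob (random_arcs n p) {X. card (X\<inverse> `` {v}) = 0} \<le> exp (3 - ?x)"
      by simp
  qed simp
  thus ?thesis by (simp add: exp_diff exp_minus field_simps)
qed

lemma prob_indeg_large:
  fixes p :: real
  assumes "0 \<le> p" "p \<le> 1"
  shows "measure_pmf.prob (random_arcs n p) {X. \<exists>v\<in>vertices n. 4 * (n * p) < card (X\<inverse> `` {v})} \<le>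
    n * exp (- 2 * (n * p))"
proof -
  have "measure_pmf.prob (random_arcs n p) {X. \<exists>v\<in>vertices n. 4 * (n * p) < card (X\<inverse> `` {v})} \<le>
      card (vertices n) * exp (- 2 * (n * p))"
  proof (rule prob_ex_le)
    fix v assume v: "v \<in> vertices n"
    have "measure_pmf.prob (random_arcs n p) {X. 4 * (n * p) < card (X\<inverse> `` {v})} \<le>
       measure_pmf.prob (random_arcs n p) {X. 4 * (n * p) \<le> card (X\<inverse> `` {v})}"
      by (intro prob_mono_random_arcs) simp
    \<comment> \<open>The choice \<open>s = exp 1\<close> together with \<open>exp 1 \<le> 3\<close>
      leaves the exponent \<open>- 4 + 2\<close> times \<open>n * p\<close>.\<close>
    also have "\<dots> \<le> exp (- (4 * (n * p)) * ln (exp 1) + n * p * (exp 1 - 1))"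
      using assms v by (intro prob_indeg_ge) auto
    also have "\<dots> \<le> exp (- 2 * (n * p))"
    proof -
      have "n * p * exp 1 \<le> n * p * 3" using exp_le assms by (intro mult_left_mono) auto
      thus ?thesis by (simp add: algebra_simps)
    qed
    finally show "measure_pmf.prob (random_arcs n p) {X. 4 * (n * p) < card (X\<inverse> `` {v})} \<le> exp (- 2 * (n * p))" .
  qed simp
  thus ?thesis by simp
qed

text \<open>The choice \<open>s = 1 / (n * p)\<close> makes \<open>k\<close> successes cost
  \<open>(n * p) ^ k\<close>, and the arc itself adds one more factor \<open>n * p\<close>. The 3 in
  the exponent is 2 for the missing trials plus 1 for \<open>n * p * s\<close>.\<close>

lemma prob_arc_low_degree:
  fixes k :: nat and p :: real
  assumes "0 \<le> p" "p \<le> 1" "1 \<le> real n * p" "2 \<le> n"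
  shows "measure_pmf.prob (random_arcs n p)
      {X. \<exists>w v. (w, v) \<in> X \<and> (card (X `` {w}) \<le> k)} \<le> exp 3 * (n * (n * p) ^ (k + 1) * exp (- (n * p)))" (is ?th1)
    and "measure_pmf.prob (random_arcs n p)
      {X. \<exists>w v. (w, v) \<in> X \<and> (card (X\<inverse> `` {v}) \<le> k)} \<le> exp 3 * (n * (n * p) ^ (k + 1) * exp (- (n * p)))" (is ?th2)
proof -
  let ?x = "real n * p" and ?V = "vertices n"
  have b: "?x - 3 \<le> real (n - 2) * p * (1 - 1 / ?x)"
  proof -
    have "y * (1 - 1 / y) = y - 1" if "1 \<le> y" for y :: real using that by (simp add: field_simps)
    hence "?x * (1 - 1 / ?x) = ?x - 1" using assms(3) .
    thus ?thesis using card_minus_mult_ge[of p "1 / ?x" 2 n] assms by simp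
  qed
  have eq: "n * (n * p) * exp (- real k * ln (1 / ?x) - (?x - 3)) = exp 3 * (n * ?x ^ (k + 1) * exp (- ?x))"
  proof -
    have "exp (- real k * ln (1 / y) - (y - 3)) = exp (k * ln y + 3 + (- y))" if "1 \<le> y" for y :: real
      using that by (simp add: ln_div)
    hence "exp (- real k * ln (1 / ?x) - (?x - 3)) = exp (k * ln ?x + 3 + (- ?x))" using assms(3) .
    also have "\<dots> = exp (ln ?x) ^ k * exp 3 * exp (- ?x)"
      by (simp only: exp_add exp_of_nat_mult)
    also have "exp (ln ?x) = ?x" using assms(3) by (intro exp_ln) linarith
    finally show ?thesis by simp
  qed
  have "measure_pmf.prob (random_arcs n p) {X. \<exists>w v. (w, v) \<in> X \<and> (card (X `` {w}) \<le> k)} \<le>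
     n * (n * p) * exp (- real k * ln (1 / ?x) - (?x - 3))"
  proof (rule prob_arc_chernoff[where W = "\<lambda>w v. {w} \<times> (?V - {w, v})"])
    fix w v assume wv: "(w, v) \<in> arc_pairs ?V"
    show "{w} \<times> (?V - {w, v}) \<subseteq> arc_pairs ?V - {(w, v)}" using wv by (auto simp: arc_pairs_def)
    have "card (?V - {w, v}) = n - 2" using wv by (subst card_Diff_subset) (auto simp: arc_pairs_def)
    thus "?x - 3 \<le> card ({w} \<times> (?V - {w, v})) * p * (1 - 1 / ?x)"
      using b by (simp add: card_cartesian_product)
  next
    fix w v X assume "X \<subseteq> arc_pairs ?V" "card (X `` {w}) \<le> k"
    thus "real (card ({w} \<times> (?V - {w, v}) \<inter> X)) \<le> real k"
      using card_row_Int_le[of ?V X w "?V - {w, v}"] by simp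
  qed (use assms in auto)
  thus ?th1 unfolding eq .
  have "measure_pmf.prob (random_arcs n p) {X. \<exists>w v. (w, v) \<in> X \<and> (card (X\<inverse> `` {v}) \<le> k)} \<le>
     n * (n * p) * exp (- real k * ln (1 / ?x) - (?x - 3))"
  proof (rule prob_arc_chernoff[where W = "\<lambda>w v. (?V - {w, v}) \<times> {v}"])
    fix w v assume wv: "(w, v) \<in> arc_pairs ?V"
    show "(?V - {w, v}) \<times> {v} \<subseteq> arc_pairs ?V - {(w, v)}" using wv by (auto simp: arc_pairs_def)
    have "card (?V - {w, v}) = n - 2" using wv by (subst card_Diff_subset) (auto simp: arc_pairs_def)
    thus "?x - 3 \<le> card ((?V - {w, v}) \<times> {v}) * p * (1 - 1 / ?x)"
      using b by (simp add: card_cartesian_product)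
  next
    fix w v X assume "X \<subseteq> arc_pairs ?V" "card (X\<inverse> `` {v}) \<le> k"
    thus "real (card ((?V - {w, v}) \<times> {v} \<inter> X)) \<le> real k"
      using card_col_Int_le[of ?V X "?V - {w, v}" v] by simp
  qed (use assms in auto)
  thus ?th2 unfolding eq .
qed

lemma prob_arc_both_low_degree:
  fixes p :: real
  assumes "0 \<le> p" "p \<le> 1" "2 \<le> n"
  shows "measure_pmf.prob (random_arcs n p)
      {X. \<exists>w v. (w, v) \<in> X \<and> (card (X `` {w}) \<le> n * p / 20 \<and> card (X\<inverse> `` {v}) \<le> n * p / 20)} \<le>
    exp 4 * (n * (n * p) ^ 1 * exp (- (n * p)))"
proof -
  let ?x = "real n * p" and ?V = "vertices n"
  \<comment> \<open>At this \<open>s\<close> the permitted total degree of a tenth of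
    \<open>?x\<close> costs \<open>?x / 5\<close>, whereas the two degrees with joint mean about
    \<open>2 * ?x\<close> gain at least \<open>3 / 2 * ?x - 4\<close>. The balance is below
    \<open>4 - ?x\<close>.\<close>
  define s :: real where "s = exp (- 2)"
  have "2 * 2 \<le> exp 1 * exp (1 :: real)"
    using exp_ge_add_one_self[of "1 :: real"] by (intro mult_mono) auto
  hence "4 \<le> exp (2 :: real)" by (simp flip: exp_add)
  hence s: "0 < s" "s \<le> 1 / 4" by (auto simp: s_def exp_minus field_simps)
  have b: "3 / 2 * ?x - 4 \<le> real (2 * (n - 2)) * p * (1 - s)"
  proof -
    have "?x * (3 / 4) \<le> ?x * (1 - s)" using s assms by (intro mult_left_mono) auto
    moreover have "real (2 * (n - 2)) * p * (1 - s) = 2 * (real (n - 2) * p * (1 - s))" by simp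
    moreover have "real n * p * (1 - s) - real 2 \<le> real (n - 2) * p * (1 - s)"
      using s assms by (intro card_minus_mult_ge) auto
    ultimately show ?thesis by linarith
  qed
  have "measure_pmf.prob (random_arcs n p)
      {X. \<exists>w v. (w, v) \<in> X \<and> (card (X `` {w}) \<le> n * p / 20 \<and> card (X\<inverse> `` {v}) \<le> n * p / 20)} \<le>
     n * (n * p) * exp (- (?x / 10) * ln s - (3 / 2 * ?x - 4))"
  proof (rule prob_arc_chernoff[where W = "\<lambda>w v. {w} \<times> (?V - {w, v}) \<union> (?V - {w, v}) \<times> {v}"])
    fix w v assume wv: "(w, v) \<in> arc_pairs ?V"
    show "{w} \<times> (?V - {w, v}) \<union> (?V - {w, v}) \<times> {v} \<subseteq> arc_pairs ?V - {(w, v)}"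
      using wv by (auto simp: arc_pairs_def)
    have "card (?V - {w, v}) = n - 2" using wv by (subst card_Diff_subset) (auto simp: arc_pairs_def)
    hence "card ({w} \<times> (?V - {w, v}) \<union> (?V - {w, v}) \<times> {v}) = 2 * (n - 2)"
      by (subst card_Un_disjoint) (auto simp: card_cartesian_product)
    thus "3 / 2 * ?x - 4 \<le> card ({w} \<times> (?V - {w, v}) \<union> (?V - {w, v}) \<times> {v}) * p * (1 - s)"
      using b by simp
  next
    fix w v X
    assume X: "X \<subseteq> arc_pairs ?V" and "card (X `` {w}) \<le> n * p / 20 \<and> card (X\<inverse> `` {v}) \<le> n * p / 20"
    moreover have "card (({w} \<times> (?V - {w, v}) \<union> (?V - {w, v}) \<times> {v}) \<inter> X) \<le> card (X `` {w}) + card (X\<inverse> `` {v})"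
      unfolding Int_Un_distrib2 using X
      by (intro order.trans[OF card_Un_le] add_mono card_row_Int_le[of ?V] card_col_Int_le[of ?V]) auto
    hence "real (card (({w} \<times> (?V - {w, v}) \<union> (?V - {w, v}) \<times> {v}) \<inter> X)) \<le> real (card (X `` {w})) + real (card (X\<inverse> `` {v}))"
      by (simp only: of_nat_add[symmetric] of_nat_le_iff)
    ultimately show "real (card (({w} \<times> (?V - {w, v}) \<union> (?V - {w, v}) \<times> {v}) \<inter> X)) \<le> ?x / 10"
      by linarith
  qed (use assms s in auto)
  also have "\<dots> \<le> n * (n * p) * exp (4 - ?x)"
    using assms by (intro mult_left_mono) (auto simp: s_def)
  also have "\<dots> = exp 4 * (n * (n * p) ^ 1 * exp (- (n * p)))"
    by (simp add: exp_diff exp_minus field_simps)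
  finally show ?thesis .
qed

text \<open>The degree threshold \<open>k\<close> grows as \<epsilon> shrinks, so \<open>lim\<close>
  is required for every power; this is what a \<gamma> growing faster than any multiple of
  \<open>ln (ln n)\<close> provides.\<close>

lemma varsigma_star_whp:
  fixes p :: "nat \<Rightarrow> real" and \<epsilon> :: real
  assumes p: "\<And>n. 0 \<le> p n" "\<And>n. p n \<le> 1"
    and large: "\<forall>\<^sub>F n in sequentially. 1 \<le> real n * p n"
    and lim: "\<And>k. (\<lambda>n. n * (n * p n) ^ k * exp (- (n * p n))) \<longlonglongrightarrow> 0"
    and \<epsilon>: "0 < \<epsilon>"
  shows "with_high_probability p (\<lambda>n D. \<forall>v \<in> pverts D.
    in_nbrs D v \<noteq> {} \<and> varsigma_star D v \<le> \<epsilon> * real (indeg D v))"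
proof (rule with_high_probability_if_negligible)
  \<comment> \<open>Both degrees at the arc exceed \<open>k\<close> and one exceeds
    \<open>n * p n / 20\<close>, so their product is at least \<open>k * (n * p n) / 20\<close>. The
    value 80 makes this \<open>4 * (n * p n) / \<epsilon>\<close>, to be compared with the largest
    in-degree \<open>4 * (n * p n)\<close>.\<close>
  define k where "k = nat \<lceil>80 / \<epsilon>\<rceil>"
  have k: "80 / \<epsilon> \<le> k" unfolding k_def by linarith
  define B0 where "B0 = (\<lambda>(n::nat) (X :: (nat \<times> nat) set). \<exists>v\<in>vertices n. card (X\<inverse> `` {v}) = 0)"
  define B1 where "B1 = (\<lambda>n (X :: (nat \<times> nat) set). \<exists>v\<in>vertices n. 4 * (n * p n) < card (X\<inverse> `` {v}))"
  define B2 where "B2 = (\<lambda>(n::nat) (X :: (nat \<times> nat) set). \<exists>w v. (w, v) \<in> X \<and> (card (X `` {w}) \<le> k))"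
  define B3 where "B3 = (\<lambda>(n::nat) (X :: (nat \<times> nat) set). \<exists>w v. (w, v) \<in> X \<and> (card (X\<inverse> `` {v}) \<le> k))"
  define B4 where "B4 = (\<lambda>n (X :: (nat \<times> nat) set). \<exists>w v. (w, v) \<in> X \<and>
    (card (X `` {w}) \<le> n * p n / 20 \<and> card (X\<inverse> `` {v}) \<le> n * p n / 20))"
  have ev2: "\<forall>\<^sub>F n in sequentially. (2::nat) \<le> n" by (rule eventually_ge_at_top)
  have lim': "(\<lambda>n. c * (n * (n * p n) ^ k * exp (- (n * p n)))) \<longlonglongrightarrow> 0" for c k
    using tendsto_mult_right_zero[OF lim[of k], of c] by simp
  have "negligible p B0"
    unfolding B0_def
    by (rule negligible_bound[OF eventually_mono[OF large] lim']) (use p prob_indeg_zero in blast)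
  moreover have "negligible p B1"
    unfolding B1_def
  proof (rule negligible_bound[OF _ lim[of 0]])
    show "\<forall>\<^sub>F n in sequentially. measure_pmf.prob (random_arcs n (p n)) {X. \<exists>v\<in>vertices n. 4 * (n * p n) < card (X\<inverse> `` {v})}
        \<le> n * (n * p n) ^ 0 * exp (- (n * p n))"
      using large
    proof eventually_elim
      case (elim n)
      have "n * exp (- 2 * (n * p n)) \<le> n * exp (- (n * p n))"
        using elim by (intro mult_left_mono) auto
      thus ?case using prob_indeg_large[OF p, of n n] by simp
    qed
  qed
  moreover have "negligible p B2"
    unfolding B2_def
    by (rule negligible_bound[OF eventually_mono[OF eventually_conj[OF large ev2]] lim']) (use p prob_arc_low_degree in blast)
  moreover have "negligible p B3"
    unfolding B3_def
    by (rule negligible_bound[OF eventually_mono[OF eventually_conj[OF large ev2]] lim']) (use p prob_arc_low_degree in blast)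
  moreover have "negligible p B4"
    unfolding B4_def
    by (rule negligible_bound[OF eventually_mono[OF ev2] lim']) (use p prob_arc_both_low_degree in blast)
  ultimately have neg: "negligible p (\<lambda>n X. B0 n X \<or> B1 n X \<or> B2 n X \<or> B3 n X \<or> B4 n X)"
    by (intro negligible_disj)
  show "negligible p (\<lambda>n X. \<not> (\<forall>v \<in> pverts \<lparr>pverts = vertices n, parcs = X\<rparr>.
    in_nbrs \<lparr>pverts = vertices n, parcs = X\<rparr> v \<noteq> {} \<and>
    varsigma_star \<lparr>pverts = vertices n, parcs = X\<rparr> v \<le> \<epsilon> * real (indeg \<lparr>pverts = vertices n, parcs = X\<rparr> v)))"
  proof (rule negligible_mono[OF neg], rule eventually_mono[OF large], intro allI impI, rule ccontr)
    fix n X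
    let ?D = "\<lparr>pverts = vertices n, parcs = X\<rparr>" and ?x = "real n * p n"
    assume x: "1 \<le> ?x" and X: "X \<subseteq> arc_pairs (vertices n)"
      and bad: "\<not> (\<forall>v \<in> pverts ?D. in_nbrs ?D v \<noteq> {} \<and> varsigma_star ?D v \<le> \<epsilon> * real (indeg ?D v))"
      and good: "\<not> (B0 n X \<or> B1 n X \<or> B2 n X \<or> B3 n X \<or> B4 n X)"
    have "in_nbrs ?D v \<noteq> {} \<and> varsigma_star ?D v \<le> \<epsilon> * real (indeg ?D v)" if v: "v \<in> vertices n" for v
    proof
      have fin: "finite (X\<inverse> `` {v})" using X by (intro finite_Image_converse_arc_pairs[of "vertices n"]) auto
      have "card (X\<inverse> `` {v}) \<noteq> 0"
      proof
        assume "card (X\<inverse> `` {v}) = 0"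
        hence "B0 n X" unfolding B0_def using v by (rule bexI)
        thus False using good by simp
      qed
      thus ne: "in_nbrs ?D v \<noteq> {}" unfolding in_nbrs_eq by force
      show "varsigma_star ?D v \<le> \<epsilon> * real (indeg ?D v)"
        unfolding varsigma_star_def
      proof (rule Max.boundedI)
        fix r assume "r \<in> (\<lambda>w. real (indeg ?D w) / real (outdeg ?D w)) ` in_nbrs ?D v"
        then obtain w where wv: "(w, v) \<in> X" and r: "r = real (indeg ?D w) / real (outdeg ?D w)"
          by (auto simp: in_nbrs_eq)
        hence wV: "w \<in> vertices n" using X by (auto simp: arc_pairs_def)
        define a where "a = real (card (X `` {w}))"
        define b where "b = real (card (X\<inverse> `` {v}))"
        have ab: "k < a" "k < b" "?x / 20 < a \<or> ?x / 20 < b"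
          using good wv by (force simp: B2_def B3_def B4_def a_def b_def)+
        have k0: "0 < real k" using k \<epsilon> by (metis divide_pos_pos less_le_trans zero_less_numeral)
        have "k * (?x / 20) \<le> a * b"
          using ab(3)
        proof
          assume "?x / 20 < a"
          hence "(?x / 20) * k \<le> a * b" using ab k0 x by (intro mult_mono) auto
          thus ?thesis by (simp add: mult.commute)
        next
          assume "?x / 20 < b"
          thus ?thesis using ab k0 x by (intro mult_mono) auto
        qed
        moreover have "80 / \<epsilon> * (?x / 20) \<le> k * (?x / 20)" using k x by (intro mult_right_mono) auto
        ultimately have "80 / \<epsilon> * (?x / 20) \<le> a * b" by linarith
        hence "4 * ?x / \<epsilon> \<le> a * b" by simp
        hence "4 * ?x \<le> \<epsilon> * b * a" using \<epsilon> by (simp add: pos_divide_le_eq mult_ac)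
        moreover have "real (card (X\<inverse> `` {w})) \<le> 4 * ?x"
          using good wV by (force simp: B1_def)
        ultimately have "real (card (X\<inverse> `` {w})) / a \<le> \<epsilon> * b"
          using ab k0 by (simp add: divide_le_eq)
        thus "r \<le> \<epsilon> * real (indeg ?D v)"
          by (simp add: r indeg_eq outdeg_eq a_def b_def)
      qed (use fin ne in \<open>auto simp: in_nbrs_eq\<close>)
    qed
    thus False using bad by simp
  qed
qed

section \<open>Leave-one-out bounds\<close>

text \<open>Markov's inequality for the number of bad vertices: a probability tending to 0 at any
  rate suffices when only a small proportion of bad vertices has to be ensured.\<close>

lemma negligible_many:
  fixes \<beta> :: real
  assumes "0 < \<beta>" "f \<longlonglongrightarrow> 0"
    and "\<forall>\<^sub>F n in sequentially. \<forall>w\<in>vertices n. measure_pmf.prob (random_arcs n (p n)) {X. B n w X} \<le> f n"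
  shows "negligible p (\<lambda>n X. \<beta> * n < card {w \<in> vertices n. B n w X})"
proof (rule negligible_bound)
  show "(\<lambda>n. f n / \<beta>) \<longlonglongrightarrow> 0" using tendsto_divide[OF assms(2) tendsto_const[of \<beta>]] assms(1) by simp
  show "\<forall>\<^sub>F n in sequentially. measure_pmf.prob (random_arcs n (p n)) {X. \<beta> * n < card {w \<in> vertices n. B n w X}} \<le> f n / \<beta>"
    using assms(3) eventually_gt_at_top[of 0]
  proof eventually_elim
    case (elim n)
    let ?M = "random_arcs n (p n)"
    have "measure_pmf.prob ?M {X. \<beta> * n < card {w \<in> vertices n. B n w X}} \<le>
      measure_pmf.expectation ?M (\<lambda>X. \<Sum>w\<in>vertices n. indicator {X. B n w X} X) / (\<beta> * n)"
    proof (rule prob_le_expectation_div)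
      fix X assume "\<beta> * n < card {w \<in> vertices n. B n w X}"
      also have "card {w \<in> vertices n. B n w X} = card (vertices n \<inter> {w. B n w X})"
        by (intro arg_cong[where f = card]) auto
      also have "real \<dots> = (\<Sum>w\<in>vertices n. indicator {X. B n w X} X)"
        by (simp add: indicator_def of_bool_def[symmetric])
      finally show "\<beta> * n \<le> (\<Sum>w\<in>vertices n. indicator {X. B n w X} X)" by simp
    qed (use assms(1) elim in \<open>auto intro!: finite_set_pmf_random_subset finite_arc_pairs sum_nonneg\<close>)
    also have "measure_pmf.expectation ?M (\<lambda>X. \<Sum>w\<in>vertices n. indicator {X. B n w X} X) =
        (\<Sum>w\<in>vertices n. measure_pmf.prob ?M {X. B n w X})"
      by (subst Bochner_Integration.integral_sum) (auto intro!: integrable_random_subset finite_arc_pairs)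
    also have "\<dots> \<le> (\<Sum>w\<in>vertices n. f n)" using elim by (intro sum_mono) auto
    finally have "measure_pmf.prob ?M {X. \<beta> * n < card {w \<in> vertices n. B n w X}} \<le> (\<Sum>w\<in>vertices n. f n) / (\<beta> * n)"
      using assms(1) by (simp add: divide_right_mono)
    thus ?case using elim by simp
  qed
qed

lemma negligible_ex:
  fixes f :: "nat \<Rightarrow> real"
  assumes "(\<lambda>n. n * f n) \<longlonglongrightarrow> 0"
    and "\<forall>\<^sub>F n in sequentially. \<forall>w\<in>vertices n. measure_pmf.prob (random_arcs n (p n)) {X. B n w X} \<le> f n"
  shows "negligible p (\<lambda>n X. \<exists>w\<in>vertices n. B n w X)"
proof (rule negligible_bound[OF _ assms(1)])
  show "\<forall>\<^sub>F n in sequentially. measure_pmf.prob (random_arcs n (p n)) {X. \<exists>w\<in>vertices n. B n w X} \<le> n * f n"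
    using assms(2)
  proof eventually_elim
    case (elim n)
    thus ?case using prob_ex_le[of "vertices n" "random_arcs n (p n)" "B n" "f n"] by simp
  qed
qed

text \<open>Tilting by \<open>s = exp (3 / \<eta>)\<close> turns \<open>\<eta> * (n * p n)\<close>
  hits into the exponent \<open>- 3 * (n * p n)\<close>. A set of at most
  \<open>exp (- 3 / \<eta>) * n\<close> elements gives back no more than \<open>n * p n\<close>, and
  the remaining \<open>exp (- 2 * (n * p n))\<close> beats the union over \<open>n\<close>
  vertices.\<close>

lemma negligible_leave_one_out:
  fixes \<eta> :: real and p :: "nat \<Rightarrow> real" and W :: "nat \<Rightarrow> nat \<Rightarrow> (nat \<times> nat) set \<Rightarrow> (nat \<times> nat) set"
  assumes p: "\<And>n. 0 \<le> p n" "\<And>n. p n \<le> 1" and "0 < \<eta>"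
    and lim: "(\<lambda>n. n * exp (- 2 * (n * p n))) \<longlonglongrightarrow> 0"
    and "\<And>n v. v \<in> vertices n \<Longrightarrow> T n v \<subseteq> arc_pairs (vertices n)"
    and "\<And>n v X. W n v X \<subseteq> T n v" "\<And>n v X. W n v X = W n v (X - T n v)"
  shows "negligible p (\<lambda>n X. \<exists>v\<in>vertices n. real (card (W n v X)) \<le> exp (- 3 / \<eta>) * n \<and>
    \<eta> * (n * p n) \<le> card (W n v X \<inter> X))"
proof (rule negligible_ex[OF lim], intro always_eventually allI ballI)
  fix n v assume v: "v \<in> vertices n"
  have "measure_pmf.prob (random_arcs n (p n)) {X. real (card (W n v X)) \<le> exp (- 3 / \<eta>) * n \<and>
      \<eta> * (n * p n) \<le> card (W n v X \<inter> X)} \<le>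
    exp (- (\<eta> * (n * p n)) * ln (exp (3 / \<eta>)) + (exp (- 3 / \<eta>) * n) * p n * (exp (3 / \<eta>) - 1))"
  proof (rule prob_random_subset_leave_one_out[OF finite_arc_pairs_vertices assms(5)[OF v] p])
    show "W n v X = W n v (X - T n v)" for X by (rule assms(7))
  qed (use assms(3,6) in auto)
  also have "\<dots> \<le> exp (- 2 * (n * p n))"
  proof -
    have "(exp (- 3 / \<eta>) * n) * p n * (exp (3 / \<eta>) - 1) = (exp (- 3 / \<eta>) * exp (3 / \<eta>) - exp (- 3 / \<eta>)) * (n * p n)"
      by (simp add: algebra_simps)
    also have "exp (- 3 / \<eta>) * exp (3 / \<eta>) = 1" by (simp flip: exp_add)
    also have "(1 - exp (- 3 / \<eta>)) * (n * p n) \<le> 1 * (n * p n)"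
      using p by (intro mult_right_mono) auto
    finally have "(exp (- 3 / \<eta>) * n) * p n * (exp (3 / \<eta>) - 1) \<le> n * p n" by simp
    moreover have "- (\<eta> * (n * p n)) * ln (exp (3 / \<eta>)) = - 3 * (n * p n)" using assms(3) by simp
    ultimately show ?thesis by (intro iffD2[OF exp_le_cancel_iff]) linarith
  qed
  finally show "measure_pmf.prob (random_arcs n (p n)) {X. real (card (W n v X)) \<le> exp (- 3 / \<eta>) * n \<and>
      \<eta> * (n * p n) \<le> card (W n v X \<inter> X)} \<le> exp (- 2 * (n * p n))" .
qed

lemma negligible_row_bad:
  fixes \<eta> :: real and p :: "nat \<Rightarrow> real"
  assumes p: "\<And>n. 0 \<le> p n" "\<And>n. p n \<le> 1" and "0 < \<eta>"
    and lim: "(\<lambda>n. n * exp (- 2 * (n * p n))) \<longlonglongrightarrow> 0"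
  shows "negligible p (\<lambda>n X. \<exists>v\<in>vertices n. card (row_bad (vertices n) (t n) \<epsilon> v X) \<le> exp (- 3 / \<eta>) * n \<and>
    \<eta> * (n * p n) \<le> card (row_bad (vertices n) (t n) \<epsilon> v X \<inter> X `` {v}))"
proof -
  define T where "T n v = {v} \<times> (vertices n - {v})" for n v
  \<comment> \<open>Intersecting with \<open>arc_pairs\<close> makes \<open>W\<close> insensitive to
    \<open>T n v\<close> for every \<open>X\<close>, including sets with arcs outside the vertex
    set.\<close>
  define W where "W n v X = {v} \<times> row_bad (vertices n) (t n) \<epsilon> v (X \<inter> arc_pairs (vertices n))" for n v X
  have W_Diff: "W n v X = W n v (X - T n v)" for n v X
  proof -
    have "(X - T n v) \<inter> arc_pairs (vertices n) = (X \<inter> arc_pairs (vertices n)) - {v} \<times> UNIV"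
      by (auto simp: T_def arc_pairs_def)
    thus ?thesis by (simp add: W_def row_bad_Diff)
  qed
  have "negligible p (\<lambda>n X. \<exists>v\<in>vertices n. real (card (W n v X)) \<le> exp (- 3 / \<eta>) * n \<and>
    \<eta> * (n * p n) \<le> card (W n v X \<inter> X))"
    by (rule negligible_leave_one_out[where T = T, OF assms])
       (use W_Diff in \<open>auto simp: T_def W_def arc_pairs_def row_bad_def\<close>)
  thus ?thesis
  proof (rule negligible_mono, intro always_eventually allI impI)
    fix n X assume X: "X \<subseteq> arc_pairs (vertices n)"
      and "\<exists>v\<in>vertices n. card (row_bad (vertices n) (t n) \<epsilon> v X) \<le> exp (- 3 / \<eta>) * n \<and>
        \<eta> * (n * p n) \<le> card (row_bad (vertices n) (t n) \<epsilon> v X \<inter> X `` {v})"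
    then obtain v where v: "v \<in> vertices n" "card (row_bad (vertices n) (t n) \<epsilon> v X) \<le> exp (- 3 / \<eta>) * n"
        "\<eta> * (n * p n) \<le> card (row_bad (vertices n) (t n) \<epsilon> v X \<inter> X `` {v})" by blast
    have W: "W n v X = Pair v ` row_bad (vertices n) (t n) \<epsilon> v X"
      using X by (auto simp: W_def Int_absorb2)
    have "W n v X \<inter> X = Pair v ` (row_bad (vertices n) (t n) \<epsilon> v X \<inter> X `` {v})"
      unfolding W by auto
    hence "card (W n v X \<inter> X) = card (row_bad (vertices n) (t n) \<epsilon> v X \<inter> X `` {v})"
      by (simp add: card_image inj_on_def)
    moreover have "card (W n v X) = card (row_bad (vertices n) (t n) \<epsilon> v X)"
      by (simp add: W card_image inj_on_def)
    ultimately show "\<exists>v\<in>vertices n. real (card (W n v X)) \<le> exp (- 3 / \<eta>) * n \<and> \<eta> * (n * p n) \<le> card (W n v X \<inter> X)"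
      using v by (intro bexI[of _ v]) auto
  qed
qed

lemma negligible_col_bad:
  fixes \<eta> \<eta>' :: real and p :: "nat \<Rightarrow> real"
  assumes p: "\<And>n. 0 \<le> p n" "\<And>n. p n \<le> 1" and "0 < \<eta>"
    and lim: "(\<lambda>n. n * exp (- 2 * (n * p n))) \<longlonglongrightarrow> 0"
  shows "negligible p (\<lambda>n X. \<exists>v\<in>vertices n. card (col_bad (vertices n) (k n) \<eta>' (s n) v X) \<le> exp (- 3 / \<eta>) * n \<and>
    \<eta> * (n * p n) \<le> card (col_bad (vertices n) (k n) \<eta>' (s n) v X \<inter> X\<inverse> `` {v}))"
proof -
  define T where "T n v = (vertices n - {v}) \<times> {v}" for n v
  define W where "W n v X = col_bad (vertices n) (k n) \<eta>' (s n) v (X \<inter> arc_pairs (vertices n)) \<times> {v}" for n v X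
  have W_Diff: "W n v X = W n v (X - T n v)" for n v X
  proof -
    have "(X - T n v) \<inter> arc_pairs (vertices n) = (X \<inter> arc_pairs (vertices n)) - UNIV \<times> {v}"
      by (auto simp: T_def arc_pairs_def)
    thus ?thesis by (simp add: W_def col_bad_Diff)
  qed
  have "negligible p (\<lambda>n X. \<exists>v\<in>vertices n. real (card (W n v X)) \<le> exp (- 3 / \<eta>) * n \<and>
    \<eta> * (n * p n) \<le> card (W n v X \<inter> X))"
    by (rule negligible_leave_one_out[where T = T, OF assms])
       (use W_Diff in \<open>auto simp: T_def W_def arc_pairs_def col_bad_def\<close>)
  thus ?thesis
  proof (rule negligible_mono, intro always_eventually allI impI)
    fix n X assume X: "X \<subseteq> arc_pairs (vertices n)"
      and "\<exists>v\<in>vertices n. card (col_bad (vertices n) (k n) \<eta>' (s n) v X) \<le> exp (- 3 / \<eta>) * n \<and>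
        \<eta> * (n * p n) \<le> card (col_bad (vertices n) (k n) \<eta>' (s n) v X \<inter> X\<inverse> `` {v})"
    then obtain v where v: "v \<in> vertices n" "card (col_bad (vertices n) (k n) \<eta>' (s n) v X) \<le> exp (- 3 / \<eta>) * n"
        "\<eta> * (n * p n) \<le> card (col_bad (vertices n) (k n) \<eta>' (s n) v X \<inter> X\<inverse> `` {v})" by blast
    have W: "W n v X = (\<lambda>w. (w, v)) ` col_bad (vertices n) (k n) \<eta>' (s n) v X"
      using X by (auto simp: W_def Int_absorb2)
    have "W n v X \<inter> X = (\<lambda>w. (w, v)) ` (col_bad (vertices n) (k n) \<eta>' (s n) v X \<inter> X\<inverse> `` {v})"
      unfolding W by auto
    hence "card (W n v X \<inter> X) = card (col_bad (vertices n) (k n) \<eta>' (s n) v X \<inter> X\<inverse> `` {v})"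
      by (simp add: card_image inj_on_def)
    moreover have "card (W n v X) = card (col_bad (vertices n) (k n) \<eta>' (s n) v X)"
      by (simp add: W card_image inj_on_def)
    ultimately show "\<exists>v\<in>vertices n. real (card (W n v X)) \<le> exp (- 3 / \<eta>) * n \<and> \<eta> * (n * p n) \<le> card (W n v X \<inter> X)"
      using v by (intro bexI[of _ v]) auto
  qed
qed

lemma negligible_atypical_outdeg:
  fixes \<eta> \<beta> :: real and p :: "nat \<Rightarrow> real"
  assumes p: "\<And>n. 0 \<le> p n" "\<And>n. p n \<le> 1" and "0 < \<eta>" "\<eta> \<le> 1" "0 < \<beta>"
    and lim: "filterlim (\<lambda>n. n * p n) at_top sequentially"
  shows "negligible p (\<lambda>n X. \<beta> * n < card {w \<in> vertices n. \<eta> * (n * p n) - 1 < \<bar>real (card (X `` {w})) - n * p n\<bar>})"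
proof -
  \<comment> \<open>Half of the margin \<eta> is kept in reserve: it absorbs the \<open>- 1\<close>
    as soon as \<open>a * (n * p n) \<ge> 1\<close>.\<close>
  define a where "a = \<eta> / 2"
  have a: "0 < a" "a < 1" using assms by (auto simp: a_def)
  \<comment> \<open>These are the large deviation rates of the two tails for the tilts
    \<open>1 + a\<close> and \<open>1 - a\<close>. They are positive by the strict inequality
    \<open>1 - 1 / y < ln y\<close>.\<close>
  define r1 where "r1 = (1 + a) * ln (1 + a) - a"
  define r2 where "r2 = (1 - a) * ln (1 - a) + a"
  have ln_gt: "1 - 1 / y < ln y" if "0 < y" "y \<noteq> 1" for y :: real
  proof -
    have "ln (1 / y) < 1 / y - 1" using ln_le_minus_one[of "1 / y"] ln_eq_minus_one[of "1 / y"] that by fastforce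
    thus ?thesis using that by (simp add: ln_div)
  qed
  have r1: "0 < r1"
  proof -
    have "a = (1 + a) * (1 - 1 / (1 + a))" using a by (simp add: field_simps)
    also have "\<dots> < (1 + a) * ln (1 + a)" using a ln_gt[of "1 + a"] by (intro mult_strict_left_mono) auto
    finally show ?thesis by (simp add: r1_def)
  qed
  have r2: "0 < r2"
  proof -
    have "- a = (1 - a) * (1 - 1 / (1 - a))" using a by (simp add: field_simps)
    also have "\<dots> < (1 - a) * ln (1 - a)" using a ln_gt[of "1 - a"] by (intro mult_strict_left_mono) auto
    finally show ?thesis by (simp add: r2_def)
  qed
  have lim0: "(\<lambda>n. exp (c - r * (n * p n))) \<longlonglongrightarrow> 0" if "0 < r" for r c :: real
  proof -
    have "((\<lambda>x. exp (c - r * x)) \<longlongrightarrow> 0) at_top" using that by real_asymp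
    thus ?thesis using lim by (rule filterlim_compose)
  qed
  show ?thesis
  proof (rule negligible_many[OF assms(5)])
    show "(\<lambda>n. exp (0 - r1 * (n * p n)) + exp (1 - r2 * (n * p n))) \<longlonglongrightarrow> 0"
      using tendsto_add[OF lim0[OF r1, of 0] lim0[OF r2, of 1]] by simp
    have "\<forall>\<^sub>F n in sequentially. 1 / a \<le> n * p n"
      using lim by (simp add: filterlim_at_top)
    thus "\<forall>\<^sub>F n in sequentially. \<forall>w\<in>vertices n. measure_pmf.prob (random_arcs n (p n))
        {X. \<eta> * (n * p n) - 1 < \<bar>real (card (X `` {w})) - n * p n\<bar>} \<le>
        exp (0 - r1 * (n * p n)) + exp (1 - r2 * (n * p n))"
    proof (eventually_elim, intro ballI)
      fix n w assume n: "1 / a \<le> n * p n" and w: "w \<in> vertices n"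
      let ?x = "real n * p n" and ?M = "random_arcs n (p n)"
      have "1 \<le> a * ?x" using n a by (simp add: field_simps)
      hence x: "a * ?x \<le> \<eta> * ?x - 1" by (simp add: a_def)
      have "measure_pmf.prob ?M {X. \<eta> * (n * p n) - 1 < \<bar>real (card (X `` {w})) - n * p n\<bar>} \<le>
          measure_pmf.prob ?M ({X. (1 + a) * ?x \<le> card (X `` {w})} \<union> {X. card (X `` {w}) \<le> (1 - a) * ?x})"
        using x by (intro measure_pmf.finite_measure_mono) (auto simp: algebra_simps)
      also have "\<dots> \<le> measure_pmf.prob ?M {X. (1 + a) * ?x \<le> card (X `` {w})} +
          measure_pmf.prob ?M {X. card (X `` {w}) \<le> (1 - a) * ?x}"
        by (rule measure_Un_le) auto
      also have "\<dots> \<le> exp (- ((1 + a) * ?x) * ln (1 + a) + ?x * ((1 + a) - 1)) +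
          exp (1 - ((1 - a) * ?x) * ln (1 - a) - ?x * (1 - (1 - a)))"
        using a p w by (intro add_mono prob_outdeg_ge prob_outdeg_le) auto
      also have "\<dots> = exp (0 - r1 * (n * p n)) + exp (1 - r2 * (n * p n))"
        by (simp add: r1_def r2_def algebra_simps)
      finally show "measure_pmf.prob ?M {X. \<eta> * (n * p n) - 1 < \<bar>real (card (X `` {w})) - n * p n\<bar>} \<le>
        exp (0 - r1 * (n * p n)) + exp (1 - r2 * (n * p n))" .
    qed
  qed
qed

text \<open>With tilt \<open>s\<close>, a degree at most \<open>c * x\<close> has Chernoff exponent
  \<open>x * (1 - s + c * ln s)\<close>, where \<open>x = (1 + \<delta>) * ln n\<close>. The losses
  \<open>s\<close> and \<open>- c * ln s\<close> are both set to
  \<open>\<delta> / (4 * (1 + \<delta>))\<close>; what is left still exceeds \<open>ln n\<close> by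
  the factor \<open>1 + \<delta> / 2\<close>, enough for a union bound over vertices.\<close>

lemma low_degree_constants:
  fixes \<delta> :: real
  assumes "0 < \<delta>"
  obtains c s :: real where "0 < c" "0 < s" "s \<le> 1" "(1 + \<delta>) * (1 - s + c * ln s) = 1 + \<delta> / 2"
proof -
  define s where "s = \<delta> / (4 * (1 + \<delta>))"
  have s: "0 < s" "s < 1" using assms by (auto simp: s_def field_simps)
  define c where "c = \<delta> / (4 * (1 + \<delta>)) / (- ln s)"
  have "0 < - ln s" using s by simp
  hence c: "0 < c" unfolding c_def using assms by (intro divide_pos_pos) auto
  have "c * ln s = - (\<delta> / (4 * (1 + \<delta>)))" using s by (simp add: c_def)
  hence "(1 + \<delta>) * (1 - s + c * ln s) = (1 + \<delta>) * (1 - 2 * (\<delta> / (4 * (1 + \<delta>))))"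
    by (simp add: s_def)
  also have "\<dots> = 1 + \<delta> / 2" using assms by (simp add: field_simps)
  finally show ?thesis using that[of c s] c s by simp
qed

section \<open>The supercritical regime\<close>

locale supercritical =
  fixes p :: "nat \<Rightarrow> real" and \<delta> c s :: real
  assumes p: "\<And>n. 0 \<le> p n" "\<And>n. p n \<le> 1" and \<delta>: "0 < \<delta>"
    and np: "\<forall>\<^sub>F n in sequentially. real n * p n = (1 + \<delta>) * ln (real n)"
    and c: "0 < c" and s: "0 < s" "s \<le> 1" and c_s: "(1 + \<delta>) * (1 - s + c * ln s) = 1 + \<delta> / 2"
begin

abbreviation x :: "nat \<Rightarrow> real" where "x n \<equiv> real n * p n"

text \<open>Just long enough that \<open>(c * x n) ^ t n \<ge> n\<^sup>2\<close>, so that coinciding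
  paths contribute at most \<open>1 / n\<close> to the second moment. It is still of smaller order
  than \<open>x n\<close>, because \<open>ln (c * x n)\<close> tends to infinity.\<close>

definition t :: "nat \<Rightarrow> nat" where "t n = nat \<lceil>2 * ln n / ln (c * x n)\<rceil>"

lemma x_at_top: "filterlim x at_top sequentially"
proof -
  have "filterlim (\<lambda>n::nat. (1 + \<delta>) * ln (real n)) at_top sequentially"
    using \<delta> by real_asymp
  thus ?thesis
    by (rule filterlim_mono_eventually[OF _ order.refl order.refl]) (use np in eventually_elim, simp)
qed

lemma eventually_x_ge: "\<forall>\<^sub>F n in sequentially. b \<le> x n"
  using x_at_top by (simp add: filterlim_at_top)

lemma lim_exp_x: "(\<lambda>n. n * exp (- 2 * x n)) \<longlonglongrightarrow> 0"
proof -
  have "0 < 1 + 2 * \<delta>" using \<delta> by simp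
  hence "(\<lambda>n. exp (- (1 + 2 * \<delta>) * ln (real n))) \<longlonglongrightarrow> 0" by real_asymp
  thus ?thesis
  proof (rule Lim_transform_eventually)
    show "\<forall>\<^sub>F n in sequentially. exp (- (1 + 2 * \<delta>) * ln (real n)) = n * exp (- 2 * x n)"
      using np eventually_ge_at_top[of 1]
    proof eventually_elim
      case (elim n)
      have "real n * exp (- 2 * x n) = exp (ln n + (- 2 * x n))"
        using elim(2) by (simp only: exp_add) simp
      also have "ln n + (- 2 * x n) = - (1 + 2 * \<delta>) * ln (real n)"
        unfolding elim(1) by (simp add: algebra_simps)
      finally show ?case by simp
    qed
  qed
qed

lemma low_degree:
  "\<forall>\<^sub>F n in sequentially. \<forall>a\<in>vertices n.
    measure_pmf.prob (random_arcs n (p n)) {X. card (X `` {a}) \<le> c * x n} \<le> exp (1 - (1 + \<delta> / 2) * ln n) \<and>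
    measure_pmf.prob (random_arcs n (p n)) {X. card (X\<inverse> `` {a}) \<le> c * x n} \<le> exp (1 - (1 + \<delta> / 2) * ln n)"
  using np
proof eventually_elim
  case (elim n)
  have "(c * x n) * ln s + x n * (1 - s) = ln n * ((1 + \<delta>) * (1 - s + c * ln s))"
    unfolding elim by (simp add: algebra_simps)
  hence eq: "1 - c * x n * ln s - x n * (1 - s) = 1 - (1 + \<delta> / 2) * ln n"
    unfolding c_s by (simp add: algebra_simps)
  show ?case
  proof (intro ballI)
    fix a assume a: "a \<in> vertices n"
    show "measure_pmf.prob (random_arcs n (p n)) {X. card (X `` {a}) \<le> c * x n} \<le> exp (1 - (1 + \<delta> / 2) * ln n) \<and>
      measure_pmf.prob (random_arcs n (p n)) {X. card (X\<inverse> `` {a}) \<le> c * x n} \<le> exp (1 - (1 + \<delta> / 2) * ln n)"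
      using prob_outdeg_le[OF p(1)[of n] p(2)[of n] s a, of "c * x n"]
        prob_indeg_le[OF p(1)[of n] p(2)[of n] s a, of "c * x n"]
      unfolding eq by blast
  qed
qed

lemma lim_low_degree: "(\<lambda>n. n * exp (1 - (1 + \<delta> / 2) * ln n)) \<longlonglongrightarrow> 0"
  using \<delta> by real_asymp

lemma negligible_low_outdeg: "negligible p (\<lambda>n X. \<exists>a\<in>vertices n. card (X `` {a}) \<le> c * x n)"
  by (rule negligible_ex[OF lim_low_degree]) (use low_degree in eventually_elim, blast)

lemma negligible_low_indeg: "negligible p (\<lambda>n X. \<exists>a\<in>vertices n. card (X\<inverse> `` {a}) \<le> c * x n)"
  by (rule negligible_ex[OF lim_low_degree]) (use low_degree in eventually_elim, blast)

lemma negligible_large_indeg: "negligible p (\<lambda>n X. \<exists>a\<in>vertices n. 4 * x n < card (X\<inverse> `` {a}))"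
  by (rule negligible_bound[OF always_eventually lim_exp_x]) (use prob_indeg_large p in blast)

lemma t_le: "\<forall>\<^sub>F n in sequentially. t n \<le> 2 * ln n / ln (c * ((1 + \<delta>) * ln n)) + 1 \<and> t n \<le> 2 * ln n + 1"
  using np eventually_x_ge[of "exp 1 / c"] eventually_ge_at_top[of 1]
proof eventually_elim
  case (elim n)
  have cx: "exp 1 \<le> c * x n" using elim(2) c by (simp add: field_simps)
  hence ln1: "1 \<le> ln (c * x n)" using c
    by (metis exp_gt_zero less_le_trans ln_exp ln_mono)
  have L: "0 \<le> ln (real n)" using elim(3) by simp
  have "t n \<le> 2 * ln n / ln (c * x n) + 1"
    unfolding t_def using L ln1 by (simp add: of_nat_ceiling)
  moreover have "2 * ln n / ln (c * x n) \<le> 2 * ln n / 1"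
    using L ln1 by (intro divide_left_mono) auto
  ultimately show ?case using elim(1) by simp
qed

lemma t_div_x: "(\<lambda>n. t n / x n) \<longlonglongrightarrow> 0"
proof (rule tendsto_sandwich[where f = "\<lambda>_. 0"])
  show "(\<lambda>n. (2 * ln n / ln (c * ((1 + \<delta>) * ln n)) + 1) / ((1 + \<delta>) * ln n)) \<longlonglongrightarrow> 0"
    using \<delta> c by real_asymp
  show "\<forall>\<^sub>F n in sequentially. t n / x n \<le> (2 * ln n / ln (c * ((1 + \<delta>) * ln n)) + 1) / ((1 + \<delta>) * ln n)"
    using t_le np eventually_x_ge[of 1]
    by eventually_elim (auto intro!: divide_right_mono)
  show "\<forall>\<^sub>F n in sequentially. 0 \<le> t n / x n"
    using p by (intro always_eventually) auto
qed simp

lemma t_sq_div: "(\<lambda>n. (real (t n))\<^sup>2 / n) \<longlonglongrightarrow> 0"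
proof (rule tendsto_sandwich[where f = "\<lambda>_. 0"])
  show "(\<lambda>n. (2 * ln (real n) + 1)\<^sup>2 / n) \<longlonglongrightarrow> 0" by real_asymp
  show "\<forall>\<^sub>F n in sequentially. (real (t n))\<^sup>2 / n \<le> (2 * ln (real n) + 1)\<^sup>2 / n"
    using t_le by eventually_elim (auto intro!: divide_right_mono power_mono)
qed auto

lemma t_div: "(\<lambda>n. real (t n) * (2 / real (n - 2))) \<longlonglongrightarrow> 0"
proof (rule tendsto_sandwich[where f = "\<lambda>_. 0"])
  show "(\<lambda>n. (2 * ln (real n) + 1) * (2 / (real n - 2))) \<longlonglongrightarrow> 0" by real_asymp
  show "\<forall>\<^sub>F n in sequentially. real (t n) * (2 / real (n - 2)) \<le> (2 * ln (real n) + 1) * (2 / (real n - 2))"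
    using t_le eventually_ge_at_top[of 3]
  proof eventually_elim
    case (elim n)
    have "real (n - 2) = real n - 2" using elim(2) by (simp add: of_nat_diff)
    thus ?case using elim by (simp only:) (intro mult_right_mono, auto)
  qed
qed auto

lemma t_less: "\<forall>\<^sub>F n in sequentially. t n < n"
proof -
  have "\<forall>\<^sub>F n in sequentially. (real (t n))\<^sup>2 / n < 1"
    using t_sq_div by (rule order_tendstoD) simp
  thus ?thesis using eventually_gt_at_top[of 0]
  proof eventually_elim
    case (elim n)
    hence "real (t n * t n) < real n" by (simp add: power2_eq_square field_simps)
    hence "t n * t n < n" by (simp only: of_nat_less_iff)
    thus ?case by (metis le_square le_less_trans)
  qed
qed

text \<open>This bounds the numerator in \<open>prob_deficit_gt_le\<close> for
  \<open>k = c * x n\<close>: \<open>n\<close> times the second moment, minus twice the expected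
  mass on simple paths, plus 1. In the limit these terms give \<open>1 - 2 + 1\<close>.\<close>

definition \<tau> :: "nat \<Rightarrow> real" where
  "\<tau> n = real n / real (n - 2) * exp (real (t n) * (2 / real (n - 2)) + real (t n) / x n / c) / (1 - 1 / (c * x n))
    + 1 / n - 2 * (1 - (real (t n))\<^sup>2 / n) + 1"

lemma \<tau>_tendsto: "\<tau> \<longlonglongrightarrow> 0"
proof -
  have 1: "(\<lambda>n. real n / real (n - 2)) \<longlonglongrightarrow> 1" by real_asymp
  have 2: "(\<lambda>n. 1 / (c * x n)) \<longlonglongrightarrow> 0"
  proof -
    have "((\<lambda>y. 1 / (c * y)) \<longlongrightarrow> 0) at_top" using c by real_asymp
    thus ?thesis using x_at_top by (rule filterlim_compose)
  qed
  have 3: "(\<lambda>n. 1 / real n) \<longlonglongrightarrow> 0" by real_asymp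
  have "\<tau> \<longlonglongrightarrow> 1 * exp (0 + 0 / c) / (1 - 0) + 0 - 2 * (1 - 0) + 1"
    unfolding \<tau>_def[abs_def] using c
    by (intro tendsto_intros 1 2 3 t_div t_div_x t_sq_div) auto
  thus ?thesis by simp
qed

lemma prob_unmixed_le:
  fixes \<epsilon> :: real
  assumes "0 < \<epsilon>"
  shows "\<forall>\<^sub>F n in sequentially. \<forall>y\<in>vertices n. measure_pmf.prob (random_arcs n (p n))
    {X. \<epsilon> < deficit (vertices n) ((act (vertices n) (walk_kernel (c * x n) X) ^^ t n) (dirac y))} \<le> \<tau> n / \<epsilon>\<^sup>2"
proof -
  have "\<forall>\<^sub>F n in sequentially. n * exp (1 - (1 + \<delta> / 2) * ln n) < 1"
    using lim_low_degree by (rule order_tendstoD) simp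
  thus ?thesis
    using eventually_x_ge[of "2 / c"] eventually_ge_at_top[of 3] t_less low_degree
  proof (eventually_elim, intro ballI)
    fix n y
    assume q: "n * exp (1 - (1 + \<delta> / 2) * ln n) < 1" and cx: "2 / c \<le> x n" and n: "3 \<le> n" and tn: "t n < n"
      and low: "\<forall>a\<in>vertices n.
        measure_pmf.prob (random_arcs n (p n)) {X. card (X `` {a}) \<le> c * x n} \<le> exp (1 - (1 + \<delta> / 2) * ln n) \<and>
        measure_pmf.prob (random_arcs n (p n)) {X. card (X\<inverse> `` {a}) \<le> c * x n} \<le> exp (1 - (1 + \<delta> / 2) * ln n)"
      and y: "y \<in> vertices n"
    define k where "k = c * x n"
    define N where "N = real (n - 2)"
    \<comment> \<open>A low out-degree has probability at most \<open>1 / n\<close> here. This value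
      also makes \<open>q0 * (n - t n) / (n - 1)\<close> exactly \<open>1 - t n / n\<close>, ready
      for Bernoulli's inequality.\<close>
    define q0 where "q0 = 1 - 1 / real n"
    have k: "2 \<le> k" using cx c by (simp add: k_def field_simps)
    have N: "0 < N" "real n = N + 2" using n by (auto simp: N_def)
    have q0: "q0 \<le> measure_pmf.prob (random_arcs n (p n)) {X. k \<le> real (card (X `` {a}))}" if a: "a \<in> vertices n" for a
    proof -
      let ?M = "random_arcs n (p n)"
      have "exp (1 - (1 + \<delta> / 2) * ln n) \<le> 1 / n" using q n by (simp add: field_simps)
      hence "measure_pmf.prob ?M {X. card (X `` {a}) \<le> k} \<le> 1 / n"
        using low a unfolding k_def by (meson order.trans)
      moreover have "measure_pmf.prob ?M (UNIV - {X. card (X `` {a}) \<le> k}) = 1 - measure_pmf.prob ?M {X. card (X `` {a}) \<le> k}"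
        using measure_pmf.prob_compl[of "{X. card (X `` {a}) \<le> k}" ?M] by simp
      moreover have "measure_pmf.prob ?M (UNIV - {X. card (X `` {a}) \<le> k}) \<le> measure_pmf.prob ?M {X. k \<le> real (card (X `` {a}))}"
        by (intro measure_pmf.finite_measure_mono) auto
      ultimately show ?thesis by (simp add: q0_def)
    qed
    have "measure_pmf.prob (random_arcs n (p n)) {X. \<epsilon> < deficit (vertices n) ((act (vertices n) (walk_kernel k X) ^^ t n) (dirac y))} \<le>
      (n * (1 / N * (n * (1 / N) + 1 / k) ^ t n / (1 - 1 / k) + (1 / k) ^ t n)
      - 2 * (q0 * real (n - t n) / real (n - 1)) ^ t n + 1) / \<epsilon>\<^sup>2"
      using prob_deficit_gt_le[of "vertices n" y k "t n" \<epsilon> q0 "p n"] n y k tn assms q0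
      by (simp add: N_def q0_def)
    also have "\<dots> \<le> \<tau> n / \<epsilon>\<^sup>2"
    proof (rule divide_right_mono)
      have "(n * (1 / N) + 1 / k) ^ t n \<le> exp (2 / N + 1 / k) ^ t n"
      proof (rule power_mono)
        have "n * (1 / N) = 1 + 2 / N" using N by (simp add: field_simps)
        thus "n * (1 / N) + 1 / k \<le> exp (2 / N + 1 / k)"
          using exp_ge_add_one_self[of "2 / N + 1 / k"] by linarith
      qed (use N k in auto)
      also have "\<dots> = exp (real (t n) * (2 / N) + real (t n) / x n / c)"
        by (simp add: exp_of_nat_mult[symmetric] k_def algebra_simps)
      finally have A: "n / N * (n * (1 / N) + 1 / k) ^ t n / (1 - 1 / k) \<le>
          n / N * exp (real (t n) * (2 / N) + real (t n) / x n / c) / (1 - 1 / k)"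
        using N k by (intro divide_right_mono mult_left_mono) auto
      have "n * (1 / k) ^ t n \<le> n * (1 / (real n * real n))"
      proof (rule mult_left_mono)
        have lnk: "0 < ln k" using k by simp
        have "2 * ln n / ln k \<le> t n" unfolding t_def k_def by linarith
        hence "2 * ln n \<le> t n * ln k" using lnk by (simp add: field_simps)
        hence "exp (- (t n * ln k)) \<le> exp (- (ln n + ln n))" by simp
        also have "exp (- (t n * ln k)) = (1 / k) ^ t n"
          using k by (simp add: exp_minus exp_of_nat_mult power_divide inverse_eq_divide)
        also have "exp (- (ln n + ln n)) = inverse (exp (ln n) * exp (ln n))"
          by (simp only: exp_minus exp_add)
        also have "\<dots> = 1 / (real n * real n)" using n by (simp add: inverse_eq_divide)
        finally show "(1 / k) ^ t n \<le> 1 / (real n * real n)" .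
      qed simp
      also have "n * (1 / (real n * real n)) = 1 / n" using n by simp
      finally have B: "n * (1 / k) ^ t n \<le> 1 / n" .
      have "q0 * real (n - t n) / real (n - 1) = 1 + (- (t n / n))"
        using n tn by (simp add: q0_def field_simps of_nat_diff)
      moreover have "1 + real (t n) * (- (t n / n)) \<le> (1 + (- (t n / n))) ^ t n"
        using tn n by (intro Bernoulli_inequality) auto
      ultimately have C: "1 - (real (t n))\<^sup>2 / n \<le> (q0 * real (n - t n) / real (n - 1)) ^ t n"
        by (simp add: power2_eq_square)
      have gen: "a + b - 2 * v + 1 \<le> a' + b' - 2 * u + 1" if "a \<le> a'" "b \<le> b'" "u \<le> v" for a a' b b' u v :: real
        using that by linarith
      have "n * (1 / N * (n * (1 / N) + 1 / k) ^ t n / (1 - 1 / k) + (1 / k) ^ t n) =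
        n / N * (n * (1 / N) + 1 / k) ^ t n / (1 - 1 / k) + n * (1 / k) ^ t n"
        by (simp add: distrib_left)
      thus "n * (1 / N * (n * (1 / N) + 1 / k) ^ t n / (1 - 1 / k) + (1 / k) ^ t n)
          - 2 * (q0 * real (n - t n) / real (n - 1)) ^ t n + 1 \<le> \<tau> n"
        unfolding \<tau>_def k_def[symmetric] N_def[symmetric] using gen[OF A B C] by (simp only:)
    qed simp
    finally show "measure_pmf.prob (random_arcs n (p n))
      {X. \<epsilon> < deficit (vertices n) ((act (vertices n) (walk_kernel (c * x n) X) ^^ t n) (dirac y))} \<le> \<tau> n / \<epsilon>\<^sup>2"
      by (simp only: k_def)
  qed
qed

text \<open>If no out-degree is low, the cut-off kernel agrees with the walk, so the moment
  estimates apply to the walk outside a negligible event.\<close>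

lemma negligible_unmixed:
  fixes \<epsilon> \<beta> :: real
  assumes "0 < \<epsilon>" "0 < \<beta>"
  shows "negligible p (\<lambda>n X. \<beta> * n < card {y \<in> vertices n.
    \<epsilon> < deficit (vertices n) ((act (vertices n) (rw X) ^^ t n) (dirac y))})"
proof -
  have "(\<lambda>n. \<tau> n / \<epsilon>\<^sup>2) \<longlonglongrightarrow> 0"
    using tendsto_divide[OF \<tau>_tendsto tendsto_const[of "\<epsilon>\<^sup>2"]] assms(1) by simp
  hence "negligible p (\<lambda>n X. \<beta> * n < card {y \<in> vertices n.
    \<epsilon> < deficit (vertices n) ((act (vertices n) (walk_kernel (c * x n) X) ^^ t n) (dirac y))})"
    by (rule negligible_many[OF assms(2) _ prob_unmixed_le[OF assms(1)]])
  from negligible_disj[OF negligible_low_outdeg this] show ?thesis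
  proof (rule negligible_mono, intro always_eventually allI impI)
    fix n X
    let ?V = "vertices n"
    assume *: "\<beta> * n < card {y \<in> ?V. \<epsilon> < deficit ?V ((act ?V (rw X) ^^ t n) (dirac y))}"
    show "(\<exists>a\<in>?V. card (X `` {a}) \<le> c * x n) \<or>
      \<beta> * n < card {y \<in> ?V. \<epsilon> < deficit ?V ((act ?V (walk_kernel (c * x n) X) ^^ t n) (dirac y))}"
    proof (cases "\<exists>a\<in>?V. card (X `` {a}) \<le> c * x n")
      case False
      have eq: "deficit ?V ((act ?V (rw X) ^^ t n) (dirac y)) = deficit ?V ((act ?V (walk_kernel (c * x n) X) ^^ t n) (dirac y))"
        for y
        unfolding deficit_def
      proof (intro sum.cong refl)
        fix v assume v: "v \<in> ?V"
        have "(act ?V (rw X) ^^ t n) (dirac y) v = (act ?V (walk_kernel (c * x n) X) ^^ t n) (dirac y) v"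
        proof (rule funpow_act_cong[OF _ _ v])
          fix a b assume "a \<in> ?V"
          hence "c * x n \<le> card (X `` {a})" using False by (meson linear)
          thus "rw X a b = walk_kernel (c * x n) X a b" by (simp add: walk_kernel_def)
        qed simp
        thus "max 0 (1 / card ?V - (act ?V (rw X) ^^ t n) (dirac y) v) =
          max 0 (1 / card ?V - (act ?V (walk_kernel (c * x n) X) ^^ t n) (dirac y) v)" by simp
      qed
      show ?thesis using * unfolding eq by blast
    qed blast
  qed
qed

section \<open>Minimum out-degree and stationary distribution\<close>

lemma min_outdeg_whp: "with_high_probability p (\<lambda>n D. c * ln n \<le> real (min_outdeg D))"
proof (rule with_high_probability_if_negligible, rule negligible_mono[OF negligible_low_outdeg])
  show "\<forall>\<^sub>F n in sequentially. \<forall>X\<subseteq>arc_pairs (vertices n).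
     \<not> c * ln n \<le> real (min_outdeg \<lparr>pverts = vertices n, parcs = X\<rparr>) \<longrightarrow> (\<exists>a\<in>vertices n. card (X `` {a}) \<le> c * x n)"
    using np eventually_ge_at_top[of 1]
  proof (eventually_elim, intro allI impI)
    fix n X
    assume n: "x n = (1 + \<delta>) * ln n" "1 \<le> n"
      and bad: "\<not> c * ln n \<le> real (min_outdeg \<lparr>pverts = vertices n, parcs = X\<rparr>)"
    have "min_outdeg \<lparr>pverts = vertices n, parcs = X\<rparr> \<in> outdeg \<lparr>pverts = vertices n, parcs = X\<rparr> ` vertices n"
      unfolding min_outdeg_def using n by (auto intro!: Min_in)
    then obtain a where a: "a \<in> vertices n" "min_outdeg \<lparr>pverts = vertices n, parcs = X\<rparr> = card (X `` {a})"
      by (auto simp: outdeg_eq)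
    have "1 * ln n \<le> (1 + \<delta>) * ln n" using \<delta> n by (intro mult_right_mono) auto
    hence "c * ln n \<le> c * x n" unfolding n(1) using c by (intro mult_left_mono) auto
    hence "card (X `` {a}) \<le> c * x n" using bad a(2) by linarith
    thus "\<exists>a\<in>vertices n. card (X `` {a}) \<le> c * x n" using a(1) by blast
  qed
qed

end

context supercritical
begin

text \<open>The deterministic core. The bound on unmixed vertices activates \<open>row\<close>,
  which yields mixing from every vertex in \<open>Suc (t n)\<close> steps; mixing and
  \<open>atypical\<close> in turn bound the size of \<open>col_bad\<close>, which activates
  \<open>col\<close> and hence \<open>stationary_asymptotic\<close>.\<close>

lemma stationary_if_typical:
  fixes \<eta> \<kappa> e K \<epsilon>0 \<beta>r :: real
  defines "K \<equiv> (4 * 4 + 1) / c + 1" and "e \<equiv> K * \<eta> * (2 * 4 + 2) / c"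
  assumes n: "0 < n" and X: "X \<subseteq> arc_pairs (vertices n)"
    and \<eta>: "0 < \<eta>" "K * \<eta> \<le> 1 / 2" and kap: "0 < \<kappa>" "\<kappa> \<le> 1 / 8" "\<kappa> \<le> \<eta> * exp (- 3 / \<eta>) / 8"
    and large: "2 \<le> c * x n" "t n / (c * x n) \<le> \<kappa> / 4" "Suc (t n) / (c * x n) \<le> \<kappa>"
      "5 * Suc (t n) / (c * x n - 1) \<le> \<eta>" "1 \<le> \<eta> * x n" "(1 + e) / n \<le> \<epsilon>0 / 2" "e \<le> \<epsilon>0 / 2"
    and J: "J = nat \<lceil>2 * real n / \<eta>\<rceil>"
    and outdeg: "\<not> (\<exists>a\<in>vertices n. card (X `` {a}) \<le> c * x n)"
    and indeg: "\<not> (\<exists>a\<in>vertices n. card (X\<inverse> `` {a}) \<le> c * x n)"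
      "\<not> (\<exists>a\<in>vertices n. 4 * x n < card (X\<inverse> `` {a}))"
    and unmixed: "\<not> \<beta>r * n < card {y \<in> vertices n.
      \<kappa> / 4 < deficit (vertices n) ((act (vertices n) (rw X) ^^ t n) (dirac y))}"
    and row: "\<not> (\<exists>v\<in>vertices n. card (row_bad (vertices n) (t n) (\<kappa> / 4) v X) \<le> \<beta>r * n \<and>
      \<kappa> / 2 * c * x n \<le> card (row_bad (vertices n) (t n) (\<kappa> / 4) v X \<inter> X `` {v}))"
    and atypical: "\<not> exp (- 3 / \<eta>) / 2 * n < card {w \<in> vertices n. \<eta> * x n - 1 < \<bar>real (card (X `` {w})) - x n\<bar>}"
    and col: "\<not> (\<exists>v\<in>vertices n. card (col_bad (vertices n) (J * Suc (t n)) \<eta> (x n) v X) \<le> exp (- 3 / \<eta>) * n \<and>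
      \<eta> * x n \<le> card (col_bad (vertices n) (J * Suc (t n)) \<eta> (x n) v X \<inter> X\<inverse> `` {v}))"
  shows "(\<exists>!\<pi>. is_stationary \<lparr>pverts = vertices n, parcs = X\<rparr> \<pi>) \<and>
    (\<forall>\<pi>. is_stationary \<lparr>pverts = vertices n, parcs = X\<rparr> \<pi> \<longrightarrow> (\<forall>v \<in> vertices n.
      \<bar>pmf \<pi> v * (real n * (real n - 1) * p n) / real (indeg \<lparr>pverts = vertices n, parcs = X\<rparr> v) - 1\<bar> \<le> \<epsilon>0))"
proof -
  let ?V = "vertices n" and ?D = "\<lparr>pverts = vertices n, parcs = X\<rparr>"
  have V: "finite ?V" "?V \<noteq> {}" "card ?V = n" using n by auto
  have out: "c * x n \<le> card (X `` {a})" if "a \<in> ?V" for a using outdeg that by force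
  have in1: "c * x n \<le> card (X\<inverse> `` {a})" if "a \<in> ?V" for a using indeg(1) that by force
  have in2: "card (X\<inverse> `` {a}) \<le> 4 * x n" if "a \<in> ?V" for a using indeg(2) that by force
  have outpos: "0 < card (X `` {a})" if "a \<in> ?V" for a using out[OF that] large(1) by linarith
  have mixing: "deficit ?V ((act ?V (rw X) ^^ Suc (t n)) (dirac y)) \<le> \<kappa>" if y: "y \<in> ?V" for y
  proof -
    have "card (row_bad ?V (t n) (\<kappa> / 4) y X) \<le> card {y \<in> ?V. \<kappa> / 4 < deficit ?V ((act ?V (rw X) ^^ t n) (dirac y))}"
      using large by (intro card_mono row_bad_subset[OF V(1) X out]) auto
    hence "card (row_bad ?V (t n) (\<kappa> / 4) y X) \<le> \<beta>r * n" using unmixed by linarith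
    hence "card (row_bad ?V (t n) (\<kappa> / 4) y X \<inter> X `` {y}) \<le> \<kappa> / 2 * (c * x n)"
      using row y by (force simp: mult.assoc)
    hence "deficit ?V ((act ?V (rw X) ^^ Suc (t n)) (dirac y)) \<le> 2 * (\<kappa> / 4) + \<kappa> / 2"
      using large kap by (intro deficit_step_le[OF V(1) X out _ y]) auto
    thus ?thesis by simp
  qed
  have \<kappa>T: "\<kappa> + Suc (t n) / (c * x n) \<le> 1 / 4" using kap(2) large(3) by linarith
  have "2 * real n / \<eta> > 0" using n \<eta> by simp
  hence J0: "0 < J" "2 * real n / \<eta> \<le> J" unfolding J by linarith+
  \<comment> \<open>None of the error bounds grows with the number \<open>J\<close> of blocks, so a
    crude choice linear in \<open>n\<close> suffices, justified by \<open>J < 2 ^ J\<close>.\<close>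
  have Jpow: "2 * (1 / 2) ^ J \<le> \<eta> / card ?V"
  proof -
    have "2 * real n / \<eta> \<le> 2 ^ J" using J0(2) of_nat_less_two_power[of J, where 'a = real] by linarith
    thus ?thesis using n \<eta> by (simp add: V(3) power_divide field_simps)
  qed
  have bad: "card (col_bad ?V (J * Suc (t n)) \<eta> (x n) v X \<inter> X\<inverse> `` {v}) \<le> \<eta> * x n" if v: "v \<in> ?V" for v
  proof -
    interpret delete_in_arcs ?V X "c * x n" v "Suc (t n)" \<kappa>
      by unfold_locales (fact V(1), fact X, fact large(1), fact v, erule out, erule mixing, fact \<kappa>T, simp)
    have "card (col_bad ?V (J * Suc (t n)) \<eta> (x n) v X) \<le> 2 * (\<kappa> + Suc (t n) / (c * x n)) * n / \<eta> +
        card {w \<in> ?V. \<eta> * x n - 1 < \<bar>real (card (X `` {w})) - x n\<bar>}"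
      using card_col_bad_le[OF J0(1) \<eta>(1), of "x n"] by (simp only: V(3))
    also have "\<dots> \<le> exp (- 3 / \<eta>) / 2 * n + exp (- 3 / \<eta>) / 2 * n"
    proof (rule add_mono)
      have "\<kappa> + Suc (t n) / (c * x n) \<le> 2 * (\<eta> * exp (- 3 / \<eta>) / 8)"
        using large(3) kap(3) by linarith
      hence "2 * (\<kappa> + Suc (t n) / (c * x n)) * n / \<eta> \<le> 2 * (2 * (\<eta> * exp (- 3 / \<eta>) / 8)) * n / \<eta>"
        using \<eta> by (intro divide_right_mono mult_right_mono mult_left_mono) auto
      thus "2 * (\<kappa> + Suc (t n) / (c * x n)) * n / \<eta> \<le> exp (- 3 / \<eta>) / 2 * n"
        using \<eta> by simp
    qed (use atypical in linarith)
    finally have "card (col_bad ?V (J * Suc (t n)) \<eta> (x n) v X) \<le> exp (- 3 / \<eta>) * n" by (simp add: mult.commute)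
    thus ?thesis using col v by (meson linear)
  qed
  have "\<exists>!\<pi>. is_stationary ?D \<pi>"
  proof (rule is_stationary_exists_unique[OF V(1,2) X outpos])
    fix y assume "y \<in> ?V"
    thus "deficit ?V ((act ?V (rw X) ^^ Suc (t n)) (dirac y)) \<le> 1 / 4"
      using mixing[of y] kap(2) by linarith
  qed
  moreover have "\<bar>pmf \<pi> v * (real n * (real n - 1) * p n) / real (indeg ?D v) - 1\<bar> \<le> \<epsilon>0"
    if \<pi>: "is_stationary ?D \<pi>" and v: "v \<in> ?V" for \<pi> v
  proof -
    have *: "set_pmf \<pi> \<subseteq> ?V" "\<And>v. v \<in> ?V \<Longrightarrow> act ?V (rw X) (pmf \<pi>) v = pmf \<pi> v"
      using \<pi> is_stationary_iff[OF V(1) X outpos] by auto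
    \<comment> \<open>The asymptotic normalises by \<open>n * x n\<close>, but \<open>m\<close>
      carries \<open>n - 1\<close> in place of one \<open>n\<close>; the discrepancy is
      \<open>q / n\<close>.\<close>
    define q where "q = pmf \<pi> v * (real n * x n) / card (X\<inverse> `` {v})"
    have "\<bar>pmf \<pi> v * (card ?V * x n) / card (X\<inverse> `` {v}) - 1\<bar> \<le> K * \<eta> * (2 * 4 + 2) / c"
    proof (rule stationary_asymptotic[OF V(1) X c large(1) out in1 in2 mixing, where J = J])
      show "sum (pmf \<pi>) ?V = 1" using *(1) V(1) by (intro sum_pmf_eq_1)
      show "\<kappa> + Suc (t n) / (c * x n) \<le> 1 / 4" by (rule \<kappa>T)
      show "K = (4 * 4 + 1) / c + 1" by (simp add: K_def)
    qed (use \<eta> large Jpow bad *(2) v in auto)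
    hence q: "\<bar>q - 1\<bar> \<le> e" by (simp only: q_def e_def V(3))
    have "0 < real (card (X\<inverse> `` {v}))" using in1[OF v] large(1) by linarith
    hence eq: "pmf \<pi> v * (real n * (real n - 1) * p n) / real (indeg ?D v) = q - q / n"
      using n by (simp add: q_def indeg_eq field_simps)
    have "\<bar>q / n\<bar> \<le> (1 + e) / n"
      using q n by (auto simp: abs_divide intro!: divide_right_mono)
    moreover have "\<bar>q - r - 1\<bar> \<le> \<epsilon>0" if "\<bar>r\<bar> \<le> u" "u \<le> \<epsilon>0 / 2" for r u
      using that q large(7) by linarith
    ultimately show ?thesis unfolding eq using large(6) by blast
  qed
  ultimately show ?thesis by blast
qed

lemma stationary_whp:
  fixes \<epsilon>0 :: real
  assumes "0 < \<epsilon>0"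
  shows "with_high_probability p (\<lambda>n D. (\<exists>!\<pi>. is_stationary D \<pi>) \<and>
    (\<forall>\<pi>. is_stationary D \<pi> \<longrightarrow> (\<forall>v \<in> pverts D.
      \<bar>pmf \<pi> v * (real n * (real n - 1) * p n) / real (indeg D v) - 1\<bar> \<le> \<epsilon>0)))"
proof -
  define K where "K = (4 * 4 + 1) / c + 1"
  have K: "0 < K" using c by (simp add: K_def add_pos_pos)
  \<comment> \<open>The second entry permits absorbing the maximum of \<pi>. The third makes the
    final error at most half of \<open>\<epsilon>0\<close>, with \<open>20 = 2 * (2 * 4 + 2)\<close>
    for the in-degree constant 4.\<close>
  define \<eta> where "\<eta> = min 1 (min (1 / (2 * K)) (\<epsilon>0 * c / (20 * K)))"
  have \<eta>: "0 < \<eta>" "\<eta> \<le> 1" using K c assms by (auto simp: \<eta>_def)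
  have "\<eta> \<le> 1 / (2 * K)" "\<eta> \<le> \<epsilon>0 * c / (20 * K)" by (auto simp: \<eta>_def)
  hence \<eta>K: "K * \<eta> \<le> 1 / 2" "K * \<eta> \<le> \<epsilon>0 * c / 20" using K by (auto simp: field_simps)
  define e where "e = K * \<eta> * (2 * 4 + 2) / c"
  have e: "e \<le> \<epsilon>0 / 2" using \<eta>K(2) c by (simp add: e_def field_simps)
  \<comment> \<open>The second bound keeps the vertices of wrong mass below half of
    \<open>exp (- 3 / \<eta>) * n\<close>; the other half is reserved for atypical
    out-degrees.\<close>
  define \<kappa> where "\<kappa> = min (1 / 8) (\<eta> * exp (- 3 / \<eta>) / 8)"
  have \<kappa>: "0 < \<kappa>" "\<kappa> \<le> 1 / 8" "\<kappa> \<le> \<eta> * exp (- 3 / \<eta>) / 8" using \<eta> by (auto simp: \<kappa>_def)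
  \<comment> \<open>Among at least \<open>c * x n\<close> out-neighbours, \<open>h * x n\<close> bad
    ones are a proportion \<open>\<kappa> / 2\<close>, the share of the deficit allotted to the
    first step.\<close>
  define h where "h = \<kappa> / 2 * c"
  have h: "0 < h" using \<kappa> c by (simp add: h_def)
  define J where "J n = nat \<lceil>2 * real n / \<eta>\<rceil>" for n
  define Bad where "Bad n X \<longleftrightarrow>
    (\<exists>a\<in>vertices n. card (X `` {a}) \<le> c * x n) \<or> (\<exists>a\<in>vertices n. card (X\<inverse> `` {a}) \<le> c * x n) \<or>
    (\<exists>a\<in>vertices n. 4 * x n < card (X\<inverse> `` {a})) \<or>
    (exp (- 3 / h) * n < card {y \<in> vertices n.
      \<kappa> / 4 < deficit (vertices n) ((act (vertices n) (rw X) ^^ t n) (dirac y))}) \<or>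
    (\<exists>v\<in>vertices n. card (row_bad (vertices n) (t n) (\<kappa> / 4) v X) \<le> exp (- 3 / h) * n \<and>
      h * x n \<le> card (row_bad (vertices n) (t n) (\<kappa> / 4) v X \<inter> X `` {v})) \<or>
    (exp (- 3 / \<eta>) / 2 * n < card {w \<in> vertices n. \<eta> * x n - 1 < \<bar>real (card (X `` {w})) - x n\<bar>}) \<or>
    (\<exists>v\<in>vertices n. card (col_bad (vertices n) (J n * Suc (t n)) \<eta> (x n) v X) \<le> exp (- 3 / \<eta>) * n \<and>
      \<eta> * x n \<le> card (col_bad (vertices n) (J n * Suc (t n)) \<eta> (x n) v X \<inter> X\<inverse> `` {v}))" for n X
  have neg: "negligible p Bad"
    unfolding Bad_def[abs_def] using \<kappa> h \<eta>
    by (intro negligible_disj negligible_low_outdeg negligible_low_indeg negligible_large_indeg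
        negligible_unmixed negligible_row_bad negligible_atypical_outdeg negligible_col_bad p lim_exp_x x_at_top) auto
  have inv_x: "(\<lambda>n. 1 / x n) \<longlonglongrightarrow> 0"
  proof -
    have "((\<lambda>y::real. 1 / y) \<longlongrightarrow> 0) at_top" by real_asymp
    thus ?thesis using x_at_top by (rule filterlim_compose)
  qed
  have T_x: "(\<lambda>n. Suc (t n) / x n) \<longlonglongrightarrow> 0"
    using tendsto_add[OF t_div_x inv_x] by (simp add: add_divide_distrib add.commute)
  have small: "\<forall>\<^sub>F n in sequentially. Suc (t n) / x n < b" if "0 < b" for b
    using order_tendstoD(2)[OF T_x that] .
  have pos: "0 < c * \<kappa> / 4" "0 < \<eta> * c / 10" using c \<kappa> \<eta> by auto
  have inv_n: "\<forall>\<^sub>F n in sequentially. (1 + e) / real n < \<epsilon>0 / 2"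
  proof (rule order_tendstoD(2)[of _ 0])
    show "(\<lambda>n. (1 + e) / real n) \<longlonglongrightarrow> 0" by real_asymp
  qed (use assms in simp)
  show ?thesis
  proof (rule with_high_probability_if_negligible, rule negligible_mono[OF neg])
    show "\<forall>\<^sub>F n in sequentially. \<forall>X\<subseteq>arc_pairs (vertices n).
      \<not> ((\<exists>!\<pi>. is_stationary \<lparr>pverts = vertices n, parcs = X\<rparr> \<pi>) \<and>
        (\<forall>\<pi>. is_stationary \<lparr>pverts = vertices n, parcs = X\<rparr> \<pi> \<longrightarrow>
          (\<forall>v \<in> pverts \<lparr>pverts = vertices n, parcs = X\<rparr>.
            \<bar>pmf \<pi> v * (real n * (real n - 1) * p n) / real (indeg \<lparr>pverts = vertices n, parcs = X\<rparr> v) - 1\<bar> \<le> \<epsilon>0))) \<longrightarrow>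
      Bad n X"
      using eventually_x_ge[of "max (2 / c) (1 / \<eta>)"] small[OF pos(1)] small[OF pos(2)] inv_n eventually_gt_at_top[of 0]
    proof (eventually_elim)
      case (elim n)
      have cx: "2 \<le> c * x n" using elim(1) c by (simp add: field_simps)
      hence x: "0 < x n" using c by (metis less_le_trans zero_less_mult_pos zero_less_numeral)
      have \<eta>x: "1 \<le> \<eta> * x n" using elim(1) \<eta> by (simp add: field_simps)
      have T: "Suc (t n) / (c * x n) \<le> \<kappa> / 4"
        using elim(2) c x by (simp add: field_simps)
      have "t n / (c * x n) \<le> Suc (t n) / (c * x n)" using cx by (intro divide_right_mono) auto
      hence t: "t n / (c * x n) \<le> \<kappa> / 4" using T by linarith
      have "5 * Suc (t n) / (c * x n - 1) \<le> 5 * Suc (t n) / (c * x n / 2)"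
        using cx by (intro divide_left_mono) auto
      also have "\<dots> \<le> \<eta>" using elim(3) c x by (simp add: field_simps)
      finally have T5: "5 * Suc (t n) / (c * x n - 1) \<le> \<eta>" .
      have T': "Suc (t n) / (c * x n) \<le> \<kappa>" using T \<kappa>(1) by linarith
      show ?case
      proof (intro allI impI, rule ccontr)
        fix X assume X: "X \<subseteq> arc_pairs (vertices n)" and good: "\<not> Bad n X"
          and contra: "\<not> ((\<exists>!\<pi>. is_stationary \<lparr>pverts = vertices n, parcs = X\<rparr> \<pi>) \<and>
        (\<forall>\<pi>. is_stationary \<lparr>pverts = vertices n, parcs = X\<rparr> \<pi> \<longrightarrow>
          (\<forall>v \<in> pverts \<lparr>pverts = vertices n, parcs = X\<rparr>.
            \<bar>pmf \<pi> v * (real n * (real n - 1) * p n) / real (indeg \<lparr>pverts = vertices n, parcs = X\<rparr> v) - 1\<bar> \<le> \<epsilon>0)))"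
        have "(\<exists>!\<pi>. is_stationary \<lparr>pverts = vertices n, parcs = X\<rparr> \<pi>) \<and>
          (\<forall>\<pi>. is_stationary \<lparr>pverts = vertices n, parcs = X\<rparr> \<pi> \<longrightarrow> (\<forall>v \<in> vertices n.
          \<bar>pmf \<pi> v * (real n * (real n - 1) * p n) / real (indeg \<lparr>pverts = vertices n, parcs = X\<rparr> v) - 1\<bar> \<le> \<epsilon>0))"
        proof (rule stationary_if_typical[where \<beta>r = "exp (- 3 / (\<kappa> / 2 * c))" and J = "J n" and \<eta> = \<eta> and \<kappa> = \<kappa>])
          show "0 < n" by (rule elim(5))
          show "(1 + ((4 * 4 + 1) / c + 1) * \<eta> * (2 * 4 + 2) / c) / real n \<le> \<epsilon>0 / 2"
            using elim(4) unfolding e_def K_def by (rule less_imp_le)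
          show "((4 * 4 + 1) / c + 1) * \<eta> * (2 * 4 + 2) / c \<le> \<epsilon>0 / 2"
            using e unfolding e_def K_def .
          show "((4 * 4 + 1) / c + 1) * \<eta> \<le> 1 / 2" using \<eta>K(1) unfolding K_def .
          show "J n = nat \<lceil>2 * real n / \<eta>\<rceil>" by (rule J_def)
        qed (insert X \<eta>(1) \<kappa> cx t T' T5 \<eta>x good[unfolded Bad_def h_def de_Morgan_disj],
            (elim conjE, assumption)+)
        thus False using contra by simp
      qed
    qed
  qed
qed

end

text \<open>For large \<open>n\<close>, with \<open>L = ln n\<close> the expression is
  \<open>x n ^ k * exp (- \<gamma> n)\<close>, where \<open>x n \<le> L * (1 + \<gamma> n)\<close>.
  Half of the exponent absorbs \<open>(1 + \<gamma> n) ^ k\<close>; as eventually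
  \<open>\<gamma> n \<ge> (2 * k + 2) * ln L\<close>, the other half is at most
  \<open>1 / L ^ (k + 1)\<close> and absorbs \<open>L ^ k\<close> with one power to spare.\<close>

lemma pow_exp_minus_tendsto_0:
  fixes x \<gamma> :: "nat \<Rightarrow> real"
  assumes "\<And>n. \<gamma> n = x n - ln n"
    and "filterlim (\<lambda>n. \<gamma> n / ln (ln (real n))) at_top sequentially"
  shows "(\<lambda>n. n * x n ^ k * exp (- x n)) \<longlonglongrightarrow> 0"
proof (rule tendsto_sandwich[where f = "\<lambda>_. 0"])
  \<comment> \<open>A value of at least \<open>2 * k\<close> gives
    \<open>(1 + \<gamma> n) ^ k \<le> b ^ k * exp (\<gamma> n / 2)\<close>; the extra 1 keeps it
    positive for \<open>k = 0\<close>.\<close>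
  define b where "b = real (2 * k + 1)"
  have b: "1 \<le> b" by (simp add: b_def)
  show "(\<lambda>n. b ^ k / ln (real n)) \<longlonglongrightarrow> 0" by real_asymp
  have ev: "\<forall>\<^sub>F n in sequentially. real (2 * k + 2) \<le> \<gamma> n / ln (ln (real n))"
    using assms(2) by (simp add: filterlim_at_top)
  have ln_ev: "\<forall>\<^sub>F n in sequentially. 1 < ln (real n)" by real_asymp
  have both: "\<forall>\<^sub>F n in sequentially. 0 \<le> n * x n ^ k * exp (- x n) \<and> n * x n ^ k * exp (- x n) \<le> b ^ k / ln (real n)"
    using ev ln_ev eventually_gt_at_top[of 0]
  proof eventually_elim
    case (elim n)
    define L where "L = ln (real n)"
    have L: "1 < L" using elim(2) by (simp add: L_def)
    have lnL: "0 < ln L" using L by simp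
    have \<gamma>: "real (2 * k + 2) * ln L \<le> \<gamma> n" using elim(1) lnL by (simp add: L_def field_simps)
    hence \<gamma>0: "0 \<le> \<gamma> n" using lnL by (meson less_imp_le mult_nonneg_nonneg of_nat_0_le_iff order.trans)
    have x: "x n = L + \<gamma> n" using assms(1) by (simp add: L_def)
    have "L * 1 + 1 * \<gamma> n \<le> L * 1 + L * \<gamma> n" using L \<gamma>0 by (intro add_left_mono mult_right_mono) auto
    hence xle: "x n \<le> L * (1 + \<gamma> n)" by (simp add: x distrib_left)
    have "1 + \<gamma> n \<le> b * (1 + \<gamma> n / b)" using b by (simp add: distrib_left)
    also have "\<dots> \<le> b * exp (\<gamma> n / b)" using b by (intro mult_left_mono exp_ge_add_one_self) auto
    finally have "(1 + \<gamma> n) ^ k \<le> (b * exp (\<gamma> n / b)) ^ k" using \<gamma>0 by (intro power_mono) auto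
    also have "\<dots> = b ^ k * exp (k * (\<gamma> n / b))" by (simp only: power_mult_distrib exp_of_nat_mult)
    also have "\<dots> \<le> b ^ k * exp (\<gamma> n / 2)"
    proof -
      have "k * (\<gamma> n / b) = \<gamma> n * (k / b)" by simp
      also have "\<dots> \<le> \<gamma> n * (1 / 2)" using \<gamma>0 by (intro mult_left_mono) (auto simp: b_def field_simps)
      finally show ?thesis using b by simp
    qed
    finally have 1: "(1 + \<gamma> n) ^ k \<le> b ^ k * exp (\<gamma> n / 2)" .
    have "exp (- (\<gamma> n / 2)) \<le> exp (- (real (Suc k) * ln L))" using \<gamma> by (simp add: algebra_simps)
    also have "\<dots> = 1 / L ^ Suc k" using L by (simp only: exp_minus exp_of_nat_mult) (simp add: inverse_eq_divide)
    finally have 2: "exp (- (\<gamma> n / 2)) \<le> 1 / L ^ Suc k" .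
    have "real n = exp L" using elim(3) by (simp add: L_def)
    hence "n * x n ^ k * exp (- x n) = x n ^ k * (exp L * exp (- x n))" by simp
    also have "exp L * exp (- x n) = exp (- (\<gamma> n / 2)) * exp (- (\<gamma> n / 2))"
      by (simp add: x flip: exp_add)
    also have "x n ^ k * \<dots> \<le> (L * (1 + \<gamma> n)) ^ k * \<dots>"
      using xle x L \<gamma>0 by (intro mult_right_mono power_mono) auto
    also have "\<dots> = L ^ k * (1 + \<gamma> n) ^ k * exp (- (\<gamma> n / 2)) * exp (- (\<gamma> n / 2))"
      by (simp add: power_mult_distrib)
    also have "\<dots> \<le> L ^ k * (b ^ k * exp (\<gamma> n / 2)) * exp (- (\<gamma> n / 2)) * (1 / L ^ Suc k)"
      using 1 2 L \<gamma>0 b by (intro mult_mono mult_left_mono) auto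
    also have "\<dots> = b ^ k * (exp (\<gamma> n / 2) * exp (- (\<gamma> n / 2))) * (L ^ k * (1 / L ^ Suc k))" by simp
    also have "exp (\<gamma> n / 2) * exp (- (\<gamma> n / 2)) = 1" by (simp flip: exp_add)
    also have "L ^ k * (1 / L ^ Suc k) = 1 / L" using L by simp
    finally have "n * x n ^ k * exp (- x n) \<le> b ^ k / L" by simp
    moreover have "0 \<le> n * x n ^ k * exp (- x n)" using x L \<gamma>0 by auto
    ultimately show ?case by (simp add: L_def)
  qed
  show "\<forall>\<^sub>F n in sequentially. 0 \<le> n * x n ^ k * exp (- x n)"
    using both by eventually_elim blast
  show "\<forall>\<^sub>F n in sequentially. n * x n ^ k * exp (- x n) \<le> b ^ k / ln (real n)"
    using both by eventually_elim blast
qed simp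

text \<open>Nonempty in-neighbourhoods are part of the conclusion because the maximum in
  \<open>varsigma_star\<close> is specified only for them. Existence and uniqueness of the
  stationary distribution are included so that the quantification over \<pi> is not vacuous.\<close>

theorem mainTheorem3:
  fixes p d \<gamma> m :: "nat \<Rightarrow> real"
  assumes "\<And>n. 0 \<le> p n \<and> p n \<le> 1"
    and "\<forall>\<^sub>F n in sequentially. real n * p n = d n * ln (real n)"
    and "\<And>n. \<gamma> n = real n * p n - ln (real n)"
    and "\<And>n. m n = real n * (real n - 1) * p n"
    and "filterlim (\<lambda>n. \<gamma> n / ln (ln (real n))) at_top sequentially"
  shows "(\<exists>\<epsilon> :: nat \<Rightarrow> real. \<epsilon> \<longlonglongrightarrow> 0 \<and>
            with_high_probability p (\<lambda>n D. \<forall>v \<in> pverts D.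
              in_nbrs D v \<noteq> {} \<and> varsigma_star D v \<le> \<epsilon> n * real (indeg D v)))
       \<and> (\<forall>\<delta> > 0. (\<forall>\<^sub>F n in sequentially. d n = 1 + \<delta>) \<longrightarrow>
            (\<exists>c > 0. with_high_probability p (\<lambda>n D. real (min_outdeg D) \<ge> c * ln (real n)))
          \<and> (\<exists>\<epsilon> :: nat \<Rightarrow> real. \<epsilon> \<longlonglongrightarrow> 0 \<and>
               with_high_probability p (\<lambda>n D. (\<exists>!\<pi>. is_stationary D \<pi>) \<and>
                 (\<forall>\<pi>. is_stationary D \<pi> \<longrightarrow>
                   (\<forall>v \<in> pverts D. \<bar>pmf \<pi> v * m n / real (indeg D v) - 1\<bar> \<le> \<epsilon> n)))))"
proof (intro conjI allI impI)
  have p: "\<And>n. 0 \<le> p n" "\<And>n. p n \<le> 1" using assms(1) by auto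
  have "\<forall>\<^sub>F n in sequentially. 0 \<le> \<gamma> n / ln (ln (real n))"
    using assms(5) by (simp add: filterlim_at_top)
  moreover have "\<forall>\<^sub>F n in sequentially. 1 < ln (real n)" by real_asymp
  ultimately have large: "\<forall>\<^sub>F n in sequentially. 1 \<le> real n * p n"
  proof eventually_elim
    case (elim n)
    hence "0 \<le> \<gamma> n" by (simp add: zero_le_divide_iff)
    thus ?case using elim(2) assms(3)[of n] by linarith
  qed
  show "\<exists>\<epsilon> :: nat \<Rightarrow> real. \<epsilon> \<longlonglongrightarrow> 0 \<and> with_high_probability p (\<lambda>n D. \<forall>v \<in> pverts D.
      in_nbrs D v \<noteq> {} \<and> varsigma_star D v \<le> \<epsilon> n * real (indeg D v))"
    using pow_exp_minus_tendsto_0[OF assms(3,5)]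
    by (intro with_high_probability_diagonal[where P = "\<lambda>n D \<epsilon>. \<forall>v \<in> pverts D.
      in_nbrs D v \<noteq> {} \<and> varsigma_star D v \<le> \<epsilon> * real (indeg D v)"] varsigma_star_whp p large)
  fix \<delta> :: real
  assume \<delta>: "\<delta> > 0" and d: "\<forall>\<^sub>F n in sequentially. d n = 1 + \<delta>"
  have np: "\<forall>\<^sub>F n in sequentially. real n * p n = (1 + \<delta>) * ln (real n)"
    using assms(2) d by eventually_elim simp
  obtain c s where cs: "0 < c" "0 < s" "s \<le> 1" "(1 + \<delta>) * (1 - s + c * ln s) = 1 + \<delta> / 2"
    using low_degree_constants[OF \<delta>] by blast
  interpret supercritical p \<delta> c s
    using p \<delta> np cs by unfold_locales auto
  show "\<exists>c > 0. with_high_probability p (\<lambda>n D. real (min_outdeg D) \<ge> c * ln (real n))"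
    using cs(1) min_outdeg_whp by blast
  show "\<exists>\<epsilon> :: nat \<Rightarrow> real. \<epsilon> \<longlonglongrightarrow> 0 \<and> with_high_probability p (\<lambda>n D. (\<exists>!\<pi>. is_stationary D \<pi>) \<and>
      (\<forall>\<pi>. is_stationary D \<pi> \<longrightarrow> (\<forall>v \<in> pverts D. \<bar>pmf \<pi> v * m n / real (indeg D v) - 1\<bar> \<le> \<epsilon> n)))"
    unfolding assms(4)
    by (rule with_high_probability_diagonal[where P = "\<lambda>n D \<epsilon>. (\<exists>!\<pi>. is_stationary D \<pi>) \<and>
      (\<forall>\<pi>. is_stationary D \<pi> \<longrightarrow> (\<forall>v \<in> pverts D.
        \<bar>pmf \<pi> v * (real n * (real n - 1) * p n) / real (indeg D v) - 1\<bar> \<le> \<epsilon>))", OF stationary_whp])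
qed

end
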